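(* Let $G:I\times[0,1]\to I$, $G(\cdot,t)=g_t$, be a $C^2$ family of $C^2$ unimodal maps such that $g_0$ has a parabolic periodic orbit which attracts, but is disjoint from, the critical orbit of $g_0$. Let $h(t)=h_{\mathrm{top}}(g_t)$. Then $$\mathrm{H\ddot{o}l}(h,0)=\infty.$$
   Context: $I=[-1,1]$. A continuous map $g:I\to I$ is unimodal if $g(\partial I)\subset\partial I$ and $g$ has exactly one turning point $c$, with $c\in I\setminus\partial I$. Here the unimodal maps are smooth unimodal: $C^1$ (in fact $C^2$) with $c$ the unique (critical) point where $g'=0$. The critical orbit is the forward orbit of $c$. A periodic orbit of period $k$ is parabolic if $(g^k)'$ equals $1$ or $-1$ on it. The periodic orbit attracts the critical orbit if the iterates of the critical point converge to the periodic orbit. A real map $u:J\to\mathbb R$ on an interval $J$ is $\beta$-Hölder continuous at $x\in J$ ($\beta>0$) if there is $C>0$ with $|u(y)-u(x)|\le C|y-x|^\beta$ for all $y\in J$, and $\mathrm{H\ddot{o}l}(u,x):=\sup\{\beta>0: u\text{ is }\beta\text{-Hölder continuous at }x\}$. *)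

theory Defs
  imports "HOL-Analysis.Analysis"
begin

(* Derivatives are taken within S, hence are one-sided at boundary points. They are unique on
   the sets used below (compact intervals and rectangles). *)
definition C1_on :: "'a::real_normed_vector set \<Rightarrow> ('a \<Rightarrow> 'b::real_normed_vector) \<Rightarrow> bool" where
  "C1_on S f \<longleftrightarrow>
     (\<exists>f' :: 'a \<Rightarrow> 'a \<Rightarrow>\<^sub>L 'b.
        (\<forall>x\<in>S. (f has_derivative blinfun_apply (f' x)) (at x within S)) \<and> continuous_on S f')"

definition C2_on :: "'a::real_normed_vector set \<Rightarrow> ('a \<Rightarrow> 'b::real_normed_vector) \<Rightarrow> bool" where
  "C2_on S f \<longleftrightarrow>
     (\<exists>f' :: 'a \<Rightarrow> 'a \<Rightarrow>\<^sub>L 'b.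
        (\<forall>x\<in>S. (f has_derivative blinfun_apply (f' x)) (at x within S)) \<and> C1_on S f')"

definition turning_point :: "(real \<Rightarrow> real) \<Rightarrow> real \<Rightarrow> bool" where
  "turning_point g c \<longleftrightarrow>
     c \<in> {-1<..<1} \<and>
     ((\<forall>\<^sub>F x in at c. g x \<le> g c) \<or> (\<forall>\<^sub>F x in at c. g c \<le> g x))"

definition unimodal :: "(real \<Rightarrow> real) \<Rightarrow> bool" where
  "unimodal g \<longleftrightarrow>
     continuous_on {-1..1} g \<and> g ` {-1..1} \<subseteq> {-1..1} \<and> g ` {-1, 1} \<subseteq> {-1, 1} \<and>
     (\<exists>!c. turning_point g c)"

definition C2_unimodal :: "(real \<Rightarrow> real) \<Rightarrow> bool" where
  "C2_unimodal g \<longleftrightarrow>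
     unimodal g \<and> C2_on {-1..1} g \<and>
     (\<forall>x\<in>{-1..1}. (g has_real_derivative 0) (at x within {-1..1}) \<longleftrightarrow> turning_point g x)"

definition forward_orbit :: "('a \<Rightarrow> 'a) \<Rightarrow> 'a \<Rightarrow> 'a set" where
  "forward_orbit g x = range (\<lambda>n. (g ^^ n) x)"

(* k is the minimal period. *)
definition periodic_orbit :: "(real \<Rightarrow> real) \<Rightarrow> nat \<Rightarrow> real set \<Rightarrow> bool" where
  "periodic_orbit g k P \<longleftrightarrow>
     k > 0 \<and>
     (\<exists>p\<in>{-1..1}. (g ^^ k) p = p \<and> (\<forall>j. 0 < j \<and> j < k \<longrightarrow> (g ^^ j) p \<noteq> p) \<and>
        P = forward_orbit g p)"

definition parabolic_orbit :: "(real \<Rightarrow> real) \<Rightarrow> nat \<Rightarrow> real set \<Rightarrow> bool" where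
  "parabolic_orbit g k P \<longleftrightarrow>
     periodic_orbit g k P \<and>
     (\<forall>x\<in>P. ((g ^^ k) has_real_derivative 1) (at x within {-1..1}) \<or>
            ((g ^^ k) has_real_derivative -1) (at x within {-1..1}))"

definition attracts :: "(real \<Rightarrow> real) \<Rightarrow> real set \<Rightarrow> real \<Rightarrow> bool" where
  "attracts g P x \<longleftrightarrow> (\<lambda>n. infdist ((g ^^ n) x) P) \<longlonglongrightarrow> 0"

definition separated_sets :: "('a::metric_space \<Rightarrow> 'a) \<Rightarrow> 'a set \<Rightarrow> nat \<Rightarrow> real \<Rightarrow> 'a set set" where
  "separated_sets f X n \<epsilon> =
     {E. finite E \<and> E \<subseteq> X \<and>
         (\<forall>x\<in>E. \<forall>y\<in>E. x \<noteq> y \<longrightarrow> (\<exists>i<n. dist ((f ^^ i) x) ((f ^^ i) y) > \<epsilon>))}"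

(* Topological entropy of f on X (f continuous, X compact, f ` X \<subseteq> X), in Bowen's form. The
   inner limsup is monotone in \<epsilon>, so its supremum over \<epsilon> > 0 is its limit as \<epsilon> tends to 0.
   The empty set contributes ln 0 / n = 0, the same as a singleton. *)
definition top_entropy :: "('a::metric_space \<Rightarrow> 'a) \<Rightarrow> 'a set \<Rightarrow> ereal" where
  "top_entropy f X =
     (SUP \<epsilon>\<in>{0<..}. limsup (\<lambda>n. SUP E\<in>separated_sets f X n \<epsilon>. ereal (ln (real (card E)) / real n)))"

definition hoelder_at :: "real \<Rightarrow> real set \<Rightarrow> (real \<Rightarrow> real) \<Rightarrow> real \<Rightarrow> bool" where
  "hoelder_at \<beta> J u x \<longleftrightarrow> (\<exists>C>0. \<forall>y\<in>J. \<bar>u y - u x\<bar> \<le> C * \<bar>y - x\<bar> powr \<beta>)"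

definition Hoel :: "real set \<Rightarrow> (real \<Rightarrow> real) \<Rightarrow> real \<Rightarrow> ereal" where
  "Hoel J u x = (SUP \<beta>\<in>{\<beta>. \<beta> > 0 \<and> hoelder_at \<beta> J u x}. ereal \<beta>)"

(* The conversion to real loses nothing for the maps at hand: a unimodal map has entropy at
   most ln 2. *)
definition family_entropy :: "(real \<times> real \<Rightarrow> real) \<Rightarrow> real \<Rightarrow> real" where
  "family_entropy G t = real_of_ereal (top_entropy (\<lambda>x. G (x, t)) {-1..1})"

end

theory Submission
  imports Defs
begin

text \<open>
  The entropy of a unimodal map is encoded in the itinerary of its critical point, and the
  dependence is exponentially precise: if the itinerary of a map is eventually periodic, then every
  unimodal map whose critical itinerary agrees with it for \<open>n\<close> steps has an entropy that differs by at
  most \<open>C * \<rho> ^ n\<close>, for some \<open>\<rho> < 1\<close> (\<open>entropy_exponentially_close\<close>).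

  Let the critical orbit of \<open>g 0\<close> tend to a cycle along which the derivatives multiply to \<open>1\<close> or \<open>-1\<close>.
  For every \<open>\<eta> > 0\<close> there is a metric near the cycle in which one step of \<open>g t\<close>, for small \<open>t\<close>, expands
  distances by at most \<open>1 + \<eta>\<close>. The critical orbits of \<open>g t\<close> and \<open>g 0\<close> start a distance of order \<open>t\<close>
  apart. So they stay close for about \<open>ln (1 / t) / ln (1 + \<eta>)\<close> steps (\<open>shadowing\<close>), and since the
  critical orbit of \<open>g 0\<close> keeps away from the critical point, the itineraries agree during this time
  (\<open>long_agreement\<close>). The entropies then differ by at most a constant times \<open>t\<close> to the power
  \<open>ln (1 / \<rho>) / ln (1 + \<eta>)\<close>, and this exponent is as large as desired when \<open>\<eta>\<close> is small
  (\<open>entropy_flat\<close>). Hence every Hoelder exponent is attained at \<open>0\<close>.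

  The exponential precision comes from the kneading theory of Milnor and Thurston. Let \<open>\<gamma> n\<close> count the
  points that visit the critical point for the first time at time \<open>n\<close>, and let \<open>\<theta> n = \<plusminus>1\<close> be the signs of
  the critical itinerary. The power series \<open>\<Gamma>\<close> and \<open>D\<close> with coefficients \<open>\<gamma>\<close> and \<open>\<theta>\<close> satisfy
  \<open>(1 - x) * \<Gamma> x * D x = 1\<close> (\<open>kneading_product\<close>). The entropy \<open>ln s\<close> is the growth rate of the number of
  laps of the iterates, so \<open>D\<close> is positive on \<open>[0, 1 / s)\<close> and, if \<open>s > 1\<close>, vanishes at \<open>1 / s\<close>.
  Maps whose first \<open>n\<close> signs agree have determinants that differ by at most \<open>2 * x ^ n / (1 - x)\<close>.

  If \<open>s > 1\<close> and the signs are eventually periodic, \<open>D\<close> is a nonzero rational function. Its zero at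
  \<open>1 / s\<close> has finite order, and an exponentially small perturbation moves it by an exponentially small
  amount. If \<open>s = 1\<close> there is no zero to follow, and the same argument would only give a bound of order
  \<open>ln n / n\<close>. Instead the entropy is locally constant: a map with growth \<open>s > 1\<close> has
  the critical itinerary of the tent map of slope \<open>s\<close>, and as \<open>s\<close> tends to \<open>1\<close> this itinerary converges to
  the period doubling sequence, which is not eventually periodic (\<open>growth_one_stable\<close>).
\<close>

section \<open>Unimodal maps and their laps\<close>

text \<open>
  The normal form is increasing and then decreasing, with both end points sent to \<open>-1\<close>. Maps of the
  other orientation are conjugate to it by \<open>x \<mapsto> - x\<close>.
\<close>

locale unimodal_map =
  fixes f :: "real \<Rightarrow> real" and c :: real
  assumes cont: "continuous_on {-1..1} f"
    and ends: "f (-1) = -1" "f 1 = -1"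
    and crit: "-1 < c" "c < 1" "f c \<le> 1"
    and incr: "\<And>x y. -1 \<le> x \<Longrightarrow> x < y \<Longrightarrow> y \<le> c \<Longrightarrow> f x < f y"
    and decr: "\<And>x y. c \<le> x \<Longrightarrow> x < y \<Longrightarrow> y \<le> 1 \<Longrightarrow> f y < f x"
begin

lemma f_ge: "x \<in> {-1..1} \<Longrightarrow> -1 \<le> f x"
  using incr[of "-1" x] decr[of x 1] ends by (cases "x \<le> c"; cases "x = -1"; cases "x = 1") auto

lemma f_less_crit: "x \<in> {-1..1} \<Longrightarrow> x \<noteq> c \<Longrightarrow> f x < f c"
  using incr[of x c] decr[of c x] by (cases "x < c") auto

lemma f_le_crit: "x \<in> {-1..1} \<Longrightarrow> f x \<le> f c"
  using f_less_crit[of x] by (cases "x = c") auto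

lemma f_in: "x \<in> {-1..1} \<Longrightarrow> f x \<in> {-1..1}"
  using f_ge[of x] f_le_crit[of x] crit(3) by auto

lemma c_in: "c \<in> {-1..1}" using crit by auto

lemma iter_in: "x \<in> {-1..1} \<Longrightarrow> (f ^^ n) x \<in> {-1..1}"
  by (induction n) (use f_in in auto)

lemma iter_cont: "continuous_on {-1..1} (f ^^ n)"
proof (induction n)
  case (Suc n)
  have "continuous_on {-1..1} (f \<circ> (f ^^ n))"
    by (rule continuous_on_compose[OF Suc]) (rule continuous_on_subset[OF cont], use iter_in in blast)
  then show ?case by simp
qed (auto simp: id_def)

lemma left_surj: assumes "-1 \<le> z" "z \<le> f c" obtains x where "-1 \<le> x" "x \<le> c" "f x = z"
  using IVT'[of f "-1" z c] assms ends crit continuous_on_subset[OF cont, of "{-1..c}"] by auto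

lemma right_surj: assumes "-1 \<le> z" "z \<le> f c" obtains x where "c \<le> x" "x \<le> 1" "f x = z"
  using IVT2'[of f 1 z c] assms ends crit continuous_on_subset[OF cont, of "{c..1}"] by auto

text \<open>
  The points of \<open>hits n\<close> are the turning points of \<open>f ^^ n\<close>; they cut the interval into its laps.
\<close>

definition hits :: "nat \<Rightarrow> real set" where
  "hits n = {x \<in> {-1..1}. \<exists>i<n. (f ^^ i) x = c}"

definition monotone_piece :: "nat \<Rightarrow> real \<Rightarrow> real \<Rightarrow> bool" where
  "monotone_piece n x y \<longleftrightarrow>
     (\<forall>a b. x \<le> a \<longrightarrow> a < b \<longrightarrow> b \<le> y \<longrightarrow> (f ^^ n) a < (f ^^ n) b) \<or>
     (\<forall>a b. x \<le> a \<longrightarrow> a < b \<longrightarrow> b \<le> y \<longrightarrow> (f ^^ n) b < (f ^^ n) a)"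

lemma hits_mono: "m \<le> n \<Longrightarrow> hits m \<subseteq> hits n"
  unfolding hits_def by force

lemma iter_segment:
  assumes "x \<in> {-1..1}" "y \<in> {-1..1}" "x \<le> y"
    and "min ((f ^^ n) x) ((f ^^ n) y) \<le> z" "z \<le> max ((f ^^ n) x) ((f ^^ n) y)"
  obtains w where "x \<le> w" "w \<le> y" "(f ^^ n) w = z"
proof -
  have ct: "continuous_on {x..y} (f ^^ n)"
    using assms by (intro continuous_on_subset[OF iter_cont]) auto
  show ?thesis
  proof (cases "(f ^^ n) x \<le> (f ^^ n) y")
    case True
    then show ?thesis using IVT'[of "f ^^ n" x z y, OF _ _ _ ct] assms that by auto
  next
    case False
    then show ?thesis using IVT2'[of "f ^^ n" y z x, OF _ _ _ ct] assms that by auto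
  qed
qed

text \<open>
  An iterate folds only at points that visit the critical point earlier: between two such points the
  image of the segment lies on one side of \<open>c\<close>, where \<open>f\<close> is monotone.
\<close>

lemma monotone_pieceI:
  assumes "x \<in> {-1..1}" "y \<in> {-1..1}" "{x<..<y} \<inter> hits n = {}"
  shows "monotone_piece n x y"
  using assms(3)
proof (induction n)
  case 0
  then show ?case by (auto simp: monotone_piece_def)
next
  case (Suc n)
  have "{x<..<y} \<inter> hits n = {}" using Suc.prems hits_mono[of n "Suc n"] by auto
  then have piece: "monotone_piece n x y" by (rule Suc.IH)
  have avoid: "(f ^^ n) w \<noteq> c" if "x < w" "w < y" for w
  proof
    assume "(f ^^ n) w = c"
    then have "w \<in> hits (Suc n)" using that assms(1,2) by (auto simp: hits_def intro!: exI[of _ n])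
    then show False using that Suc.prems by auto
  qed
  show ?case
  proof (cases "x < y")
    case False
    then show ?thesis by (auto simp: monotone_piece_def)
  next
    case True
    have side: "max ((f ^^ n) x) ((f ^^ n) y) \<le> c \<or> c \<le> min ((f ^^ n) x) ((f ^^ n) y)"
    proof (rule ccontr)
      assume neg: "\<not> ?thesis"
      then obtain w where w: "x \<le> w" "w \<le> y" "(f ^^ n) w = c"
        using iter_segment[of x y n c] assms True by (metis less_eq_real_def linorder_not_le)
      with neg have "w \<noteq> x" "w \<noteq> y" by (auto simp: max_def min_def split: if_splits)
      then show False using w avoid[of w] by auto
    qed
    have bnd: "(f ^^ n) a \<in> {-1..1}" if "x \<le> a" "a \<le> y" for a
      using that assms by (intro iter_in) auto
    have between: "min ((f ^^ n) x) ((f ^^ n) y) \<le> (f ^^ n) a \<and> (f ^^ n) a \<le> max ((f ^^ n) x) ((f ^^ n) y)"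
      if "x \<le> a" "a \<le> y" for a
      using piece that unfolding monotone_piece_def
      by (smt (verit, best))
    from side show ?thesis
    proof
      assume le: "max ((f ^^ n) x) ((f ^^ n) y) \<le> c"
      have *: "f ((f ^^ n) a) < f ((f ^^ n) b)" if "x \<le> a" "a \<le> y" "x \<le> b" "b \<le> y" "(f ^^ n) a < (f ^^ n) b" for a b
        using that between[of b] le bnd[of a] by (intro incr) auto
      from piece show ?thesis unfolding monotone_piece_def[of n]
      proof
        assume "\<forall>a b. x \<le> a \<longrightarrow> a < b \<longrightarrow> b \<le> y \<longrightarrow> (f ^^ n) a < (f ^^ n) b"
        then show ?thesis unfolding monotone_piece_def funpow.simps comp_def by (intro disjI1) (use * in auto)
      next
        assume "\<forall>a b. x \<le> a \<longrightarrow> a < b \<longrightarrow> b \<le> y \<longrightarrow> (f ^^ n) b < (f ^^ n) a"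
        then show ?thesis unfolding monotone_piece_def funpow.simps comp_def by (intro disjI2) (use * in auto)
      qed
    next
      assume ge: "c \<le> min ((f ^^ n) x) ((f ^^ n) y)"
      have *: "f ((f ^^ n) b) < f ((f ^^ n) a)" if "x \<le> a" "a \<le> y" "x \<le> b" "b \<le> y" "(f ^^ n) a < (f ^^ n) b" for a b
        using that between[of a] ge bnd[of b] by (intro decr) auto
      from piece show ?thesis unfolding monotone_piece_def[of n]
      proof
        assume "\<forall>a b. x \<le> a \<longrightarrow> a < b \<longrightarrow> b \<le> y \<longrightarrow> (f ^^ n) a < (f ^^ n) b"
        then show ?thesis unfolding monotone_piece_def funpow.simps comp_def by (intro disjI2) (use * in auto)
      next
        assume "\<forall>a b. x \<le> a \<longrightarrow> a < b \<longrightarrow> b \<le> y \<longrightarrow> (f ^^ n) b < (f ^^ n) a"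
        then show ?thesis unfolding monotone_piece_def funpow.simps comp_def by (intro disjI1) (use * in auto)
      qed
    qed
  qed
qed

lemma monotone_piece_inj:
  assumes "monotone_piece n x y" "x < y"
  shows "(f ^^ n) x \<noteq> (f ^^ n) y"
  using assms unfolding monotone_piece_def by (metis less_irrefl order_refl)

lemma monotone_piece_between:
  assumes "monotone_piece n x y" "x \<le> a" "a \<le> y"
  shows "min ((f ^^ n) x) ((f ^^ n) y) \<le> (f ^^ n) a" "(f ^^ n) a \<le> max ((f ^^ n) x) ((f ^^ n) y)"
  using assms unfolding monotone_piece_def by (smt (verit, best))+

lemma hits_Suc: "hits (Suc n) = {x \<in> {-1..1}. x = c \<or> f x \<in> hits n}"
proof -
  have "(\<exists>i<Suc n. (f ^^ i) x = c) \<longleftrightarrow> x = c \<or> (\<exists>i<n. (f ^^ i) (f x) = c)" for x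
    unfolding Ex_less_Suc2 by (simp add: funpow_swap1)
  then show ?thesis unfolding hits_def using f_in by auto
qed

text \<open>
  Each of the two branches is injective, so preimages of finite sets are finite.
\<close>

lemma preimage_subset:
  "{x \<in> {-1..1}. f x \<in> A} \<subseteq> the_inv_into {-1..c} f ` A \<union> the_inv_into {c..1} f ` A"
proof
  fix x assume x: "x \<in> {x \<in> {-1..1}. f x \<in> A}"
  have i1: "inj_on f {-1..c}" using incr by (intro linorder_inj_onI) force+
  have i2: "inj_on f {c..1}" using decr by (intro linorder_inj_onI) force+
  show "x \<in> the_inv_into {-1..c} f ` A \<union> the_inv_into {c..1} f ` A"
  proof (cases "x \<le> c")
    case True
    then have "x = the_inv_into {-1..c} f (f x)" using x the_inv_into_f_f[OF i1] by auto
    then show ?thesis using x by blast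
  next
    case False
    then have "x = the_inv_into {c..1} f (f x)" using x the_inv_into_f_f[OF i2] by auto
    then show ?thesis using x by blast
  qed
qed

lemma finite_hits [simp]: "finite (hits n)"
proof (induction n)
  case 0
  then show ?case by (simp add: hits_def)
next
  case (Suc n)
  have "hits (Suc n) \<subseteq> insert c ({x \<in> {-1..1}. f x \<in> hits n})" by (auto simp: hits_Suc)
  moreover have "finite {x \<in> {-1..1}. f x \<in> hits n}"
    by (rule finite_subset[OF preimage_subset]) (simp add: Suc)
  ultimately show ?case by (simp add: finite_subset)
qed

definition laps :: "nat \<Rightarrow> nat" where
  "laps n = card (hits n) + 1"

lemma laps_mono: "m \<le> n \<Longrightarrow> laps m \<le> laps n"
  unfolding laps_def using hits_mono by (simp add: card_mono)

lemma hits_1: "hits 1 = {c}"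
  using c_in by (auto simp: hits_def)

lemma laps_0 [simp]: "laps 0 = 1" and laps_1: "laps 1 = 2" and laps_pos: "laps n \<ge> 1"
  using hits_1 by (simp_all add: laps_def) (simp add: hits_def)

text \<open>
  Counting strictly and weakly smaller elements of \<open>A\<close> gives odd values at the points of \<open>A\<close> and even
  values in the gaps, so that the rank distinguishes a point of \<open>A\<close> from the gaps on both sides.
\<close>

definition rank :: "real set \<Rightarrow> real \<Rightarrow> nat" where
  "rank A x = card {z \<in> A. z < x} + card {z \<in> A. z \<le> x}"

lemma card_below_less:
  assumes "finite A" "z \<in> A" "x \<le> z" "z < (y::real)"
  shows "card {w \<in> A. w < x} < card {w \<in> A. w < y}"
proof (rule psubset_card_mono)
  have "z \<in> {w \<in> A. w < y} - {w \<in> A. w < x}" using assms by simp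
  moreover have "{w \<in> A. w < x} \<subseteq> {w \<in> A. w < y}" using assms by force
  ultimately show "{w \<in> A. w < x} \<subset> {w \<in> A. w < y}" by blast
qed (use assms in simp)

lemma rank_eq_imp:
  assumes "finite A" "rank A x = rank A y" "x < y"
  shows "{x..y} \<inter> A = {}"
proof (rule ccontr)
  assume "{x..y} \<inter> A \<noteq> {}"
  then obtain z where z: "z \<in> A" "x \<le> z" "z \<le> y" by auto
  have a: "card {z \<in> A. z < x} \<le> card {z \<in> A. z < y}"
    using assms by (intro card_mono) auto
  have b: "card {z \<in> A. z \<le> x} \<le> card {z \<in> A. z \<le> y}"
    using assms by (intro card_mono) auto
  show False
  proof (cases "z = x")
    case True
    then have "card {z \<in> A. z < x} < card {z \<in> A. z < y}"
      using assms z by (intro psubset_card_mono) auto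
    then show False using b assms(2) by (simp add: rank_def)
  next
    case False
    have "z \<in> {z \<in> A. z \<le> y} - {z \<in> A. z \<le> x}" using z False by auto
    then have "{z \<in> A. z \<le> x} \<subset> {z \<in> A. z \<le> y}" using assms(3) by (auto simp: psubset_eq)
    then have "card {z \<in> A. z \<le> x} < card {z \<in> A. z \<le> y}"
      using assms by (intro psubset_card_mono) auto
    then show False using a assms(2) by (simp add: rank_def)
  qed
qed

text \<open>
  Within one lap of \<open>f ^^ a\<close> this iterate is injective, so it meets each point of \<open>hits b\<close> at most once.
\<close>

lemma laps_submult: "laps (a + b) \<le> laps a * laps b"
proof -
  define below where "below x = card {z \<in> hits a. z < x}" for x
  have split: "u \<in> hits a \<or> (f ^^ a) u \<in> hits b" if h: "u \<in> hits (a + b)" for u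
  proof -
    obtain i where i: "i < a + b" "(f ^^ i) u = c" and u: "u \<in> {-1..1}" using h by (auto simp: hits_def)
    show ?thesis
    proof (cases "i < a")
      case True then show ?thesis using i u by (auto simp: hits_def)
    next
      case False
      then have "(f ^^ (i - a)) ((f ^^ a) u) = c"
        using i by (metis comp_apply funpow_add le_add_diff_inverse2 linorder_not_le)
      then show ?thesis using i False iter_in[OF u] unfolding hits_def
        by (auto intro!: exI[of _ "i - a"])
    qed
  qed
  have "inj_on (\<lambda>x. (below x, (f ^^ a) x)) (hits (a + b) - hits a)"
  proof (rule linorder_inj_onI)
    fix x y assume xy: "x < y" "x \<in> hits (a + b) - hits a" "y \<in> hits (a + b) - hits a"
    then have I: "x \<in> {-1..1}" "y \<in> {-1..1}" by (auto simp: hits_def)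
    show "(below x, (f ^^ a) x) \<noteq> (below y, (f ^^ a) y)"
    proof
      assume eq: "(below x, (f ^^ a) x) = (below y, (f ^^ a) y)"
      have "{x<..<y} \<inter> hits a = {}"
      proof (rule ccontr)
        assume "{x<..<y} \<inter> hits a \<noteq> {}"
        then obtain z where "z \<in> hits a" "x < z" "z < y" by auto
        then have "below x < below y" unfolding below_def
          by (intro card_below_less) auto
        then show False using eq by simp
      qed
      then show False using monotone_piece_inj[OF monotone_pieceI[OF I]] xy(1) eq by auto
    qed
  qed auto
  moreover have "(\<lambda>x. (below x, (f ^^ a) x)) ` (hits (a + b) - hits a) \<subseteq> {..card (hits a)} \<times> hits b"
    using split by (auto simp: below_def intro!: card_mono)
  ultimately have "card (hits (a + b) - hits a) \<le> card ({..card (hits a)} \<times> hits b)"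
    by (intro card_inj_on_le[where f = "\<lambda>x. (below x, (f ^^ a) x)"]) auto
  then have "card (hits (a + b) - hits a) \<le> laps a * card (hits b)"
    by (simp add: laps_def card_cartesian_product)
  moreover have "card (hits (a + b)) = card (hits a) + card (hits (a + b) - hits a)"
    using hits_mono[of a "a + b"] card_mono[of "hits (a + b)" "hits a"] by (simp add: card_Diff_subset)
  ultimately show ?thesis by (simp add: laps_def algebra_simps)
qed

lemma laps_mult_le: "laps (q * M) \<le> laps M ^ q"
proof (induction q)
  case (Suc q)
  have "laps (Suc q * M) \<le> laps M * laps (q * M)" using laps_submult[of M "q * M"] by simp
  also have "\<dots> \<le> laps M * laps M ^ q" using Suc by simp
  finally show ?case by simp
qed simp

end

section \<open>Topological entropy is the growth rate of laps\<close>

context unimodal_map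
begin

text \<open>
  Inside one lap the iterates up to time \<open>n\<close> are all monotone, so the distances travelled add up along
  an ordered set of points: the distances from the iterates of the leftmost point, summed over the
  \<open>n\<close> times, increase by more than \<open>\<epsilon>\<close> from one separated point to the next, while the sum is at most \<open>2 * n\<close>.
\<close>

lemma separated_card_le:
  assumes E: "E \<in> separated_sets f {-1..1} n \<epsilon>" and eps: "\<epsilon> > 0"
  shows "real (card E) \<le> real (laps n) * (2 * real n / \<epsilon> + 1)"
proof -
  have fin: "finite E" and sub: "E \<subseteq> {-1..1}"
    and sep: "\<And>x y. x \<in> E \<Longrightarrow> y \<in> E \<Longrightarrow> x \<noteq> y \<Longrightarrow> \<exists>i<n. dist ((f ^^ i) x) ((f ^^ i) y) > \<epsilon>"
    using E by (auto simp: separated_sets_def)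
  define below where "below x = card {z \<in> hits n. z < x}" for x
  define base where "base x = Min {y \<in> E. below y = below x}" for x
  define travel where "travel x = (\<Sum>i<n. \<bar>(f ^^ i) x - (f ^^ i) (base x)\<bar>)" for x
  have base: "base x \<in> E" "below (base x) = below x" "base x \<le> x" if "x \<in> E" for x
  proof -
    have "base x \<in> {y \<in> E. below y = below x}" unfolding base_def using that fin by (intro Min_in) auto
    then show "base x \<in> E" "below (base x) = below x" by auto
    show "base x \<le> x" unfolding base_def using that fin by (intro Min_le) auto
  qed
  have base_cong: "base x = base y" if "below x = below y" for x y
    using that by (simp add: base_def)
  have no_hit: "{x<..<y} \<inter> hits n = {}" if "below x = below y" for x y
  proof (rule ccontr)
    assume "{x<..<y} \<inter> hits n \<noteq> {}"
    then obtain z where "z \<in> hits n" "x < z" "z < y" by auto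
    then have "below x < below y" unfolding below_def by (intro card_below_less) auto
    then show False using that by simp
  qed
  have step: "travel x + \<epsilon> < travel y" if x: "x \<in> E" and y: "y \<in> E" and "x < y" and eq: "below x = below y" for x y
  proof -
    obtain j where j: "j < n" "\<bar>(f ^^ j) x - (f ^^ j) y\<bar> > \<epsilon>" using sep[OF x y] \<open>x < y\<close> by (auto simp: dist_real_def)
    have add: "\<bar>(f ^^ i) y - (f ^^ i) (base y)\<bar> = \<bar>(f ^^ i) x - (f ^^ i) (base x)\<bar> + \<bar>(f ^^ i) x - (f ^^ i) y\<bar>"
      if "i < n" for i
    proof -
      have "{base x<..<y} \<inter> hits i = {}"
        using no_hit[of "base x" y] base(2)[OF x] eq hits_mono[of i n] that by auto
      then have "monotone_piece i (base x) y"
        using base(1)[OF x] y sub by (intro monotone_pieceI) auto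
      then show ?thesis using monotone_piece_between[of i "base x" y x] base(3)[OF x] \<open>x < y\<close> base_cong[OF eq]
        by (auto simp: min_def max_def split: if_splits)
    qed
    have "travel y = travel x + (\<Sum>i<n. \<bar>(f ^^ i) x - (f ^^ i) y\<bar>)"
      unfolding travel_def sum.distrib[symmetric] by (intro sum.cong) (use add in auto)
    moreover have "\<bar>(f ^^ j) x - (f ^^ j) y\<bar> \<le> (\<Sum>i<n. \<bar>(f ^^ i) x - (f ^^ i) y\<bar>)"
      using j by (intro member_le_sum) auto
    ultimately show ?thesis using j by simp
  qed
  have travel_bounds: "0 \<le> travel x" "travel x \<le> 2 * real n" if "x \<in> E" for x
  proof -
    show "0 \<le> travel x" unfolding travel_def by (intro sum_nonneg) auto
    have "\<bar>(f ^^ i) x - (f ^^ i) (base x)\<bar> \<le> 2" for i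
      using iter_in[of x i] iter_in[of "base x" i] base(1)[OF that] that sub by fastforce
    then have "travel x \<le> (\<Sum>i<n. 2)" unfolding travel_def by (intro sum_mono)
    then show "travel x \<le> 2 * real n" by simp
  qed
  \<comment> \<open>lap of the point, and the number of \<epsilon>-steps travelled from the leftmost point of the lap\<close>
  define code where "code x = (below x, nat \<lfloor>travel x / \<epsilon>\<rfloor>)" for x
  have "inj_on code E"
  proof (rule linorder_inj_onI)
    fix x y assume xy: "x < y" "x \<in> E" "y \<in> E"
    show "code x \<noteq> code y"
    proof
      assume eq: "code x = code y"
      then have "travel x + \<epsilon> < travel y" using step xy by (auto simp: code_def)
      then have "(travel x + \<epsilon>) / \<epsilon> < travel y / \<epsilon>" using eps by (rule divide_strict_right_mono)
      then have "travel x / \<epsilon> + 1 < travel y / \<epsilon>" using eps by (simp add: add_divide_distrib)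
      then have "\<lfloor>travel x / \<epsilon>\<rfloor> < \<lfloor>travel y / \<epsilon>\<rfloor>" by linarith
      moreover have "0 \<le> \<lfloor>travel x / \<epsilon>\<rfloor>" using travel_bounds[OF xy(2)] eps by simp
      ultimately have "nat \<lfloor>travel x / \<epsilon>\<rfloor> < nat \<lfloor>travel y / \<epsilon>\<rfloor>" by linarith
      moreover have "nat \<lfloor>travel x / \<epsilon>\<rfloor> = nat \<lfloor>travel y / \<epsilon>\<rfloor>" using eq by (simp add: code_def)
      ultimately show False by (metis less_irrefl)
    qed
  qed auto
  moreover have "code ` E \<subseteq> {..card (hits n)} \<times> {..nat \<lfloor>2 * real n / \<epsilon>\<rfloor>}"
  proof
    fix u assume "u \<in> code ` E"
    then obtain x where x: "x \<in> E" "u = code x" by auto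
    have "travel x / \<epsilon> \<le> 2 * real n / \<epsilon>" using travel_bounds[OF x(1)] eps by (simp add: divide_right_mono)
    then have "nat \<lfloor>travel x / \<epsilon>\<rfloor> \<le> nat \<lfloor>2 * real n / \<epsilon>\<rfloor>" by (intro nat_mono floor_mono)
    moreover have "below x \<le> card (hits n)" unfolding below_def by (intro card_mono) auto
    ultimately show "u \<in> {..card (hits n)} \<times> {..nat \<lfloor>2 * real n / \<epsilon>\<rfloor>}" using x by (simp add: code_def)
  qed
  ultimately have "card E \<le> card ({..card (hits n)} \<times> {..nat \<lfloor>2 * real n / \<epsilon>\<rfloor>})"
    by (intro card_inj_on_le) auto
  then have "card E \<le> laps n * (nat \<lfloor>2 * real n / \<epsilon>\<rfloor> + 1)"
    by (simp add: laps_def card_cartesian_product)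
  then have "real (card E) \<le> real (laps n * (nat \<lfloor>2 * real n / \<epsilon>\<rfloor> + 1))" by (rule of_nat_mono)
  also have "\<dots> = real (laps n) * (real (nat \<lfloor>2 * real n / \<epsilon>\<rfloor>) + 1)" by (simp add: algebra_simps)
  also have "\<dots> \<le> real (laps n) * (2 * real n / \<epsilon> + 1)"
    using eps by (intro mult_left_mono) (auto simp: of_nat_nat)
  finally show ?thesis .
qed

text \<open>
  By the previous bound separated sets grow no faster than laps, up to a factor that is linear in \<open>n\<close>,
  and laps are submultiplicative.
\<close>

lemma entropy_le_laps:
  assumes "M > 0"
  shows "top_entropy f {-1..1} \<le> ereal (ln (laps M) / M)"
  unfolding top_entropy_def
proof (rule SUP_least)
  fix \<epsilon> :: real assume "\<epsilon> \<in> {0<..}"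
  then have eps: "\<epsilon> > 0" by simp
  define b where "b n = (real n / M + 1) * ln (laps M) / n + ln (2 * real n / \<epsilon> + 1) / n" for n :: nat
  have bound: "(SUP E\<in>separated_sets f {-1..1} n \<epsilon>. ereal (ln (real (card E)) / real n)) \<le> ereal (b n)" for n
  proof (rule SUP_least)
    fix E assume E: "E \<in> separated_sets f {-1..1} n \<epsilon>"
    have L1: "ln (real (laps M)) \<ge> 0" using laps_pos[of M] by (intro ln_ge_zero) simp
    have "ln (real (card E)) \<le> (real n / M + 1) * ln (laps M) + ln (2 * real n / \<epsilon> + 1)"
    proof (cases "card E = 0")
      case True
      then show ?thesis using L1 eps by (simp add: ln_ge_zero)
    next
      case False
      have "laps n \<le> laps ((n div M + 1) * M)" using assms
        by (intro laps_mono) (metis add_mult_distrib div_mult_mod_eq less_imp_le mod_less_divisor mult_1 nat_add_left_cancel_le)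
      also have "\<dots> \<le> laps M ^ (n div M + 1)" by (rule laps_mult_le)
      finally have "real (laps n) \<le> real (laps M) ^ (n div M + 1)" by (metis of_nat_le_iff of_nat_power)
      then have "ln (real (laps n)) \<le> ln (real (laps M) ^ (n div M + 1))"
        using laps_pos[of n] by (intro ln_mono) auto
      also have "\<dots> = real (n div M + 1) * ln (real (laps M))" using laps_pos[of M] by (subst ln_realpow) auto
      also have "\<dots> \<le> (real n / M + 1) * ln (laps M)"
        using L1 of_nat_div_le_of_nat[of n M] by (intro mult_right_mono) auto
      finally have l: "ln (real (laps n)) \<le> (real n / M + 1) * ln (laps M)" .
      have "ln (real (card E)) \<le> ln (real (laps n) * (2 * real n / \<epsilon> + 1))"
        using separated_card_le[OF E eps] False by (intro ln_mono) auto
      also have "\<dots> = ln (real (laps n)) + ln (2 * real n / \<epsilon> + 1)"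
        using laps_pos[of n] eps by (intro ln_mult_pos) (auto simp: add_pos_nonneg add_nonneg_pos)
      finally show ?thesis using l by simp
    qed
    then have "ln (real (card E)) / n \<le> ((real n / M + 1) * ln (laps M) + ln (2 * real n / \<epsilon> + 1)) / n"
      by (intro divide_right_mono) auto
    then show "ereal (ln (real (card E)) / real n) \<le> ereal (b n)"
      by (simp add: b_def add_divide_distrib)
  qed
  have lim: "b \<longlonglongrightarrow> ln (laps M) / M"
  proof -
    define L where "L = ln (real (laps M))"
    have "(\<lambda>n. L / M + L / real n + ln (2 * real n / \<epsilon> + 1) / n) \<longlonglongrightarrow> L / M + 0 + 0"
    proof (intro tendsto_add tendsto_const)
      show "(\<lambda>n. L / real n) \<longlonglongrightarrow> 0" by (rule lim_const_over_n)
      show "(\<lambda>n. ln (2 * real n / \<epsilon> + 1) / n) \<longlonglongrightarrow> 0"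
      proof (rule tendsto_sandwich)
        show "\<forall>\<^sub>F n in sequentially. 0 \<le> ln (2 * real n / \<epsilon> + 1) / n"
          using eps by (intro always_eventually) (auto intro!: divide_nonneg_nonneg ln_ge_zero)
        have "ln (2 * real n / \<epsilon> + 1) \<le> ln (2 / \<epsilon> + 1) + ln n" if "n \<ge> 1" for n :: nat
        proof -
          have "2 * real n / \<epsilon> + 1 \<le> (2 / \<epsilon> + 1) * n" using that by (simp add: algebra_simps)
          then have "ln (2 * real n / \<epsilon> + 1) \<le> ln ((2 / \<epsilon> + 1) * n)"
            using eps by (intro ln_mono) (auto simp: add_nonneg_pos)
          also have "\<dots> = ln (2 / \<epsilon> + 1) + ln n" using eps that by (intro ln_mult_pos) (auto simp: add_pos_pos)
          finally show ?thesis .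
        qed
        then show "\<forall>\<^sub>F n in sequentially. ln (2 * real n / \<epsilon> + 1) / n \<le> ln (2 / \<epsilon> + 1) / n + ln n / n"
          by (intro eventually_sequentiallyI[of 1])
            (simp add: add_divide_distrib[symmetric] divide_right_mono)
        have "(\<lambda>n. ln (2 / \<epsilon> + 1) / real n + ln n / n) \<longlonglongrightarrow> 0 + 0"
          by (intro tendsto_add lim_const_over_n lim_ln_over_n)
        then show "(\<lambda>n. ln (2 / \<epsilon> + 1) / real n + ln n / n) \<longlonglongrightarrow> 0" by simp
      qed simp
    qed
    moreover have "\<forall>\<^sub>F n in sequentially. L / M + L / real n + ln (2 * real n / \<epsilon> + 1) / n = b n"
      using assms by (intro eventually_sequentiallyI[of 1]) (simp add: b_def L_def field_simps)
    ultimately show ?thesis by (simp add: tendsto_cong L_def)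
  qed
  have "limsup (\<lambda>n. SUP E\<in>separated_sets f {-1..1} n \<epsilon>. ereal (ln (real (card E)) / real n)) \<le> limsup (\<lambda>n. ereal (b n))"
    by (intro Limsup_mono always_eventually allI bound)
  also have "\<dots> = ereal (ln (laps M) / M)"
    by (intro lim_imp_Limsup) (use lim in auto)
  finally show "limsup (\<lambda>n. SUP E\<in>separated_sets f {-1..1} n \<epsilon>. ereal (ln (real (card E)) / real n))
      \<le> ereal (ln (laps M) / M)" .
qed

lemma entropy_nonneg: "0 \<le> top_entropy f {-1..1}"
  unfolding top_entropy_def
proof (rule SUP_upper2[of 1])
  have "(0::ereal) \<le> (SUP E\<in>separated_sets f {-1..1} n 1. ereal (ln (real (card E)) / real n))" for n
    by (rule SUP_upper2[of "{}"]) (auto simp: separated_sets_def)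
  then show "0 \<le> limsup (\<lambda>n. SUP E\<in>separated_sets f {-1..1} n 1. ereal (ln (real (card E)) / real n))"
    by (intro le_Limsup always_eventually) auto
qed simp

text \<open>
  A separated set of the largest cardinality is also spanning.
\<close>

lemma maximal_separated:
  assumes "\<epsilon> > 0"
  obtains E where "E \<in> separated_sets f {-1..1} n \<epsilon>"
    and "\<And>x. x \<in> {-1..1} \<Longrightarrow> \<exists>e\<in>E. \<forall>i<n. \<bar>(f ^^ i) x - (f ^^ i) e\<bar> \<le> \<epsilon>"
proof -
  let ?S = "separated_sets f {-1..1} n \<epsilon>"
  obtain B where B: "\<And>E. E \<in> ?S \<Longrightarrow> card E \<le> B"
  proof -
    have "card E \<le> nat \<lceil>real (laps n) * (2 * real n / \<epsilon> + 1)\<rceil>" if "E \<in> ?S" for E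
      using separated_card_le[OF that assms] by linarith
    then show ?thesis using that by blast
  qed
  have "{} \<in> ?S" by (auto simp: separated_sets_def)
  then obtain E where E: "E \<in> ?S" "\<And>E'. E' \<in> ?S \<Longrightarrow> card E' \<le> card E"
    using ex_has_greatest_nat[of "\<lambda>E. E \<in> ?S" "{}" card "Suc B"] B by (auto simp: less_Suc_eq_le)
  have "\<exists>e\<in>E. \<forall>i<n. \<bar>(f ^^ i) x - (f ^^ i) e\<bar> \<le> \<epsilon>" if x: "x \<in> {-1..1}" for x
  proof (rule ccontr)
    assume neg: "\<not> ?thesis"
    then have "x \<notin> E" using assms by fastforce
    have "insert x E \<in> ?S" unfolding separated_sets_def
    proof (intro CollectI conjI ballI impI)
      fix a b assume ab: "a \<in> insert x E" "b \<in> insert x E" "a \<noteq> b"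
      have *: "\<exists>i<n. \<epsilon> < dist ((f ^^ i) x) ((f ^^ i) e)" if "e \<in> E" for e
        using neg that by (auto simp: dist_real_def not_le)
      show "\<exists>i<n. \<epsilon> < dist ((f ^^ i) a) ((f ^^ i) b)"
        using ab *[of a] *[of b] E(1) unfolding separated_sets_def by (auto simp: dist_commute)
    qed (use E x in \<open>auto simp: separated_sets_def\<close>)
    then have "card (insert x E) \<le> card E" using E by blast
    then show False using \<open>x \<notin> E\<close> E by (simp add: separated_sets_def)
  qed
  then show ?thesis using that E by blast
qed

text \<open>
  The ranks with respect to \<open>hits M\<close> along every \<open>M\<close>-th iterate form an itinerary, and points with the
  same itinerary lie in the same lap.
\<close>

lemma same_code_no_hit:
  assumes "x \<in> {-1..1}" "y \<in> {-1..1}" "x < y"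
    and "\<And>i. i < j \<Longrightarrow> rank (hits M) ((f ^^ (i * M)) x) = rank (hits M) ((f ^^ (i * M)) y)"
  shows "{x..y} \<inter> hits (j * M) = {}"
  using assms(4)
proof (induction j)
  case 0
  then show ?case by (auto simp: hits_def)
next
  case (Suc j)
  have none: "{x..y} \<inter> hits (j * M) = {}" by (rule Suc.IH) (use Suc.prems in auto)
  then have "{x<..<y} \<inter> hits (j * M) = {}" by (meson disjoint_iff greaterThanLessThan_subseteq_atLeastAtMost_iff order_refl subsetD)
  then have piece: "monotone_piece (j * M) x y" using assms(1,2) by (intro monotone_pieceI)
  let ?u = "(f ^^ (j * M)) x" and ?v = "(f ^^ (j * M)) y"
  have neq: "?u \<noteq> ?v" using piece assms(3) by (rule monotone_piece_inj)
  have rk: "rank (hits M) ?u = rank (hits M) ?v" using Suc.prems by auto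
  have empty: "{min ?u ?v..max ?u ?v} \<inter> hits M = {}"
    using rank_eq_imp[of "hits M" ?u ?v] rank_eq_imp[of "hits M" ?v ?u] rk neq
    by (cases "?u < ?v") auto
  show ?case
  proof (rule ccontr)
    assume "{x..y} \<inter> hits (Suc j * M) \<noteq> {}"
    then obtain z where z: "x \<le> z" "z \<le> y" "z \<in> hits (Suc j * M)" by auto
    have zI: "z \<in> {-1..1}" using z assms by auto
    obtain i where i: "i < Suc j * M" "(f ^^ i) z = c" using z by (auto simp: hits_def)
    have ge: "j * M \<le> i"
    proof (rule ccontr)
      assume "\<not> j * M \<le> i"
      then have "z \<in> hits (j * M)" using i zI unfolding hits_def not_le by blast
      then show False using none z by auto
    qed
    then have "(f ^^ (i - j * M)) ((f ^^ (j * M)) z) = c"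
      using i by (metis comp_apply funpow_add le_add_diff_inverse2)
    moreover have "i - j * M < M" using i ge by simp
    ultimately have "(f ^^ (j * M)) z \<in> hits M" using iter_in[OF zI] unfolding hits_def by blast
    then show False using monotone_piece_between[OF piece z(1,2)] empty by auto
  qed
qed

text \<open>
  This is the argument of Misiurewicz and Szlenk. Every turning point is shadowed by some point \<open>e\<close> of a
  maximal separated set. When \<open>\<epsilon>\<close> is small against the gaps of \<open>hits M\<close>, a point that is \<open>\<epsilon>\<close>-close to
  an iterate of \<open>e\<close> has at most three possible ranks, so at most \<open>3 ^ j\<close> turning points share the same
  shadow. The loss is one factor \<open>3\<close> in \<open>M\<close> steps, which is negligible for large \<open>M\<close>.
\<close>

lemma laps_le_separated:
  assumes eps: "\<epsilon> > 0" and gap: "\<And>z z'. z \<in> hits M \<Longrightarrow> z' \<in> hits M \<Longrightarrow> z < z' \<Longrightarrow> 2 * \<epsilon> < z' - z"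
    and "M > 0"
  obtains E where "E \<in> separated_sets f {-1..1} (j * M) \<epsilon>" "laps (j * M) \<le> card E * 3 ^ j + 1"
proof -
  obtain E where E: "E \<in> separated_sets f {-1..1} (j * M) \<epsilon>"
    and span: "\<And>x. x \<in> {-1..1} \<Longrightarrow> \<exists>e\<in>E. \<forall>i<j * M. \<bar>(f ^^ i) x - (f ^^ i) e\<bar> \<le> \<epsilon>"
    using maximal_separated[OF eps] by blast
  have finE: "finite E" using E by (simp add: separated_sets_def)
  define shadow where "shadow e = {x \<in> hits (j * M). \<forall>i<j * M. \<bar>(f ^^ i) x - (f ^^ i) e\<bar> \<le> \<epsilon>}" for e
  define lower where "lower e = card {z \<in> hits M. z < e - \<epsilon>}" for e
  have rank3: "rank (hits M) w \<in> {2 * lower e, 2 * lower e + 1, 2 * lower e + 2}" if "\<bar>w - e\<bar> \<le> \<epsilon>" for w e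
  proof -
    have one: "card {z \<in> hits M. e - \<epsilon> \<le> z \<and> z \<le> w} \<le> 1"
    proof (rule ccontr)
      assume "\<not> ?thesis"
      then obtain z z' where "z \<in> hits M" "z' \<in> hits M" "z \<noteq> z'" "e - \<epsilon> \<le> z" "z \<le> w" "e - \<epsilon> \<le> z'" "z' \<le> w"
        by (force simp: card_le_Suc0_iff_eq)
      then show False using gap[of z z'] gap[of z' z] that by (cases "z < z'") auto
    qed
    have a: "lower e \<le> card {z \<in> hits M. z < w}" "card {z \<in> hits M. z < w} \<le> card {z \<in> hits M. z \<le> w}"
      unfolding lower_def using that by (intro card_mono; force)+
    have "{z \<in> hits M. z \<le> w} \<subseteq> {z \<in> hits M. z < e - \<epsilon>} \<union> {z \<in> hits M. e - \<epsilon> \<le> z \<and> z \<le> w}" by auto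
    then have "card {z \<in> hits M. z \<le> w} \<le> card ({z \<in> hits M. z < e - \<epsilon>} \<union> {z \<in> hits M. e - \<epsilon> \<le> z \<and> z \<le> w})"
      by (intro card_mono) auto
    also have "\<dots> \<le> lower e + card {z \<in> hits M. e - \<epsilon> \<le> z \<and> z \<le> w}"
      unfolding lower_def by (rule card_Un_le)
    finally have "card {z \<in> hits M. z \<le> w} \<le> lower e + 1" using one by simp
    then have "rank (hits M) w = 2 * lower e \<or> rank (hits M) w = 2 * lower e + 1 \<or> rank (hits M) w = 2 * lower e + 2"
      using a unfolding rank_def by linarith
    then show ?thesis by simp
  qed
  define code where "code x = (\<lambda>i\<in>{..<j}. rank (hits M) ((f ^^ (i * M)) x))" for x
  have code_inj: "inj_on code (hits (j * M))"
  proof (rule linorder_inj_onI)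
    fix x y assume xy: "x < y" "x \<in> hits (j * M)" "y \<in> hits (j * M)"
    show "code x \<noteq> code y"
    proof
      assume eq: "code x = code y"
      have "{x..y} \<inter> hits (j * M) = {}"
      proof (rule same_code_no_hit)
        fix i assume "i < j"
        then show "rank (hits M) ((f ^^ (i * M)) x) = rank (hits M) ((f ^^ (i * M)) y)"
          using fun_cong[OF eq, of i] by (simp add: code_def)
      qed (use xy in \<open>auto simp: hits_def\<close>)
      moreover have "x \<in> {x..y}" using xy by simp
      ultimately show False using xy by blast
    qed
  qed auto
  have shadow_card: "card (shadow e) \<le> 3 ^ j" for e
  proof -
    define target where "target = (\<Pi>\<^sub>E i\<in>{..<j}. {2 * lower ((f ^^ (i * M)) e), 2 * lower ((f ^^ (i * M)) e) + 1, 2 * lower ((f ^^ (i * M)) e) + 2})"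
    have "code ` shadow e \<subseteq> target"
    proof
      fix u assume "u \<in> code ` shadow e"
      then obtain x where x: "x \<in> shadow e" "u = code x" by auto
      have "rank (hits M) ((f ^^ (i * M)) x) \<in> {2 * lower ((f ^^ (i * M)) e), 2 * lower ((f ^^ (i * M)) e) + 1, 2 * lower ((f ^^ (i * M)) e) + 2}"
        if "i < j" for i
        using x(1) that assms(3) by (intro rank3) (auto simp: shadow_def)
      then show "u \<in> target" unfolding x(2) code_def target_def by (intro restrict_PiE_iff[THEN iffD2]) auto
    qed
    moreover have "inj_on code (shadow e)" using code_inj by (rule inj_on_subset) (auto simp: shadow_def)
    moreover have "finite target" unfolding target_def by (intro finite_PiE) auto
    ultimately have "card (shadow e) \<le> card target" by (intro card_inj_on_le)
    also have "card target = 3 ^ j" unfolding target_def by (simp add: card_PiE numeral_3_eq_3)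
    finally show ?thesis .
  qed
  have "hits (j * M) \<subseteq> (\<Union>e\<in>E. shadow e)"
  proof
    fix x assume x: "x \<in> hits (j * M)"
    then have "x \<in> {-1..1}" by (simp add: hits_def)
    then show "x \<in> (\<Union>e\<in>E. shadow e)" using span x by (auto simp: shadow_def)
  qed
  then have "card (hits (j * M)) \<le> card (\<Union>e\<in>E. shadow e)"
    using finE by (intro card_mono finite_UN_I) (auto simp: shadow_def)
  also have "\<dots> \<le> (\<Sum>e\<in>E. card (shadow e))" using finE by (rule card_UN_le)
  also have "\<dots> \<le> card E * 3 ^ j" using sum_bounded_above[of E "\<lambda>e. card (shadow e)" "3 ^ j"] shadow_card by simp
  finally show ?thesis using that E by (simp add: laps_def)
qed

text \<open>
  Together with \<open>entropy_le_laps\<close> this identifies the entropy with the growth rate of laps.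
\<close>

lemma laps_growth:
  assumes "top_entropy f {-1..1} < ereal (ln \<mu>)" "\<mu> > 0"
  obtains C where "C > 0" "\<And>n. real (laps n) \<le> C * \<mu> ^ n"
proof -
  obtain h' where h': "top_entropy f {-1..1} < ereal h'" "h' < ln \<mu>"
    using ereal_dense2[OF assms(1)] by (metis ereal_less(2) less_ereal.simps(1) ereal_less_ereal_Ex)
  have "0 < ereal h'" using entropy_nonneg h'(1) by (rule order.strict_trans1)
  then have lam: "\<mu> > 1" using h' assms(2) by (smt (verit) ereal_less(2) ln_le_zero_iff)
  \<comment> \<open>block length \<open>M\<close> so large that the loss \<open>ln 3 / M\<close> fits between \<open>h'\<close> and \<open>ln \<mu>\<close>\<close>
  obtain M :: nat where M: "M > 0" "ln 3 / M < ln \<mu> - h'"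
  proof -
    obtain M :: nat where "ln 3 / (ln \<mu> - h') < M" using reals_Archimedean2 by blast
    moreover from this have "real M > 0" using h' by (smt (verit) divide_pos_pos ln_gt_zero)
    ultimately show ?thesis using h' that[of M] by (auto simp: field_simps)
  qed
  obtain \<epsilon> where eps: "\<epsilon> > 0" and gap: "\<And>z z'. z \<in> hits M \<Longrightarrow> z' \<in> hits M \<Longrightarrow> z < z' \<Longrightarrow> 2 * \<epsilon> < z' - z"
  proof -
    define D where "D = insert 1 ((\<lambda>(z, z'). z' - z) ` Set.filter (\<lambda>(z, z'). z < z') (hits M \<times> hits M))"
    have fin: "finite D" unfolding D_def by simp
    have pos: "d > 0" if "d \<in> D" for d using that by (auto simp: D_def)
    have min: "Min D > 0" using fin pos by (subst Min_gr_iff) (auto simp: D_def)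
    have "Min D \<le> z' - z" if "z \<in> hits M" "z' \<in> hits M" "z < z'" for z z'
    proof (rule Min_le[OF fin])
      have "(z, z') \<in> Set.filter (\<lambda>(z, z'). z < z') (hits M \<times> hits M)" using that by simp
      then show "z' - z \<in> D" unfolding D_def by (intro insertI2) force
    qed
    then show ?thesis using min by (intro that[of "Min D / 4"]) fastforce+
  qed
  have "limsup (\<lambda>n. SUP E\<in>separated_sets f {-1..1} n \<epsilon>. ereal (ln (real (card E)) / real n)) \<le> top_entropy f {-1..1}"
    unfolding top_entropy_def using eps by (intro SUP_upper) auto
  then have "limsup (\<lambda>n. SUP E\<in>separated_sets f {-1..1} n \<epsilon>. ereal (ln (real (card E)) / real n)) < ereal h'"
    using h'(1) by (rule order.strict_trans1)
  then have "\<forall>\<^sub>F n in sequentially. (SUP E\<in>separated_sets f {-1..1} n \<epsilon>. ereal (ln (real (card E)) / real n)) < ereal h'"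
    by (rule Limsup_lessD)
  then obtain n0 where n0: "\<And>n. n \<ge> n0 \<Longrightarrow> (SUP E\<in>separated_sets f {-1..1} n \<epsilon>. ereal (ln (real (card E)) / real n)) < ereal h'"
    unfolding eventually_sequentially by blast
  have block: "real (laps (j * M)) \<le> 2 * \<mu> ^ (j * M)" if "j * M \<ge> n0" "j > 0" for j
  proof -
    obtain E where E: "E \<in> separated_sets f {-1..1} (j * M) \<epsilon>" "laps (j * M) \<le> card E * 3 ^ j + 1"
      using laps_le_separated[OF eps gap M(1)] by blast
    have pos: "real (j * M) > 0" using that M by simp
    have "ereal (ln (real (card E)) / real (j * M)) < ereal h'"
      using E(1) by (intro order.strict_trans1[OF SUP_upper n0[OF that(1)]])
    then have "ln (real (card E)) < h' * real (j * M)" using pos by (simp add: field_simps)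
    moreover have "real j * ln 3 \<le> (ln \<mu> - h') * real (j * M)"
    proof -
      have "ln 3 \<le> (ln \<mu> - h') * real M" using M by (simp add: field_simps)
      then have "real j * ln 3 \<le> real j * ((ln \<mu> - h') * real M)" by (intro mult_left_mono) auto
      then show ?thesis by (simp add: mult_ac)
    qed
    ultimately have lnle: "ln (real (card E)) + real j * ln 3 \<le> ln \<mu> * real (j * M)" by (simp add: algebra_simps)
    have "real (card E) * 3 ^ j \<le> \<mu> ^ (j * M)"
    proof (cases "card E = 0")
      case False
      then have "ln (real (card E) * 3 ^ j) \<le> ln (\<mu> ^ (j * M))"
        using lnle lam by (simp add: ln_mult ln_realpow mult.commute)
      then show ?thesis using False lam by (subst (asm) ln_le_cancel_iff) auto
    qed (use lam in simp)
    moreover have "1 \<le> \<mu> ^ (j * M)" using lam by simp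
    moreover have "real (laps (j * M)) \<le> real (card E) * 3 ^ j + 1"
      using of_nat_mono[OF E(2), where 'a = real] by simp
    ultimately show ?thesis by linarith
  qed
  define C where "C = 2 * \<mu> ^ M + real (laps n0)"
  have "real (laps n) \<le> C * \<mu> ^ n" for n
  proof (cases "n \<ge> n0")
    case True
    define j where "j = n div M + 1"
    have "n div M * M + n mod M = n" "n mod M < M" using M(1) by simp_all
    moreover have "j * M = n div M * M + M" by (simp add: j_def)
    ultimately have n: "n \<le> j * M" "j * M \<le> n + M" by linarith+
    have "real (laps n) \<le> real (laps (j * M))" using laps_mono[OF n(1)] by simp
    also have "\<dots> \<le> 2 * \<mu> ^ (j * M)" using True n by (intro block) (auto simp: j_def)
    also have "\<dots> \<le> 2 * \<mu> ^ (n + M)" using n lam by (simp add: power_increasing)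
    also have "\<dots> \<le> C * \<mu> ^ n" using lam by (simp add: C_def power_add algebra_simps)
    finally show ?thesis .
  next
    case False
    have "real (laps n) \<le> real (laps n0)" using laps_mono[of n n0] False by simp
    also have "\<dots> \<le> C * 1" using lam by (simp add: C_def)
    also have "\<dots> \<le> C * \<mu> ^ n" using lam by (intro mult_left_mono) (auto simp: C_def)
    finally show ?thesis .
  qed
  moreover have "C > 0" using lam by (simp add: C_def add_pos_nonneg)
  ultimately show ?thesis using that by blast
qed

definition growth :: real where
  "growth = exp (real_of_ereal (top_entropy f {-1..1}))"

lemma entropy_eq: "top_entropy f {-1..1} = ereal (ln growth)"
proof -
  have "top_entropy f {-1..1} < \<infinity>" using entropy_le_laps[of 1] by auto
  then show ?thesis using entropy_nonneg by (cases "top_entropy f {-1..1}") (auto simp: growth_def)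
qed

lemma growth_ge1: "growth \<ge> 1"
  unfolding growth_def one_le_exp_iff using entropy_nonneg by (rule real_of_ereal_pos)

lemma growth_power_le: "growth ^ M \<le> laps M"
proof (cases "M = 0")
  case False
  then have "ln growth \<le> ln (laps M) / M" using entropy_le_laps[of M] by (simp add: entropy_eq)
  then have "ln (growth ^ M) \<le> ln (real (laps M))" using False growth_ge1 by (simp add: ln_realpow field_simps)
  then show ?thesis using growth_ge1 laps_pos[of M] by (subst (asm) ln_le_cancel_iff) auto
qed simp

lemma growth_le2: "growth \<le> 2"
  using growth_power_le[of 1] laps_1 by simp

lemma laps_growth':
  assumes "growth < \<mu>"
  obtains C where "C > 0" "\<And>n. real (laps n) \<le> C * \<mu> ^ n"
  using laps_growth[of \<mu>] assms growth_ge1 by (auto simp: entropy_eq)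

end

section \<open>The kneading determinant\<close>

context unimodal_map
begin

definition first_hits :: "nat \<Rightarrow> real set" where
  "first_hits n = {x \<in> {-1..1}. (f ^^ n) x = c \<and> (\<forall>i<n. (f ^^ i) x \<noteq> c)}"

definition \<gamma> :: "nat \<Rightarrow> real" where
  "\<gamma> n = card (first_hits n)"

definition below :: "nat \<Rightarrow> real \<Rightarrow> real" where
  "below n y = card {x \<in> first_hits n. x < y}"

definition upto :: "nat \<Rightarrow> real \<Rightarrow> real" where
  "upto n y = card {x \<in> first_hits n. x \<le> y}"

lemma first_hits_0: "first_hits 0 = {c}"
  using c_in by (auto simp: first_hits_def)

lemma first_hits_Suc: "first_hits (Suc n) = {x \<in> {-1..1}. x \<noteq> c \<and> f x \<in> first_hits n}"
  unfolding first_hits_def All_less_Suc2 using f_in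
  by (auto simp: funpow_swap1)

lemma first_hits_subset: "first_hits n \<subseteq> hits (Suc n)"
  by (auto simp: first_hits_def hits_def)

lemma finite_first_hits [simp]: "finite (first_hits n)"
  using first_hits_subset finite_hits by (rule finite_subset)

lemma hits_eq: "hits (Suc n) = hits n \<union> first_hits n"
proof -
  have "(\<exists>i<Suc n. (f ^^ i) x = c) \<longleftrightarrow> (\<exists>i<n. (f ^^ i) x = c) \<or> ((f ^^ n) x = c \<and> (\<forall>i<n. (f ^^ i) x \<noteq> c))" for x
    by (auto simp: less_Suc_eq)
  then show ?thesis unfolding hits_def first_hits_def by blast
qed

lemma laps_eq_sum: "real (laps n) = 1 + (\<Sum>i<n. \<gamma> i)"
proof (induction n)
  case (Suc n)
  have "hits n \<inter> first_hits n = {}" by (auto simp: hits_def first_hits_def)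
  then have "card (hits (Suc n)) = card (hits n) + card (first_hits n)"
    unfolding hits_eq by (intro card_Un_disjoint) auto
  then show ?case using Suc by (simp add: laps_def \<gamma>_def)
qed simp

text \<open>
  A first visit at time \<open>n + 1\<close> is a first visit at time \<open>n\<close> of the image; the left branch maps onto
  everything below the critical value.
\<close>

lemma left_bij:
  "bij_betw f {x \<in> first_hits (Suc n). x < c \<and> P (f x)} {z \<in> first_hits n. z < f c \<and> P z}"
  unfolding bij_betw_def
proof
  show "inj_on f {x \<in> first_hits (Suc n). x < c \<and> P (f x)}"
  proof (rule linorder_inj_onI)
    fix x y assume "x < y" "x \<in> {x \<in> first_hits (Suc n). x < c \<and> P (f x)}" "y \<in> {x \<in> first_hits (Suc n). x < c \<and> P (f x)}"
    then have "f x < f y" by (intro incr) (auto simp: first_hits_def)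
    then show "f x \<noteq> f y" by simp
  qed auto
  show "f ` {x \<in> first_hits (Suc n). x < c \<and> P (f x)} = {z \<in> first_hits n. z < f c \<and> P z}"
  proof (intro subset_antisym subsetI)
    fix z assume z: "z \<in> {z \<in> first_hits n. z < f c \<and> P z}"
    then obtain x where x: "-1 \<le> x" "x \<le> c" "f x = z" using left_surj[of z] by (auto simp: first_hits_def)
    then have "x < c" using z by (cases "x = c") auto
    then have "x \<in> {x \<in> first_hits (Suc n). x < c \<and> P (f x)}"
      using x z crit by (auto simp: first_hits_Suc)
    then show "z \<in> f ` {x \<in> first_hits (Suc n). x < c \<and> P (f x)}" using x by blast
  qed (auto simp: first_hits_Suc intro!: f_less_crit)
qed

lemma right_bij:
  "bij_betw f {x \<in> first_hits (Suc n). c < x \<and> P (f x)} {z \<in> first_hits n. z < f c \<and> P z}"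
  unfolding bij_betw_def
proof
  show "inj_on f {x \<in> first_hits (Suc n). c < x \<and> P (f x)}"
  proof (rule linorder_inj_onI)
    fix x y assume "x < y" "x \<in> {x \<in> first_hits (Suc n). c < x \<and> P (f x)}" "y \<in> {x \<in> first_hits (Suc n). c < x \<and> P (f x)}"
    then have "f y < f x" by (intro decr) (auto simp: first_hits_def)
    then show "f x \<noteq> f y" by simp
  qed auto
  show "f ` {x \<in> first_hits (Suc n). c < x \<and> P (f x)} = {z \<in> first_hits n. z < f c \<and> P z}"
  proof (intro subset_antisym subsetI)
    fix z assume z: "z \<in> {z \<in> first_hits n. z < f c \<and> P z}"
    then obtain x where x: "c \<le> x" "x \<le> 1" "f x = z" using right_surj[of z] by (auto simp: first_hits_def)
    then have "c < x" using z by (cases "x = c") auto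
    then have "x \<in> {x \<in> first_hits (Suc n). c < x \<and> P (f x)}"
      using x z crit by (auto simp: first_hits_Suc)
    then show "z \<in> f ` {x \<in> first_hits (Suc n). c < x \<and> P (f x)}" using x by blast
  qed (auto simp: first_hits_Suc intro!: f_less_crit)
qed

lemmas left_card = bij_betw_same_card[OF left_bij] and right_card = bij_betw_same_card[OF right_bij]

lemma incr_iff: "\<lbrakk>x \<in> {-1..1}; y \<in> {-1..1}; x \<le> c; y \<le> c\<rbrakk> \<Longrightarrow> f x < f y \<longleftrightarrow> x < y"
  using incr[of x y] incr[of y x] by (cases x y rule: linorder_cases) auto

lemma decr_iff: "\<lbrakk>x \<in> {-1..1}; y \<in> {-1..1}; c \<le> x; c \<le> y\<rbrakk> \<Longrightarrow> f x < f y \<longleftrightarrow> y < x"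
  using decr[of x y] decr[of y x] by (cases x y rule: linorder_cases) auto

lemma incr_le_iff: "\<lbrakk>x \<in> {-1..1}; y \<in> {-1..1}; x \<le> c; y \<le> c\<rbrakk> \<Longrightarrow> f x \<le> f y \<longleftrightarrow> x \<le> y"
  using incr_iff[of y x] by (meson not_less)

lemma decr_le_iff: "\<lbrakk>x \<in> {-1..1}; y \<in> {-1..1}; c \<le> x; c \<le> y\<rbrakk> \<Longrightarrow> f x \<le> f y \<longleftrightarrow> y \<le> x"
  using decr_iff[of y x] by (meson not_less)

lemma first_hits_in: "x \<in> first_hits n \<Longrightarrow> x \<in> {-1..1}"
  by (simp add: first_hits_def)

text \<open>
  The next five lemmas are the recursion behind kneading theory: the left branch preserves the order, so
  counts to the left of \<open>y\<close> become counts to the left of \<open>f y\<close>; the right branch reverses it, so the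
  count becomes the total minus the count on the other side, and strict and weak counts swap.
\<close>

lemma below_left:
  assumes "y \<in> {-1..1}" "y \<le> c" shows "below (Suc n) y = below n (f y)"
proof -
  have "{x \<in> first_hits (Suc n). x < y} = {x \<in> first_hits (Suc n). x < c \<and> f x < f y}"
    using assms incr_iff[of _ y] first_hits_in by (auto simp: order.strict_trans2)
  moreover have "{z \<in> first_hits n. z < f c \<and> z < f y} = {z \<in> first_hits n. z < f y}"
    using f_le_crit[OF assms(1)] by auto
  ultimately show ?thesis unfolding below_def using left_card[of n "\<lambda>z. z < f y"] by simp
qed

lemma upto_left:
  assumes "y \<in> {-1..1}" "y < c" shows "upto (Suc n) y = upto n (f y)"
proof -
  have "{x \<in> first_hits (Suc n). x \<le> y} = {x \<in> first_hits (Suc n). x < c \<and> f x \<le> f y}"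
    using assms incr_le_iff[of _ y] first_hits_in by (auto simp: order.strict_trans1)
  moreover have "{z \<in> first_hits n. z < f c \<and> z \<le> f y} = {z \<in> first_hits n. z \<le> f y}"
    using f_less_crit[OF assms(1)] assms(2) by auto
  ultimately show ?thesis unfolding upto_def using left_card[of n "\<lambda>z. z \<le> f y"] by simp
qed

lemma \<gamma>_Suc: "\<gamma> (Suc n) = 2 * below n (f c)"
proof -
  have "first_hits (Suc n) = {x \<in> first_hits (Suc n). x < c} \<union> {x \<in> first_hits (Suc n). c < x}"
    by (auto simp: first_hits_Suc)
  moreover have "card ({x \<in> first_hits (Suc n). x < c} \<union> {x \<in> first_hits (Suc n). c < x})
      = card {x \<in> first_hits (Suc n). x < c} + card {x \<in> first_hits (Suc n). c < x}"
    by (rule card_Un_disjoint) auto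
  ultimately have "card (first_hits (Suc n)) = card {x \<in> first_hits (Suc n). x < c} + card {x \<in> first_hits (Suc n). c < x}"
    by simp
  then show ?thesis using left_card[of n "\<lambda>_. True"] right_card[of n "\<lambda>_. True"]
    by (simp add: \<gamma>_def below_def)
qed

lemma below_right:
  assumes "y \<in> {-1..1}" "c < y" shows "below (Suc n) y = \<gamma> (Suc n) - upto n (f y)"
proof -
  have "card (first_hits (Suc n)) = card {x \<in> first_hits (Suc n). x < y} + card {x \<in> first_hits (Suc n). y \<le> x}"
    by (subst card_Un_disjoint[symmetric]) (auto intro: arg_cong[where f = card])
  moreover have "{x \<in> first_hits (Suc n). y \<le> x} = {x \<in> first_hits (Suc n). c < x \<and> f x \<le> f y}"
    using assms decr_le_iff[of _ y] first_hits_in by (auto simp: order.strict_trans2)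
  moreover have "{z \<in> first_hits n. z < f c \<and> z \<le> f y} = {z \<in> first_hits n. z \<le> f y}"
    using f_less_crit[OF assms(1)] assms(2) by auto
  ultimately show ?thesis unfolding upto_def below_def \<gamma>_def using right_card[of n "\<lambda>z. z \<le> f y"] by simp
qed

lemma upto_right:
  assumes "y \<in> {-1..1}" "c \<le> y" shows "upto (Suc n) y = \<gamma> (Suc n) - below n (f y)"
proof -
  have "card (first_hits (Suc n)) = card {x \<in> first_hits (Suc n). x \<le> y} + card {x \<in> first_hits (Suc n). y < x}"
    by (subst card_Un_disjoint[symmetric]) (auto intro: arg_cong[where f = card])
  moreover have "{x \<in> first_hits (Suc n). y < x} = {x \<in> first_hits (Suc n). c < x \<and> f x < f y}"
    using assms decr_iff[of _ y] first_hits_in by (auto simp: order.strict_trans1)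
  moreover have "{z \<in> first_hits n. z < f c \<and> z < f y} = {z \<in> first_hits n. z < f y}"
    using f_le_crit[OF assms(1)] by auto
  ultimately show ?thesis unfolding upto_def below_def \<gamma>_def using right_card[of n "\<lambda>z. z < f y"] by simp
qed

text \<open>
  The sign \<open>\<theta> j\<close> tells from which side the points \<open>(f ^^ Suc j) x\<close> approach \<open>(f ^^ Suc j) c\<close> as \<open>x\<close> tends
  to \<open>c\<close>: from below if it is \<open>1\<close>, from above if it is \<open>-1\<close>. This reading also fixes the value when the
  critical point is periodic: after a fold the approach is from below again.
\<close>

primrec \<theta> :: "nat \<Rightarrow> real" where
  "\<theta> 0 = 1"
| "\<theta> (Suc j) = (if (f ^^ Suc j) c = c then 1 else \<theta> j * sgn (c - (f ^^ Suc j) c))"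

declare \<theta>.simps(2) [simp del]

lemma \<theta>_cases: "\<theta> j = 1 \<or> \<theta> j = -1"
  by (induction j) (auto simp: \<theta>.simps(2) sgn_if)

lemma \<theta>_square: "\<theta> j * \<theta> j = 1" and \<theta>_abs: "\<bar>\<theta> j\<bar> = 1"
  using \<theta>_cases[of j] by auto

text \<open>
  The number of first visits at time \<open>n\<close> to the left of the \<open>j\<close>-th image of the critical value, where the
  image itself counts as approached from the side given by \<open>\<theta> j\<close>.
\<close>

definition count :: "nat \<Rightarrow> nat \<Rightarrow> real" where
  "count j n = (if \<theta> j = 1 then below n ((f ^^ Suc j) c) else upto n ((f ^^ Suc j) c))"

text \<open>
  First visits to the right minus those to the left. With the factor \<open>\<theta> j\<close>, the order reversals of the
  right branch disappear from the recursion \<open>balance_Suc\<close>.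
\<close>

definition balance :: "nat \<Rightarrow> nat \<Rightarrow> real" where
  "balance j n = \<theta> j * (\<gamma> n - 2 * count j n)"

text \<open>
  The coefficients of \<open>(1 - x) * \<Gamma> x\<close>; the kneading identity below says that they form the inverse of
  the power series with coefficients \<open>\<theta>\<close>.
\<close>

definition d :: "nat \<Rightarrow> real" where
  "d n = (case n of 0 \<Rightarrow> 1 | Suc m \<Rightarrow> \<gamma> n - \<gamma> m)"

lemma \<gamma>_0: "\<gamma> 0 = 1"
  by (simp add: \<gamma>_def first_hits_0)

lemma below_0: "below 0 y = (if c < y then 1 else 0)" and upto_0: "upto 0 y = (if c \<le> y then 1 else 0)"
proof -
  have "{x \<in> first_hits 0. x < y} = (if c < y then {c} else {})" by (auto simp: first_hits_0)
  moreover have "{x \<in> first_hits 0. x \<le> y} = (if c \<le> y then {c} else {})" by (auto simp: first_hits_0)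
  ultimately show "below 0 y = (if c < y then 1 else 0)" "upto 0 y = (if c \<le> y then 1 else 0)"
    by (auto simp: below_def upto_def)
qed

lemma balance_0: "balance j 0 = \<theta> (Suc j)"
proof -
  consider "(f ^^ Suc j) c < c" | "(f ^^ Suc j) c = c" | "c < (f ^^ Suc j) c" by linarith
  then show ?thesis unfolding balance_def count_def below_0 upto_0 \<gamma>_0 \<theta>.simps(2)
    using \<theta>_cases[of j] by cases auto
qed

lemma balance_Suc: "balance j (Suc n) = \<theta> (Suc j) * (\<gamma> (Suc n) - \<gamma> n) + balance (Suc j) n"
proof -
  let ?y = "(f ^^ Suc j) c"
  have y: "?y \<in> {-1..1}" using iter_in[OF c_in] .
  have fy: "f ?y = (f ^^ Suc (Suc j)) c" by simp
  consider "?y < c" | "?y = c" | "c < ?y" by linarith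
  then show ?thesis
  proof cases
    case 1
    then have "\<theta> (Suc j) = \<theta> j" by (simp add: \<theta>.simps(2))
    then show ?thesis using 1 y below_left[of ?y n] upto_left[of ?y n] \<theta>_cases[of j]
      unfolding balance_def count_def fy by (auto simp del: funpow.simps simp: algebra_simps)
  next
    case 2
    then have "\<theta> (Suc j) = 1" by (simp add: \<theta>.simps(2))
    then show ?thesis using 2 y below_left[of ?y n] upto_right[of ?y n] \<theta>_cases[of j]
      unfolding balance_def count_def fy by (auto simp del: funpow.simps simp: algebra_simps)
  next
    case 3
    then have "\<theta> (Suc j) = - \<theta> j" by (simp add: \<theta>.simps(2))
    then show ?thesis using 3 y below_right[of ?y n] upto_right[of ?y n] \<theta>_cases[of j]
      unfolding balance_def count_def fy by (auto simp del: funpow.simps simp: algebra_simps)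
  qed
qed

lemma balance_convolution: "balance j n = (\<Sum>i\<le>n. \<theta> (Suc j + i) * d (n - i))"
proof (induction n arbitrary: j)
  case 0
  then show ?case by (simp add: balance_0 d_def)
next
  case (Suc n)
  show ?case unfolding balance_Suc sum.atMost_Suc_shift Suc
    by (simp add: d_def)
qed

lemma balance_origin: "balance 0 n = - d (Suc n)"
  using \<gamma>_Suc[of n] by (simp add: balance_def count_def d_def)

text \<open>
  Every first visit below the critical value has exactly two preimages. This expresses \<open>balance 0\<close>
  through \<open>d\<close> itself and closes the recursion.
\<close>

lemma kneading_identity: "(\<Sum>i\<le>n. \<theta> i * d (n - i)) = (if n = 0 then 1 else 0)"
proof (cases n)
  case 0
  then show ?thesis by (simp add: d_def)
next
  case (Suc m)
  have "(\<Sum>i\<le>m. \<theta> (Suc i) * d (m - i)) = - d (Suc m)"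
    using balance_convolution[of 0 m] balance_origin[of m] by simp
  then show ?thesis unfolding Suc sum.atMost_Suc_shift by simp
qed

text \<open>
  The critical value is the largest value of \<open>f\<close>, so no later point of its orbit has more first visits to
  its left.
\<close>

lemma admissible: "- d (Suc n) \<le> \<theta> j * balance j n"
proof -
  let ?y = "(f ^^ Suc j) c"
  have "count j n \<le> below n (f c)"
  proof (cases "\<theta> j = 1")
    case True
    have "?y \<le> f c" using f_le_crit[OF iter_in[OF c_in, of j]] by simp
    then show ?thesis using True unfolding count_def below_def by (auto intro!: card_mono)
  next
    case False
    then obtain i where i: "j = Suc i" by (cases j) auto
    have "(f ^^ j) c \<noteq> c" using False by (auto simp: i \<theta>.simps(2))
    then have "?y < f c" using f_less_crit[OF iter_in[OF c_in, of j]] by simp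
    then show ?thesis using False unfolding count_def below_def upto_def by (auto intro!: card_mono)
  qed
  moreover have "- d (Suc n) = \<gamma> n - 2 * below n (f c)" by (simp add: d_def \<gamma>_Suc)
  moreover have "\<theta> j * balance j n = \<gamma> n - 2 * count j n"
    using \<theta>_square[of j] by (simp add: balance_def mult.assoc[symmetric])
  ultimately show ?thesis by simp
qed

text \<open>
  The kneading determinant is \<open>tail 0\<close>; at \<open>x = 1 / growth\<close> the later tails are, up to sign, the
  coordinates of the points of the critical orbit in a tent map.
\<close>

definition tail :: "nat \<Rightarrow> real \<Rightarrow> real" where
  "tail j x = (\<Sum>i. \<theta> (j + i) * x ^ i)"

definition \<Gamma> :: "real \<Rightarrow> real" where
  "\<Gamma> x = (\<Sum>n. \<gamma> n * x ^ n)"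

lemma summable_\<theta>: assumes "\<bar>x\<bar> < 1" shows "summable (\<lambda>i. norm (\<theta> (j + i) * x ^ i))"
proof -
  have "norm (\<theta> (j + i) * x ^ i) = \<bar>x\<bar> ^ i" for i by (simp add: abs_mult \<theta>_abs power_abs)
  then show ?thesis using assms by (simp add: summable_geometric)
qed

lemma tail_step: assumes "\<bar>x\<bar> < 1" shows "tail j x = \<theta> j + x * tail (Suc j) x"
proof -
  have s: "summable (\<lambda>i. \<theta> (j + i) * x ^ i)" using summable_norm_cancel[OF summable_\<theta>[OF assms]] .
  have "tail j x = \<theta> j + (\<Sum>i. \<theta> (j + Suc i) * x ^ Suc i)"
    unfolding tail_def using suminf_split_head[OF s] by simp
  also have "(\<lambda>i. \<theta> (j + Suc i) * x ^ Suc i) = (\<lambda>i. x * (\<theta> (Suc j + i) * x ^ i))"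
    by (auto simp: algebra_simps)
  also have "(\<Sum>i. x * (\<theta> (Suc j + i) * x ^ i)) = x * tail (Suc j) x"
    unfolding tail_def by (intro suminf_mult summable_norm_cancel[OF summable_\<theta>[OF assms]])
  finally show ?thesis .
qed

lemma isCont_tail: assumes "\<bar>x\<bar> < 1" shows "isCont (tail j) x"
proof -
  \<comment> \<open>any point between \<open>\<bar>x\<bar>\<close> and the radius of convergence \<open>1\<close>\<close>
  define K where "K = (1 + \<bar>x\<bar>) / 2"
  have "summable (\<lambda>i. \<theta> (j + i) * K ^ i)" using assms
    by (intro summable_norm_cancel[OF summable_\<theta>]) (simp add: K_def)
  then show ?thesis unfolding tail_def using assms by (intro isCont_powser) (auto simp: K_def)
qed

lemma \<gamma>_nonneg: "\<gamma> n \<ge> 0" by (simp add: \<gamma>_def)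

lemma summable_\<gamma>: assumes "0 \<le> x" "x < 1 / growth" shows "summable (\<lambda>n. norm (\<gamma> n * x ^ n))"
proof (cases "x = 0")
  case True
  then show ?thesis by (intro summable_finite[of "{0}"]) auto
next
  case False
  then have "growth < 1 / x" using assms growth_ge1 by (simp add: field_simps)
  then obtain \<mu> where \<mu>: "growth < \<mu>" "\<mu> < 1 / x" using dense by blast
  obtain C where C: "C > 0" "\<And>n. real (laps n) \<le> C * \<mu> ^ n" using laps_growth'[OF \<mu>(1)] by blast
  have mx: "\<mu> * x < 1" "0 \<le> \<mu> * x" using \<mu> False assms growth_ge1 by (auto simp: field_simps)
  show ?thesis
  proof (rule summable_comparison_test')
    show "summable (\<lambda>n. (C * \<mu>) * (\<mu> * x) ^ n)" using mx by (intro summable_mult summable_geometric) auto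
    fix n :: nat
    have "(\<Sum>i<n. \<gamma> i) \<ge> 0" by (intro sum_nonneg \<gamma>_nonneg)
    then have "\<gamma> n \<le> real (laps (Suc n))" by (simp add: laps_eq_sum)
    also have "\<dots> \<le> C * \<mu> ^ Suc n" by (rule C)
    finally have "\<gamma> n * x ^ n \<le> C * \<mu> ^ Suc n * x ^ n" using assms by (intro mult_right_mono) auto
    then show "norm (norm (\<gamma> n * x ^ n)) \<le> (C * \<mu>) * (\<mu> * x) ^ n"
      using assms \<gamma>_nonneg by (simp add: power_mult_distrib algebra_simps)
  qed
qed

lemma d_sums: assumes "0 \<le> x" "x < 1 / growth"
  shows "summable (\<lambda>n. norm (d n * x ^ n))" "(\<lambda>n. d n * x ^ n) sums ((1 - x) * \<Gamma> x)"
proof -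
  note s = summable_\<gamma>[OF assms] and s' = summable_norm_cancel[OF summable_\<gamma>[OF assms]]
  have shift: "(\<lambda>n. d n * x ^ n) = (\<lambda>n. \<gamma> n * x ^ n - (case n of 0 \<Rightarrow> 0 | Suc m \<Rightarrow> x * (\<gamma> m * x ^ m)))"
    by (auto simp: d_def \<gamma>_0 algebra_simps split: nat.split)
  have e: "(\<lambda>m. case Suc m of 0 \<Rightarrow> 0 | Suc m \<Rightarrow> x * (\<gamma> m * x ^ m)) = (\<lambda>m. x * (\<gamma> m * x ^ m))" by simp
  have "(\<lambda>m. x * (\<gamma> m * x ^ m)) sums (x * \<Gamma> x)"
    unfolding \<Gamma>_def by (intro sums_mult summable_sums s')
  then have "(\<lambda>n. (case n of 0 \<Rightarrow> 0 | Suc m \<Rightarrow> x * (\<gamma> m * x ^ m))) sums (x * \<Gamma> x)"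
    by (subst (asm) e[symmetric], subst (asm) sums_Suc_iff) simp
  then show "(\<lambda>n. d n * x ^ n) sums ((1 - x) * \<Gamma> x)"
    unfolding shift using sums_diff[OF summable_sums[OF s']] by (simp add: \<Gamma>_def algebra_simps)
  have "summable (\<lambda>m. norm (x * (\<gamma> m * x ^ m)))"
    unfolding norm_mult[of x] by (intro summable_mult s)
  then have "summable (\<lambda>n. norm (case n of 0 \<Rightarrow> 0 | Suc m \<Rightarrow> x * (\<gamma> m * x ^ m)))"
    by (subst summable_Suc_iff[symmetric]) simp
  from summable_add[OF s this] show "summable (\<lambda>n. norm (d n * x ^ n))"
  proof (rule summable_comparison_test'[of _ 0])
    fix n
    show "norm (norm (d n * x ^ n)) \<le> norm (\<gamma> n * x ^ n) + norm (case n of 0 \<Rightarrow> 0 | Suc m \<Rightarrow> x * (\<gamma> m * x ^ m))"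
      unfolding real_norm_def abs_idempotent fun_cong[OF shift] by (rule abs_triangle_ineq4)
  qed
qed

lemma inv_growth_le1: "1 / growth \<le> 1"
  using growth_ge1 by simp

lemma kneading_product: assumes "0 \<le> x" "x < 1 / growth"
  shows "tail 0 x * ((1 - x) * \<Gamma> x) = 1"
proof -
  have x1: "\<bar>x\<bar> < 1" using assms inv_growth_le1 by simp
  have "(\<lambda>n. \<Sum>i\<le>n. (\<theta> (0 + i) * x ^ i) * (d (n - i) * x ^ (n - i))) sums ((\<Sum>i. \<theta> (0 + i) * x ^ i) * (\<Sum>n. d n * x ^ n))"
    by (intro Cauchy_product_sums summable_\<theta>[OF x1] d_sums[OF assms])
  moreover have "(\<Sum>i\<le>n. (\<theta> (0 + i) * x ^ i) * (d (n - i) * x ^ (n - i))) = (if n = 0 then 1 else 0)" for n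
  proof -
    have "(\<Sum>i\<le>n. (\<theta> (0 + i) * x ^ i) * (d (n - i) * x ^ (n - i))) = (\<Sum>i\<le>n. \<theta> i * d (n - i)) * x ^ n"
      unfolding sum_distrib_right
      by (intro sum.cong) (auto simp: power_add[symmetric] algebra_simps)
    then show ?thesis by (simp add: kneading_identity)
  qed
  moreover have "(\<lambda>n. if n = 0 then 1 else 0 :: real) sums 1"
    using sums_If_finite_set[of "{0::nat}" "\<lambda>_. 1 :: real"] by simp
  ultimately have "(\<Sum>i. \<theta> (0 + i) * x ^ i) * (\<Sum>n. d n * x ^ n) = 1"
    using sums_unique2 by simp
  then show ?thesis using sums_unique[OF d_sums(2)[OF assms]] by (simp add: tail_def)
qed

lemma \<Gamma>_pos: assumes "0 \<le> x" "x < 1 / growth" shows "\<Gamma> x > 0"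
proof -
  have "\<gamma> 0 * x ^ 0 \<le> \<Gamma> x" unfolding \<Gamma>_def
    using sum_le_suminf[OF summable_norm_cancel[OF summable_\<gamma>[OF assms]], of "{0}"] \<gamma>_nonneg assms by auto
  then show ?thesis by (simp add: \<gamma>_0)
qed

lemma kneading_pos: assumes "0 \<le> x" "x < 1 / growth" shows "tail 0 x > 0"
proof -
  have "x < 1" using assms inv_growth_le1 by linarith
  then have "(1 - x) * \<Gamma> x > 0" using \<Gamma>_pos[OF assms] by simp
  then show ?thesis using kneading_product[OF assms] by (smt (verit) zero_less_mult_iff)
qed

text \<open>
  \<open>(1 - x) * tail 0 x\<close> is the reciprocal of a series with nonnegative coefficients.
\<close>

lemma kneading_decreasing:
  assumes "0 \<le> x" "x \<le> y" "y < 1 / growth" shows "(1 - y) * tail 0 y \<le> (1 - x) * tail 0 x"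
proof -
  have x: "0 \<le> x" "x < 1 / growth" and y: "0 \<le> y" "y < 1 / growth" using assms by auto
  have "\<Gamma> x \<le> \<Gamma> y" unfolding \<Gamma>_def
    using assms \<gamma>_nonneg
    by (intro suminf_le mult_left_mono power_mono summable_norm_cancel[OF summable_\<gamma>] x y) auto
  then have "1 / \<Gamma> y \<le> 1 / \<Gamma> x" using \<Gamma>_pos[OF x] by (simp add: frac_le)
  moreover have "(1 - y) * tail 0 y = 1 / \<Gamma> y" "(1 - x) * tail 0 x = 1 / \<Gamma> x"
    using kneading_product[OF x] kneading_product[OF y] \<Gamma>_pos[OF x] \<Gamma>_pos[OF y] by (auto simp: field_simps)
  ultimately show ?thesis by simp
qed

lemma tail_sign_interior: assumes "0 < x" "x < 1 / growth" shows "\<theta> j * tail j x > 0"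
proof -
  have x: "0 \<le> x" using assms by simp
  have x1: "\<bar>x\<bar> < 1" using assms inv_growth_le1 by simp
  define \<Delta> where "\<Delta> = (1 - x) * \<Gamma> x"
  have pos: "\<Delta> > 0" using \<Gamma>_pos[OF x assms(2)] x1 by (simp add: \<Delta>_def)
  have conv: "(\<lambda>n. \<Sum>i\<le>n. (\<theta> (Suc j + i) * x ^ i) * (d (n - i) * x ^ (n - i))) sums (tail (Suc j) x * \<Delta>)"
    unfolding tail_def \<Delta>_def sums_unique[OF d_sums(2)[OF x assms(2)]]
    by (intro Cauchy_product_sums summable_\<theta>[OF x1] d_sums[OF x assms(2)])
  moreover have "(\<Sum>i\<le>n. (\<theta> (Suc j + i) * x ^ i) * (d (n - i) * x ^ (n - i))) = balance j n * x ^ n" for n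
    unfolding balance_convolution sum_distrib_right
    by (intro sum.cong) (auto simp: power_add[symmetric] algebra_simps)
  ultimately have "(\<lambda>n. balance j n * x ^ n) sums (tail (Suc j) x * \<Delta>)" by simp
  then have 1: "(\<lambda>n. \<theta> j * (balance j n * x ^ n)) sums (\<theta> j * (tail (Suc j) x * \<Delta>))" by (rule sums_mult)
  have "(\<lambda>n. d (Suc n) * x ^ Suc n) sums (\<Delta> - 1)"
    using d_sums(2)[OF x assms(2)] unfolding \<Delta>_def by (subst sums_Suc_iff) (simp add: d_def)
  then have 2: "(\<lambda>n. - d (Suc n) * x ^ Suc n) sums (1 - \<Delta>)" using sums_minus by fastforce
  have "1 - \<Delta> \<le> x * (\<theta> j * (tail (Suc j) x * \<Delta>))"
  proof (rule sums_le[OF _ 2 sums_mult[OF 1]])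
    fix n
    have "- d (Suc n) * x ^ Suc n \<le> (\<theta> j * balance j n) * x ^ Suc n"
      using admissible x by (intro mult_right_mono) auto
    then show "- d (Suc n) * x ^ Suc n \<le> x * (\<theta> j * (balance j n * x ^ n))" by (simp add: mult_ac)
  qed
  also have "x * (\<theta> j * (tail (Suc j) x * \<Delta>)) = \<theta> j * (x * tail (Suc j) x) * \<Delta>" by (simp add: mult_ac)
  also have "x * tail (Suc j) x = tail j x - \<theta> j" using tail_step[OF x1, of j] by simp
  also have "\<theta> j * (tail j x - \<theta> j) * \<Delta> = \<theta> j * tail j x * \<Delta> - \<theta> j * \<theta> j * \<Delta>" by (simp add: algebra_simps)
  finally have "1 \<le> \<theta> j * tail j x * \<Delta>" by (simp add: \<theta>_square)
  then show ?thesis using pos by (smt (verit) mult_nonpos_nonneg)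
qed

text \<open>
  The admissibility of the itinerary, summed with weights \<open>x ^ n\<close> and evaluated in the limit at the zero
  of the determinant.
\<close>

lemma tail_sign: assumes "growth > 1" shows "\<theta> j * tail j (1 / growth) \<ge> 0"
proof -
  have r: "0 < 1 / growth" "\<bar>1 / growth\<bar> < 1" using assms by (simp_all add: abs_if)
  have "((\<lambda>x. \<theta> j * tail j x) \<longlongrightarrow> \<theta> j * tail j (1 / growth)) (at_left (1 / growth))"
    using isCont_tail[OF r(2), of j] by (intro tendsto_mult_left) (metis isCont_def filterlim_at_split)
  moreover have "\<forall>\<^sub>F x in at_left (1 / growth). 0 \<le> \<theta> j * tail j x"
    using eventually_at_left_real[OF r(1)] by eventually_elim (use tail_sign_interior in \<open>auto simp: less_imp_le\<close>)
  ultimately show ?thesis by (intro tendsto_lowerbound) auto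
qed

text \<open>
  If the determinant did not vanish at \<open>1 / growth\<close>, the series \<open>\<Gamma>\<close> would converge there. Convolution with
  a convergent geometric series would then make \<open>laps k / growth ^ k\<close> tend to zero, against
  \<open>growth ^ k \<le> laps k\<close>.
\<close>

lemma kneading_zero: assumes "growth > 1" shows "tail 0 (1 / growth) = 0"
proof (rule ccontr)
  define r where "r = 1 / growth"
  assume "tail 0 (1 / growth) \<noteq> 0"
  then have kpos: "tail 0 r > 0" using tail_sign[OF assms, of 0] by (simp add: r_def)
  have r: "0 < r" "r < 1" using assms by (auto simp: r_def)
  then have "isCont (tail 0) r" by (intro isCont_tail) auto
  then have lim: "(tail 0 \<longlongrightarrow> tail 0 r) (at_left r)" by (metis isCont_def filterlim_at_split)
  define B where "B = 2 / ((1 - r) * tail 0 r)"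
  have "\<forall>\<^sub>F x in at_left r. tail 0 x > tail 0 r / 2"
    using order_tendstoD(1)[OF lim, of "tail 0 r / 2"] kpos by simp
  moreover have "\<forall>\<^sub>F x in at_left r. x \<in> {0<..<r}" using eventually_at_left_real[OF r(1)] .
  ultimately have ev: "\<forall>\<^sub>F x in at_left r. (\<Sum>i<N. \<gamma> i * x ^ i) \<le> B" for N
  proof eventually_elim
    case (elim x)
    then have x: "0 \<le> x" "x < 1 / growth" by (auto simp: r_def)
    have "(\<Sum>i<N. \<gamma> i * x ^ i) \<le> \<Gamma> x" unfolding \<Gamma>_def
      using x \<gamma>_nonneg by (intro sum_le_suminf summable_norm_cancel[OF summable_\<gamma>]) auto
    also have "\<Gamma> x = 1 / ((1 - x) * tail 0 x)"
    proof -
      have "((1 - x) * tail 0 x) * \<Gamma> x = 1" using kneading_product[OF x] by (simp only: mult_ac)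
      moreover from this have "(1 - x) * tail 0 x \<noteq> 0" by (metis mult_zero_left zero_neq_one)
      ultimately show ?thesis by (metis nonzero_mult_div_cancel_left)
    qed
    also have "\<dots> \<le> 1 / ((1 - r) * (tail 0 r / 2))"
      using elim r kpos by (intro divide_left_mono mult_mono mult_pos_pos) auto
    finally show ?case by (simp add: B_def)
  qed
  have "(\<Sum>i<N. \<gamma> i * r ^ i) \<le> B" for N
  proof (rule tendsto_upperbound[OF _ ev])
    show "((\<lambda>x. \<Sum>i<N. \<gamma> i * x ^ i) \<longlongrightarrow> (\<Sum>i<N. \<gamma> i * r ^ i)) (at_left r)" by (intro tendsto_intros)
  qed simp
  then have s: "summable (\<lambda>i. \<gamma> i * r ^ i)" using \<gamma>_nonneg r by (intro summableI_nonneg_bounded) auto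
  have s1: "summable (\<lambda>i. norm (\<gamma> i * r ^ i))" using s \<gamma>_nonneg r by simp
  have s2: "summable (\<lambda>i. norm (r ^ i))" using r by (simp add: summable_geometric)
  have "(\<lambda>k. \<Sum>i\<le>k. \<gamma> i * r ^ i * r ^ (k - i)) \<longlonglongrightarrow> 0"
    by (intro summable_LIMSEQ_zero sums_summable[OF Cauchy_product_sums[OF s1 s2]])
  moreover have "(\<Sum>i\<le>k. \<gamma> i * r ^ i * r ^ (k - i)) = (real (laps (Suc k)) - 1) * r ^ k" for k
  proof -
    have "(\<Sum>i\<le>k. \<gamma> i * r ^ i * r ^ (k - i)) = (\<Sum>i\<le>k. \<gamma> i) * r ^ k"
      unfolding sum_distrib_right by (intro sum.cong) (auto simp: power_add[symmetric] mult.assoc)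
    then show ?thesis unfolding laps_eq_sum lessThan_Suc_atMost by simp
  qed
  ultimately have "(\<lambda>k. (real (laps (Suc k)) - 1) * r ^ k + r ^ k) \<longlonglongrightarrow> 0 + 0"
    using r by (intro tendsto_add LIMSEQ_realpow_zero) auto
  moreover have "growth \<le> (real (laps (Suc k)) - 1) * r ^ k + r ^ k" for k
  proof -
    have "growth * (growth * r) ^ k \<le> real (laps (Suc k)) * r ^ k"
      using growth_power_le[of "Suc k"] r by (simp add: power_mult_distrib mult.assoc[symmetric])
    moreover have "growth * r = 1" using assms by (simp add: r_def)
    ultimately have "growth \<le> real (laps (Suc k)) * r ^ k" by simp
    then show ?thesis by (simp add: algebra_simps)
  qed
  ultimately have "growth \<le> 0" by (intro tendsto_lowerbound[where f = "\<lambda>k. (real (laps (Suc k)) - 1) * r ^ k + r ^ k"]) auto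
  then show False using assms by simp
qed

end

section \<open>Renormalization of tent maps\<close>

text \<open>
  The orbit of \<open>0\<close> under \<open>u \<mapsto> s * \<bar>u - 1\<bar>\<close>, which is the tent map of slope \<open>s\<close> in the coordinate that
  measures the distance from the critical value.
\<close>

primrec tent_orbit :: "real \<Rightarrow> nat \<Rightarrow> real" where
  "tent_orbit s 0 = 0"
| "tent_orbit s (Suc j) = s * \<bar>tent_orbit s j - 1\<bar>"

text \<open>
  The period doubling sequence: the sign depends only on the parity of the exponent of \<open>2\<close> in \<open>n + 1\<close>.
\<close>

function doubling_sign :: "nat \<Rightarrow> real" where
  "doubling_sign n = (if even n then -1 else - doubling_sign (n div 2))"
  by auto
termination
  by (relation "Wellfounded.measure (\<lambda>n. n)") (auto elim!: oddE)

declare doubling_sign.simps [simp del]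

lemma doubling_sign_even: "doubling_sign (2 * i) = -1"
  and doubling_sign_odd: "doubling_sign (Suc (2 * i)) = - doubling_sign i"
  by (subst doubling_sign.simps; simp)+

lemma tent_orbit_bounds:
  assumes "1 \<le> s" "s \<le> 2"
  shows "0 \<le> tent_orbit s j \<and> tent_orbit s j \<le> s"
proof (induction j)
  case (Suc j)
  then have "\<bar>tent_orbit s j - 1\<bar> \<le> 1" using assms by auto
  then show ?case using assms mult_left_mono[of "\<bar>tent_orbit s j - 1\<bar>" 1 s] by simp
qed (use assms in simp)

text \<open>
  For \<open>s\<^sup>2 \<le> 2\<close> the second iterate of the tent map of slope \<open>s\<close>, restricted to a neighbourhood of \<open>0\<close> and
  rescaled by \<open>s / (s - 1)\<close>, is the tent map of slope \<open>s\<^sup>2\<close>.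
\<close>

lemma tent_orbit_renormalization:
  assumes "1 < s" "s\<^sup>2 \<le> 2"
  shows "tent_orbit s (2 * j) = (s - 1) / s * tent_orbit (s\<^sup>2) j"
    and "tent_orbit s (2 * j) < 1"
    and "tent_orbit s (Suc (2 * j)) - 1 = (s - 1) * (1 - tent_orbit (s\<^sup>2) j)"
proof -
  have s2: "1 \<le> s\<^sup>2" using assms by simp
  have small: "(s - 1) / s * tent_orbit (s\<^sup>2) j < 1" for j
  proof -
    have "(s - 1) / s * tent_orbit (s\<^sup>2) j \<le> (s - 1) / s * s\<^sup>2"
      using tent_orbit_bounds[OF s2 assms(2), of j] assms by (intro mult_left_mono) auto
    also have "\<dots> = s\<^sup>2 - s" using assms by (simp add: power2_eq_square field_simps)
    also have "\<dots> < 1" using assms by linarith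
    finally show ?thesis .
  qed
  have step: "tent_orbit s (Suc (2 * j)) - 1 = (s - 1) * (1 - tent_orbit (s\<^sup>2) j)"
    if "tent_orbit s (2 * j) = (s - 1) / s * tent_orbit (s\<^sup>2) j" for j
  proof -
    have "tent_orbit s (Suc (2 * j)) - 1 = s * (1 - (s - 1) / s * tent_orbit (s\<^sup>2) j) - 1"
      using small[of j] that by (simp only: tent_orbit.simps) simp
    also have "\<dots> = (s - 1) * (1 - tent_orbit (s\<^sup>2) j)" using assms by (simp add: field_simps)
    finally show ?thesis .
  qed
  show even: "tent_orbit s (2 * j) = (s - 1) / s * tent_orbit (s\<^sup>2) j" for j
  proof (induction j)
    case (Suc j)
    have "tent_orbit s (2 * Suc j) = s * \<bar>tent_orbit s (Suc (2 * j)) - 1\<bar>" by simp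
    also have "\<dots> = s * ((s - 1) * \<bar>1 - tent_orbit (s\<^sup>2) j\<bar>)"
      unfolding step[OF Suc] using assms by (simp add: abs_mult)
    also have "\<dots> = (s - 1) / s * tent_orbit (s\<^sup>2) (Suc j)"
      using assms by (simp add: power2_eq_square abs_minus_commute)
    finally show ?case .
  qed simp
  show "tent_orbit s (2 * j) < 1" using small[of j] even[of j] by simp
  show "tent_orbit s (Suc (2 * j)) - 1 = (s - 1) * (1 - tent_orbit (s\<^sup>2) j)" using step[OF even] .
qed

text \<open>
  Each renormalization squares the slope and halves the time, so the sign at time \<open>j\<close> is that of the
  period doubling sequence as long as \<open>s ^ Suc j \<le> 2\<close>.
\<close>

lemma tent_orbit_sign:
  assumes "1 < s" "s ^ Suc j \<le> 2"
  shows "sgn (tent_orbit s j - 1) = doubling_sign j"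
  using assms
proof (induction j arbitrary: s rule: less_induct)
  case (less j)
  show ?case
  proof (cases "j = 0")
    case True
    then show ?thesis using doubling_sign_even[of 0] by simp
  next
    case False
    have "s\<^sup>2 \<le> s ^ Suc j" using less.prems False by (intro power_increasing) auto
    then have s2: "s\<^sup>2 \<le> 2" using less.prems by simp
    show ?thesis
    proof (cases "even j")
      case True
      then obtain i where "j = 2 * i" by (rule evenE)
      then show ?thesis using tent_orbit_renormalization(2)[OF less.prems(1) s2, of i] doubling_sign_even[of i] by simp
    next
      case False
      then obtain i where i: "j = Suc (2 * i)" by (auto elim: oddE)
      have "(s\<^sup>2) ^ Suc i \<le> 2" using less.prems(2) power_mult[of s 2 "Suc i"] by (simp add: i)
      then have "sgn (tent_orbit (s\<^sup>2) i - 1) = doubling_sign i"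
        using less.prems by (intro less.IH) (auto simp: i)
      then show ?thesis
        unfolding i tent_orbit_renormalization(3)[OF less.prems(1) s2] doubling_sign_odd
        using less.prems(1) by (auto simp: sgn_if mult_less_0_iff zero_less_mult_iff split: if_splits)
    qed
  qed
qed

text \<open>
  An even period could be halved by renormalization, and an odd period would identify the constant signs
  at even places with the signs at odd places, which contain a negated copy of the whole sequence.
\<close>

lemma doubling_sign_not_periodic:
  assumes "q > 0"
  shows "\<exists>j\<ge>N. doubling_sign (j + q) \<noteq> doubling_sign j"
  using assms
proof (induction q arbitrary: N rule: less_induct)
  case (less q)
  show ?case
  proof (cases "even q")
    case True
    then obtain p where p: "q = 2 * p" by (rule evenE)
    then obtain i where i: "i \<ge> N" "doubling_sign (i + p) \<noteq> doubling_sign i"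
      using less.IH[of p N] less.prems by auto
    have "Suc (2 * i) + q = Suc (2 * (i + p))" by (simp add: p)
    then have "doubling_sign (Suc (2 * i) + q) \<noteq> doubling_sign (Suc (2 * i))"
      using i(2) by (simp only: doubling_sign_odd neg_equal_iff_equal not_False_eq_True)
    then show ?thesis using i(1) by (intro exI[of _ "Suc (2 * i)"]) auto
  next
    case False
    then obtain p where p: "q = Suc (2 * p)" by (auto elim: oddE)
    have a: "Suc (2 * (2 * N)) + q = 2 * (2 * N + p + 1)" by (simp add: p)
    have "doubling_sign (Suc (2 * (2 * N)) + q) = -1" unfolding a by (rule doubling_sign_even)
    moreover have "doubling_sign (Suc (2 * (2 * N))) = 1" by (simp only: doubling_sign_odd doubling_sign_even minus_minus)
    ultimately show ?thesis by (intro exI[of _ "Suc (2 * (2 * N))"]) auto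
  qed
qed

section \<open>Precision of the entropy in terms of the critical itinerary\<close>

context unimodal_map
begin

lemma tail_split:
  assumes "\<bar>x\<bar> < 1" shows "tail j x = (\<Sum>i<n. \<theta> (j + i) * x ^ i) + x ^ n * tail (j + n) x"
proof (induction n)
  case (Suc n)
  show ?case unfolding Suc using tail_step[OF assms, of "j + n"] by (simp add: algebra_simps)
qed simp

lemma tail_bound:
  assumes "0 \<le> x" "x < 1" shows "\<bar>tail j x\<bar> \<le> 1 / (1 - x)"
proof -
  have x: "\<bar>x\<bar> < 1" using assms by simp
  have "\<bar>tail j x\<bar> \<le> (\<Sum>i. norm (\<theta> (j + i) * x ^ i))"
    unfolding tail_def real_norm_def[symmetric] by (rule summable_norm[OF summable_\<theta>[OF x]])
  also have "\<dots> = (\<Sum>i. x ^ i)" using assms by (simp add: abs_mult \<theta>_abs)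
  also have "\<dots> = 1 / (1 - x)" using x by (intro suminf_geometric) simp
  finally show ?thesis .
qed

definition agrees :: "nat \<Rightarrow> (real \<Rightarrow> real) \<Rightarrow> real \<Rightarrow> bool" where
  "agrees n f' c' \<longleftrightarrow> unimodal_map f' c' \<and> (\<forall>i<n. unimodal_map.\<theta> f' c' i = \<theta> i)"

lemma kneading_close:
  assumes "agrees n f' c'" "0 \<le> x" "x < 1"
  shows "\<bar>unimodal_map.tail f' c' 0 x - tail 0 x\<bar> \<le> 2 * x ^ n / (1 - x)"
proof -
  interpret F: unimodal_map f' c' using assms(1) by (simp add: agrees_def)
  have x: "\<bar>x\<bar> < 1" using assms by simp
  have "(\<Sum>i<n. F.\<theta> (0 + i) * x ^ i) = (\<Sum>i<n. \<theta> (0 + i) * x ^ i)"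
    using assms(1) by (intro sum.cong) (auto simp: agrees_def)
  then have "F.tail 0 x - tail 0 x = x ^ n * (F.tail n x - tail n x)"
    using F.tail_split[OF x, of 0 n] tail_split[OF x, of 0 n] by (simp add: algebra_simps)
  moreover have "\<bar>F.tail n x - tail n x\<bar> \<le> 2 / (1 - x)"
    using F.tail_bound[OF assms(2,3), of n] tail_bound[OF assms(2,3), of n] by (simp add: abs_le_iff)
  ultimately show ?thesis
    using assms mult_left_mono[of "\<bar>F.tail n x - tail n x\<bar>" "2 / (1 - x)" "x ^ n"] by (simp add: abs_mult mult.commute)
qed

text \<open>
  At the zero \<open>1 / growth\<close> of the determinant the quantities \<open>\<theta> j * tail j\<close> are nonnegative. Shifting the
  series by one place then becomes one step of the tent map whose slope is \<open>growth\<close>, and the changes of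
  sign in \<open>\<theta>\<close> tell on which side of the turning point the tent orbit is.
\<close>

lemma kneading_tent:
  assumes "growth > 1"
  shows "\<theta> j * tail j (1 / growth) = tent_orbit growth j"
    and "tent_orbit growth j \<noteq> 1 \<Longrightarrow> \<theta> (Suc j) * \<theta> j = sgn (tent_orbit growth j - 1)"
proof -
  define u where "u j = \<theta> j * tail j (1 / growth)" for j
  have r: "\<bar>1 / growth\<bar> < 1" using assms by (simp add: abs_if)
  have step: "u (Suc j) = (\<theta> (Suc j) * \<theta> j) * (growth * (u j - 1))" for j
  proof -
    have "tail (Suc j) (1 / growth) = growth * (tail j (1 / growth) - \<theta> j)"
      using tail_step[OF r, of j] assms by (simp add: field_simps)
    also have "tail j (1 / growth) - \<theta> j = \<theta> j * (u j - 1)"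
      by (simp add: u_def right_diff_distrib mult.assoc[symmetric] \<theta>_square)
    finally show ?thesis by (simp add: u_def mult_ac)
  qed
  have sign: "\<theta> (Suc j) * \<theta> j = 1 \<or> \<theta> (Suc j) * \<theta> j = -1" for j
    using \<theta>_cases[of j] \<theta>_cases[of "Suc j"] by auto
  have nonneg: "u j \<ge> 0" for j using tail_sign[OF assms] by (simp add: u_def)
  have abs: "u (Suc j) = growth * \<bar>u j - 1\<bar>" for j
  proof -
    have "u (Suc j) = \<bar>u (Suc j)\<bar>" using nonneg[of "Suc j"] by simp
    also have "\<dots> = growth * \<bar>u j - 1\<bar>" unfolding step using assms by (simp add: abs_mult \<theta>_abs)
    finally show ?thesis .
  qed
  have u: "u j = tent_orbit growth j" for j
  proof (induction j)
    case 0
    then show ?case using kneading_zero[OF assms] by (simp add: u_def)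
  next
    case (Suc j)
    then show ?case using abs[of j] by simp
  qed
  then show "\<theta> j * tail j (1 / growth) = tent_orbit growth j" by (simp add: u_def)
  assume "tent_orbit growth j \<noteq> 1"
  then have ne: "u j - 1 \<noteq> 0" by (simp add: u)
  have "growth * ((\<theta> (Suc j) * \<theta> j) * (u j - 1)) = growth * \<bar>u j - 1\<bar>"
    using step[of j] abs[of j] by (metis mult.left_commute)
  then have "(\<theta> (Suc j) * \<theta> j) * (u j - 1) = sgn (u j - 1) * (u j - 1)"
    using assms by (simp add: abs_sgn mult.commute)
  then show "\<theta> (Suc j) * \<theta> j = sgn (tent_orbit growth j - 1)"
    using ne unfolding u[symmetric] by (metis mult_right_cancel)
qed

text \<open>
  If the determinant has no zero in \<open>[0, 1)\<close>, determinants close to it have none in \<open>[0, 1 / \<sigma>]\<close>.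
\<close>

lemma growth_limit_one:
  assumes "growth = 1" "\<sigma> > 1"
  obtains n where "\<And>f' c'. agrees n f' c' \<Longrightarrow> unimodal_map.growth f' < \<sigma>"
proof -
  define \<rho> where "\<rho> = 1 / \<sigma>"
  have \<rho>: "0 < \<rho>" "\<rho> < 1" using assms by (auto simp: \<rho>_def)
  have "continuous_on {0..\<rho>} (tail 0)"
    using \<rho> by (intro continuous_at_imp_continuous_on ballI isCont_tail) auto
  then obtain x0 where x0: "x0 \<in> {0..\<rho>}" "\<And>x. x \<in> {0..\<rho>} \<Longrightarrow> tail 0 x0 \<le> tail 0 x"
    using continuous_attains_inf[of "{0..\<rho>}" "tail 0"] \<rho> by auto
  have pos: "tail 0 x0 > 0" using kneading_pos[of x0] x0 \<rho> assms by auto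
  have "(\<lambda>n. 2 * \<rho> ^ n / (1 - \<rho>)) \<longlonglongrightarrow> 2 * 0 / (1 - \<rho>)"
    using \<rho> by (intro tendsto_intros LIMSEQ_realpow_zero) auto
  then have "\<forall>\<^sub>F n in sequentially. 2 * \<rho> ^ n / (1 - \<rho>) < tail 0 x0"
    using pos by (intro order_tendstoD(2)) auto
  then obtain n where n: "2 * \<rho> ^ n / (1 - \<rho>) < tail 0 x0"
    by (metis eventually_sequentially order_refl)
  have "unimodal_map.growth f' < \<sigma>" if "agrees n f' c'" for f' c'
  proof (rule ccontr)
    interpret F: unimodal_map f' c' using that by (simp add: agrees_def)
    assume "\<not> F.growth < \<sigma>"
    then have g: "F.growth \<ge> \<sigma>" by simp
    define x where "x = 1 / F.growth"
    have x: "0 < x" "x \<le> \<rho>" using g assms by (auto simp: x_def \<rho>_def frac_le)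
    have "\<bar>F.tail 0 x - tail 0 x\<bar> \<le> 2 * x ^ n / (1 - x)" using x \<rho> by (intro kneading_close that) auto
    moreover have "F.tail 0 x = 0" using F.kneading_zero g assms by (simp add: x_def)
    ultimately have "tail 0 x \<le> 2 * x ^ n / (1 - x)" by simp
    also have "\<dots> \<le> 2 * \<rho> ^ n / (1 - \<rho>)" using x \<rho> by (intro frac_le mult_left_mono power_mono) auto
    finally show False using n x0(2)[of x] x by auto
  qed
  then show ?thesis using that by blast
qed

definition eventually_periodic :: bool where
  "eventually_periodic \<longleftrightarrow> (\<exists>q>0. \<exists>N. \<forall>j\<ge>N. \<theta> (j + q) = \<theta> j)"

text \<open>
  Otherwise there are maps of growth greater than \<open>1\<close> whose itineraries agree for ever longer times; their
  growth tends to \<open>1\<close>, so the sign changes of \<open>\<theta>\<close> follow the period doubling sequence.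
\<close>

lemma growth_one_stable:
  assumes "growth = 1" "eventually_periodic"
  obtains n where "\<And>f' c'. agrees n f' c' \<Longrightarrow> unimodal_map.growth f' = 1"
proof (rule ccontr)
  assume neg: "\<not> thesis"
  have ex: "\<exists>f' c'. agrees n f' c' \<and> unimodal_map.growth f' > 1" for n
  proof (rule ccontr)
    assume no: "\<not> ?thesis"
    have "unimodal_map.growth f' = 1" if "agrees n f' c'" for f' c'
      using no that unimodal_map.growth_ge1[of f' c'] by (force simp: agrees_def)
    then show False using neg that by blast
  qed
  have sign: "\<theta> (Suc j) * \<theta> j = doubling_sign j" for j
  proof -
    \<comment> \<open>growth below \<open>\<sigma>\<close> makes the sign at time \<open>j\<close> that of the period doubling sequence\<close>
    define \<sigma> where "\<sigma> = root (Suc j) 2"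
    have \<sigma>: "\<sigma> > 1" "\<sigma> ^ Suc j = 2" unfolding \<sigma>_def by (auto simp: real_root_gt_1_iff simp del: power_Suc)
    obtain n where n: "\<And>f' c'. agrees n f' c' \<Longrightarrow> unimodal_map.growth f' < \<sigma>"
      using growth_limit_one[OF assms(1) \<sigma>(1)] by blast
    obtain f' c' where f': "agrees (max n (j + 2)) f' c'" "unimodal_map.growth f' > 1" using ex by blast
    interpret F: unimodal_map f' c' using f' by (simp add: agrees_def)
    have "agrees n f' c'" using f'(1) by (auto simp: agrees_def)
    then have "F.growth < \<sigma>" by (rule n)
    then have "F.growth ^ Suc j \<le> 2" using f'(2) \<sigma>(2) power_mono[of F.growth \<sigma> "Suc j"] by simp
    then have s: "sgn (tent_orbit F.growth j - 1) = doubling_sign j" by (intro tent_orbit_sign f')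
    moreover have "doubling_sign j \<noteq> 0"
      by (induction j rule: less_induct) (subst doubling_sign.simps, auto elim!: oddE)
    ultimately have "tent_orbit F.growth j \<noteq> 1" by auto
    then have "F.\<theta> (Suc j) * F.\<theta> j = doubling_sign j" using F.kneading_tent(2)[OF f'(2)] s by simp
    moreover have "F.\<theta> (Suc j) = \<theta> (Suc j)" "F.\<theta> j = \<theta> j" using f'(1) by (auto simp: agrees_def)
    ultimately show ?thesis by simp
  qed
  obtain q N where q: "q > 0" "\<And>j. j \<ge> N \<Longrightarrow> \<theta> (j + q) = \<theta> j" using assms(2) by (auto simp: eventually_periodic_def)
  obtain j where j: "j \<ge> N" "doubling_sign (j + q) \<noteq> doubling_sign j"
    using doubling_sign_not_periodic[OF q(1)] by blast
  show False using j(2) q(2)[of j] q(2)[of "Suc j"] j(1) unfolding sign[symmetric] by simp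
qed

text \<open>
  For eventually periodic signs the determinant is a polynomial divided by \<open>1 - x ^ q\<close>, so its zero at
  \<open>1 / growth\<close> has a finite order \<open>m\<close>.
\<close>

lemma kneading_lower_bound:
  assumes "growth > 1" "eventually_periodic"
  obtains \<rho> \<kappa> m where "1 / growth < \<rho>" "\<rho> < 1" "\<kappa> > 0" "m > 0"
    "\<And>x. 0 \<le> x \<Longrightarrow> x \<le> \<rho> \<Longrightarrow> \<kappa> * \<bar>x - 1 / growth\<bar> ^ m \<le> \<bar>tail 0 x\<bar>"
proof -
  define r where "r = 1 / growth"
  have r: "0 < r" "r < 1" using assms by (auto simp: r_def)
  obtain q N where q: "q > 0" "\<And>j. j \<ge> N \<Longrightarrow> \<theta> (j + q) = \<theta> j" using assms(2) by (auto simp: eventually_periodic_def)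
  define S where "S j n = (\<Sum>i<n. monom (\<theta> (j + i)) i)" for j n
  \<comment> \<open>preperiodic part times \<open>1 - x ^ q\<close>, plus one period shifted by \<open>N\<close>\<close>
  define Q where "Q = S 0 N * (1 - monom 1 q) + monom 1 N * S N q"
  have S: "poly (S j n) x = (\<Sum>i<n. \<theta> (j + i) * x ^ i)" for j n x
    by (simp add: S_def poly_sum poly_monom)
  have Q: "poly Q x = tail 0 x * (1 - x ^ q)" if x: "\<bar>x\<bar> < 1" for x
  proof -
    have "tail (N + q) x = tail N x" unfolding tail_def
    proof (intro arg_cong[where f = suminf] ext)
      fix i
      have "\<theta> (N + q + i) = \<theta> (N + i)" using q(2)[of "N + i"] by (simp add: add_ac)
      then show "\<theta> (N + q + i) * x ^ i = \<theta> (N + i) * x ^ i" by simp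
    qed
    then have "tail N x * (1 - x ^ q) = (\<Sum>i<q. \<theta> (N + i) * x ^ i)"
      using tail_split[OF x, of N q] by (simp add: algebra_simps)
    then have "poly Q x = (\<Sum>i<N. \<theta> (0 + i) * x ^ i) * (1 - x ^ q) + x ^ N * (tail N x * (1 - x ^ q))"
      by (simp add: Q_def S poly_monom)
    also have "\<dots> = ((\<Sum>i<N. \<theta> (0 + i) * x ^ i) + x ^ N * tail N x) * (1 - x ^ q)" by (simp add: algebra_simps)
    finally show ?thesis using tail_split[OF x, of 0 N] by simp
  qed
  have "poly Q 0 = 1" using Q[of 0] tail_step[of 0 0] q(1) by simp
  then have Q0: "Q \<noteq> 0" by auto
  define m where "m = order r Q"
  obtain R where R: "Q = [:- r, 1:] ^ m * R" "\<not> [:- r, 1:] dvd R"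
    using order_decomp[OF Q0, of r] by (auto simp: m_def)
  have Rr: "poly R r \<noteq> 0" using R(2) by (simp add: poly_eq_0_iff_dvd)
  have "poly Q r = 0" using Q[of r] r kneading_zero[OF assms(1)] by (simp add: r_def)
  then have m: "m > 0" using order_root[of Q r] Q0 by (simp add: m_def)
  have "\<forall>\<^sub>F x in at r. poly R x \<noteq> 0"
    using Rr by (intro tendsto_imp_eventually_ne[of _ "poly R r"]) (auto intro!: tendsto_intros)
  then obtain \<delta> where \<delta>: "\<delta> > 0" "\<And>x. x \<noteq> r \<Longrightarrow> dist x r < \<delta> \<Longrightarrow> poly R x \<noteq> 0"
    unfolding eventually_at by auto
  \<comment> \<open>close enough to \<open>r\<close> to exclude further zeros of the determinant in \<open>(r, \<rho>]\<close>\<close>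
  define \<rho> where "\<rho> = r + min (\<delta> / 2) ((1 - r) / 2)"
  have \<rho>: "r < \<rho>" "\<rho> < 1" "\<rho> < r + \<delta>" using \<delta>(1) r by (auto simp: \<rho>_def min_def field_simps)
  have nz: "poly R x \<noteq> 0" if "x \<in> {0..\<rho>}" for x
  proof (cases "x < r")
    case True
    then have "tail 0 x > 0" using that by (intro kneading_pos) (auto simp: r_def)
    moreover have "x ^ q < 1" using True that r q(1) by (intro power_less_one_iff[THEN iffD2]) auto
    ultimately have "poly Q x \<noteq> 0" using Q[of x] True that r by auto
    then show ?thesis using R(1) by auto
  next
    case False
    then show ?thesis using Rr \<delta>(2)[of x] \<rho> that by (cases "x = r") (auto simp: dist_real_def)
  qed
  have "continuous_on {0..\<rho>} (\<lambda>x. \<bar>poly R x\<bar>)" by (intro continuous_intros)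
  then obtain x0 where x0: "x0 \<in> {0..\<rho>}" "\<And>x. x \<in> {0..\<rho>} \<Longrightarrow> \<bar>poly R x0\<bar> \<le> \<bar>poly R x\<bar>"
    using continuous_attains_inf[of "{0..\<rho>}" "\<lambda>x. \<bar>poly R x\<bar>"] \<rho> r by auto
  define \<kappa> where "\<kappa> = \<bar>poly R x0\<bar>"
  have "\<kappa> * \<bar>x - r\<bar> ^ m \<le> \<bar>tail 0 x\<bar>" if x: "0 \<le> x" "x \<le> \<rho>" for x
  proof -
    have x1: "\<bar>x\<bar> < 1" using x \<rho> by simp
    have "\<kappa> * \<bar>x - r\<bar> ^ m \<le> \<bar>poly R x\<bar> * \<bar>x - r\<bar> ^ m"
      using x0(2)[of x] x by (intro mult_right_mono) (auto simp: \<kappa>_def)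
    also have "\<dots> = \<bar>poly Q x\<bar>" by (simp add: R(1) abs_mult power_abs)
    also have "\<dots> = \<bar>tail 0 x\<bar> * \<bar>1 - x ^ q\<bar>" by (simp add: Q[OF x1] abs_mult)
    also have "\<dots> \<le> \<bar>tail 0 x\<bar> * 1"
      using x x1 power_le_one[of x q] zero_le_power[of x q] by (intro mult_left_mono) (auto simp: abs_le_iff)
    finally show ?thesis by simp
  qed
  moreover have "\<kappa> > 0" using nz[OF x0(1)] by (simp add: \<kappa>_def)
  ultimately show ?thesis using that[of \<rho> \<kappa> m] \<rho> m by (simp add: r_def)
qed

text \<open>
  If the other map has the larger growth, its determinant vanishes at the point in question. If it has the
  smaller growth, its determinant is positive and essentially decreasing beyond \<open>1 / growth\<close>, where it is
  already exponentially small. This replaces an analysis of sign changes, so zeros of even order cause no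
  difficulty. The minimum with \<open>\<rho>\<close> keeps the point inside the region where the series converge uniformly.
\<close>

lemma kneading_small:
  assumes "growth > 1" "1 / growth < \<rho>" "\<rho> < 1" "agrees n f' c'"
  shows "\<bar>tail 0 (min (1 / unimodal_map.growth f') \<rho>)\<bar> \<le> 4 * \<rho> ^ n / (1 - \<rho>)"
proof -
  interpret F: unimodal_map f' c' using assms(4) by (simp add: agrees_def)
  define r r' where "r = 1 / growth" and "r' = 1 / F.growth"
  have r: "0 < r" "r < \<rho>" using assms by (auto simp: r_def)
  have r': "0 < r'" "r' \<le> 1" using F.growth_ge1 by (auto simp: r'_def)
  have mono: "2 * x ^ n / (1 - x) \<le> 2 * \<rho> ^ n / (1 - \<rho>)" if "0 \<le> x" "x \<le> \<rho>" for x
    using that assms(3) by (intro frac_le mult_left_mono power_mono) auto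
  have close: "\<bar>F.tail 0 x - tail 0 x\<bar> \<le> 2 * \<rho> ^ n / (1 - \<rho>)" if "0 \<le> x" "x \<le> \<rho>" for x
    using kneading_close[OF assms(4), of x] mono[OF that] that assms(3) by linarith
  have double: "4 * \<rho> ^ n / (1 - \<rho>) = 2 * \<rho> ^ n / (1 - \<rho>) + 2 * \<rho> ^ n / (1 - \<rho>)" by simp
  show ?thesis
  proof (cases "r' \<le> r")
    case True
    then have "1 / F.growth < 1" using r assms(3) by (simp add: r'_def)
    then have "F.growth > 1" using F.growth_ge1 by (simp add: field_simps)
    then have "F.tail 0 r' = 0" using F.kneading_zero by (simp add: r'_def)
    moreover have "min r' \<rho> = r'" using True r by simp
    moreover have "0 \<le> 2 * \<rho> ^ n / (1 - \<rho>)" using r assms by simp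
    ultimately show ?thesis using close[of r'] True r r' double unfolding r'_def[symmetric] by simp
  next
    case False
    define y where "y = min r' \<rho>"
    have y: "r < y" "y \<le> \<rho>" using False r by (auto simp: y_def)
    have "\<bar>tail 0 x\<bar> \<le> 4 * \<rho> ^ n / (1 - \<rho>)" if x: "r < x" "x < y" for x
    proof -
      have xr: "x < 1 / F.growth" "x < \<rho>" using x by (auto simp: y_def r'_def)
      have Fpos: "F.tail 0 x > 0" using x r xr by (intro F.kneading_pos) auto
      have "tail 0 r = 0" using kneading_zero[OF assms(1)] by (simp add: r_def)
      then have "F.tail 0 r \<le> 2 * r ^ n / (1 - r)"
        using kneading_close[OF assms(4), of r] r assms(3) by simp
      then have "(1 - r) * F.tail 0 r \<le> 2 * r ^ n" using r assms(3) by (simp add: field_simps)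
      moreover have "(1 - x) * F.tail 0 x \<le> (1 - r) * F.tail 0 r"
        using x r xr by (intro F.kneading_decreasing) auto
      ultimately have "(1 - x) * F.tail 0 x \<le> 2 * r ^ n" by simp
      then have "F.tail 0 x \<le> 2 * r ^ n / (1 - x)" using xr assms(3) by (simp add: field_simps)
      also have "\<dots> \<le> 2 * \<rho> ^ n / (1 - \<rho>)" using r xr assms(3) by (intro frac_le mult_left_mono power_mono) auto
      finally show ?thesis using Fpos close[of x] x r xr double by linarith
    qed
    moreover have "((\<lambda>x. \<bar>tail 0 x\<bar>) \<longlongrightarrow> \<bar>tail 0 y\<bar>) (at_left y)"
      using isCont_tail[of y 0] y r assms(3) by (intro tendsto_rabs) (metis isCont_def filterlim_at_split abs_of_pos order.strict_trans order.strict_trans1)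
    moreover have "\<forall>\<^sub>F x in at_left y. x \<in> {r<..<y}" using eventually_at_left_real[OF y(1)] .
    ultimately have "\<bar>tail 0 y\<bar> \<le> 4 * \<rho> ^ n / (1 - \<rho>)"
      by (intro tendsto_upperbound[of "\<lambda>x. \<bar>tail 0 x\<bar>" _ "at_left y"]) (auto elim!: eventually_mono)
    then show ?thesis by (simp add: y_def r'_def)
  qed
qed

lemma ln_growth_diff:
  assumes "unimodal_map f' c'"
  shows "\<bar>ln (unimodal_map.growth f') - ln growth\<bar> \<le> 4 * \<bar>1 / unimodal_map.growth f' - 1 / growth\<bar>"
proof -
  interpret F: unimodal_map f' c' by fact
  have lip: "ln a - ln b \<le> \<bar>a - b\<bar>" if "1 \<le> a" "1 \<le> b" for a b :: real
  proof -
    have "ln a - ln b = ln (a / b)" using that by (simp add: ln_div)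
    also have "\<dots> \<le> a / b - 1" using that by (intro ln_le_minus_one) auto
    also have "\<dots> = (a - b) / b" using that by (simp add: field_simps)
    also have "\<dots> \<le> \<bar>a - b\<bar> / b" using that by (intro divide_right_mono) auto
    also have "\<dots> \<le> \<bar>a - b\<bar> / 1" using that by (intro divide_left_mono) auto
    finally show ?thesis by simp
  qed
  have "\<bar>ln F.growth - ln growth\<bar> \<le> \<bar>F.growth - growth\<bar>"
    using lip[of F.growth growth] lip[of growth F.growth] growth_ge1 F.growth_ge1 by auto
  also have "F.growth - growth = F.growth * growth * (1 / growth - 1 / F.growth)"
    using growth_ge1 F.growth_ge1 by (simp add: field_simps)
  also have "\<bar>\<dots>\<bar> = F.growth * growth * \<bar>1 / F.growth - 1 / growth\<bar>"
    using growth_ge1 F.growth_ge1 by (simp add: abs_mult abs_minus_commute)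
  also have "\<dots> \<le> (2 * 2) * \<bar>1 / F.growth - 1 / growth\<bar>"
    using growth_ge1 F.growth_ge1 growth_le2 F.growth_le2 by (intro mult_right_mono mult_mono) auto
  finally show ?thesis by simp
qed

text \<open>
  The zeros of two determinants that are \<open>\<rho> ^ n\<close>-close lie at a distance of order \<open>root m \<rho> ^ n\<close>, where \<open>m\<close>
  is the order of the zero.
\<close>

theorem entropy_exponentially_close:
  assumes "eventually_periodic"
  obtains C \<rho> where "0 \<le> C" "0 < \<rho>" "\<rho> < 1"
    "\<And>n f' c'. agrees n f' c' \<Longrightarrow> \<bar>ln (unimodal_map.growth f') - ln growth\<bar> \<le> C * \<rho> ^ n"
proof (cases "growth = 1")
  case True
  obtain N where N: "\<And>f' c'. agrees N f' c' \<Longrightarrow> unimodal_map.growth f' = 1"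
    using growth_one_stable[OF True assms] by blast
  have "\<bar>ln (unimodal_map.growth f') - ln growth\<bar> \<le> 2 ^ N * (1 / 2) ^ n" if a: "agrees n f' c'" for n f' c'
  proof (cases "N \<le> n")
    case ge: True
    then have "agrees N f' c'" using a by (auto simp: agrees_def)
    then show ?thesis using N True by simp
  next
    case False
    interpret F: unimodal_map f' c' using a by (simp add: agrees_def)
    have "\<bar>ln F.growth - ln growth\<bar> \<le> F.growth - 1"
      using F.growth_ge1 True ln_le_minus_one[of F.growth] by simp
    also have "\<dots> \<le> 1" using F.growth_le2 by simp
    also have "(1::real) \<le> 2 ^ (N - n)" by simp
    also have "(2::real) ^ (N - n) = 2 ^ N * (1 / 2) ^ n" using False by (simp add: power_diff power_divide)
    finally show ?thesis .
  qed
  then show ?thesis by (intro that[of "2 ^ N" "1 / 2"]) auto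
next
  case False
  then have g: "growth > 1" using growth_ge1 by simp
  obtain \<rho> \<kappa> m where \<rho>: "1 / growth < \<rho>" "\<rho> < 1" and \<kappa>: "\<kappa> > 0" and m: "m > 0"
    and lower: "\<And>x. 0 \<le> x \<Longrightarrow> x \<le> \<rho> \<Longrightarrow> \<kappa> * \<bar>x - 1 / growth\<bar> ^ m \<le> \<bar>tail 0 x\<bar>"
    using kneading_lower_bound[OF g assms] by blast
  define r where "r = 1 / growth"
  have r: "0 < r" "r < \<rho>" using g \<rho> by (auto simp: r_def)
  define K where "K = 1 / (\<rho> - r)"
  have K: "K \<ge> 1" using r \<rho> by (simp add: K_def field_simps)
  define A where "A = 4 / (1 - \<rho>) / \<kappa>"
  have A: "A > 0" using \<kappa> \<rho> by (simp add: A_def)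
  have "\<bar>ln (unimodal_map.growth f') - ln growth\<bar> \<le> (4 * K * root m A) * root m \<rho> ^ n" if a: "agrees n f' c'" for n f' c'
  proof -
    interpret F: unimodal_map f' c' using a by (simp add: agrees_def)
    define x where "x = min (1 / F.growth) \<rho>"
    have x: "0 \<le> x" "x \<le> \<rho>" using r F.growth_ge1 by (auto simp: x_def)
    have "\<kappa> * \<bar>x - r\<bar> ^ m \<le> 4 * \<rho> ^ n / (1 - \<rho>)"
      using lower[OF x] kneading_small[OF g \<rho> a] unfolding x_def r_def by linarith
    then have "\<bar>x - r\<bar> ^ m \<le> 4 * \<rho> ^ n / (1 - \<rho>) / \<kappa>" by (subst pos_le_divide_eq[OF \<kappa>]) (simp add: mult.commute)
    then have "\<bar>x - r\<bar> ^ m \<le> A * \<rho> ^ n" by (simp add: A_def)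
    then have "root m (\<bar>x - r\<bar> ^ m) \<le> root m (A * \<rho> ^ n)" using m by simp
    then have xr: "\<bar>x - r\<bar> \<le> root m A * root m \<rho> ^ n"
      using m by (simp add: real_root_power_cancel real_root_mult real_root_power)
    have "\<bar>1 / F.growth - r\<bar> \<le> K * \<bar>x - r\<bar>"
    proof (cases "1 / F.growth \<le> \<rho>")
      case True
      then have "x = 1 / F.growth" by (simp add: x_def)
      then show ?thesis using K mult_right_mono[of 1 K "\<bar>x - r\<bar>"] by simp
    next
      case False
      then have "K * \<bar>x - r\<bar> = 1" using r by (simp add: x_def K_def min_def)
      moreover have "1 / F.growth \<le> 1" by (rule F.inv_growth_le1)
      ultimately show ?thesis using False r by (simp add: abs_le_iff)
    qed
    also have "\<dots> \<le> K * (root m A * root m \<rho> ^ n)" using xr K by (intro mult_left_mono) auto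
    finally show ?thesis using ln_growth_diff[OF F.unimodal_map_axioms] by (simp add: r_def mult.assoc)
  qed
  moreover have "0 \<le> 4 * K * root m A" using K A m by simp
  moreover have "0 < root m \<rho>" "root m \<rho> < 1" using r \<rho> m by auto
  ultimately show ?thesis using that by blast
qed

end

section \<open>Critical orbits attracted to a neutral cycle\<close>

lemma sgn_stable:
  fixes u v b b' :: real
  assumes "\<bar>u - v\<bar> \<le> \<Delta> / 3" "\<bar>b' - b\<bar> < \<Delta> / 3" "\<Delta> \<le> \<bar>v - b\<bar>" "0 < \<Delta>"
  shows "u \<noteq> b' \<and> sgn (b' - u) = sgn (b - v)"
proof -
  have "u - v \<le> \<Delta> / 3" "- (u - v) \<le> \<Delta> / 3" "b' - b < \<Delta> / 3" "- (b' - b) < \<Delta> / 3"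
    using assms(1,2) abs_ge_self[of "u - v"] abs_ge_minus_self[of "u - v"]
      abs_ge_self[of "b' - b"] abs_ge_minus_self[of "b' - b"] by (meson order.trans order.strict_trans1)+
  moreover have "\<Delta> \<le> v - b \<or> \<Delta> \<le> b - v" using assms(3) by linarith
  ultimately have "(v < b \<and> u < b') \<or> (b < v \<and> b' < u)" using assms(4) by argo
  then show ?thesis by (auto simp: sgn_if)
qed

text \<open>
  A family in normal form. The function \<open>a t\<close> is the derivative of \<open>g t\<close>, \<open>cr t\<close> is its critical point, and
  \<open>p\<close> lies on the neutral cycle, of period \<open>k\<close>, of \<open>g 0\<close>.
\<close>

locale parabolic_family =
  fixes g a :: "real \<Rightarrow> real \<Rightarrow> real" and cr :: "real \<Rightarrow> real" and L p :: real and k :: nat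
  assumes uni: "\<And>t. t \<in> {0..1} \<Longrightarrow> unimodal_map (g t) (cr t)"
    and deriv: "\<And>t x. t \<in> {0..1} \<Longrightarrow> x \<in> {-1..1} \<Longrightarrow> (g t has_real_derivative a t x) (at x within {-1..1})"
    and deriv_close: "\<And>e. e > 0 \<Longrightarrow> \<exists>\<delta>>0. \<forall>t\<in>{0..1}. \<forall>x\<in>{-1..1}. \<forall>y\<in>{-1..1}.
        t < \<delta> \<longrightarrow> \<bar>x - y\<bar> < \<delta> \<longrightarrow> \<bar>a t x - a 0 y\<bar> < e"
    and L: "L \<ge> 1"
    and lip_t: "\<And>t x. t \<in> {0..1} \<Longrightarrow> x \<in> {-1..1} \<Longrightarrow> \<bar>g t x - g 0 x\<bar> \<le> L * t"
    and lip_x: "\<And>t x y. t \<in> {0..1} \<Longrightarrow> x \<in> {-1..1} \<Longrightarrow> y \<in> {-1..1} \<Longrightarrow> \<bar>g t x - g t y\<bar> \<le> L * \<bar>x - y\<bar>"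
    and k: "k > 0" and p: "p \<in> {-1..1}" "(g 0 ^^ k) p = p"
    and neutral: "(\<Prod>i<k. \<bar>a 0 ((g 0 ^^ i) p)\<bar>) = 1"
    and attracted: "(\<lambda>n. infdist ((g 0 ^^ n) (cr 0)) (forward_orbit (g 0) p)) \<longlonglongrightarrow> 0"
    and disjoint: "forward_orbit (g 0) p \<inter> forward_orbit (g 0) (cr 0) = {}"
begin

sublocale G0: unimodal_map "g 0" "cr 0"
  by (rule uni) simp

abbreviation orb :: "nat \<Rightarrow> real" where "orb i \<equiv> (g 0 ^^ i) p"
abbreviation y :: "nat \<Rightarrow> real" where "y j \<equiv> (g 0 ^^ j) (cr 0)"
abbreviation P :: "real set" where "P \<equiv> forward_orbit (g 0) p"

lemma orb_periodic: "orb (i + k) = orb i"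
  by (simp add: funpow_add p(2))

lemma orb_mod: "orb (i mod k) = orb i"
proof (induction i rule: less_induct)
  case (less i)
  show ?case
  proof (cases "i < k")
    case False
    then have "orb ((i - k) mod k) = orb (i - k)" using less k by simp
    then show ?thesis using orb_periodic[of "i - k"] False by (simp add: le_mod_geq)
  qed simp
qed

lemma finite_P: "finite P"
proof -
  have "P \<subseteq> orb ` {..<k}"
  proof
    fix u assume "u \<in> P"
    then obtain i where "u = orb i" by (auto simp: forward_orbit_def)
    then have "u = orb (i mod k)" by (simp add: orb_mod)
    then show "u \<in> orb ` {..<k}" using k by simp
  qed
  then show ?thesis by (rule finite_subset) simp
qed

lemma P_nonempty: "P \<noteq> {}"
  by (simp add: forward_orbit_def)

lemma P_in: "u \<in> P \<Longrightarrow> u \<in> {-1..1}"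
  using G0.iter_in[OF p(1)] by (auto simp: forward_orbit_def)

lemma y_in: "y j \<in> {-1..1}"
  by (rule G0.iter_in[OF G0.c_in])

text \<open>
  The cycle is finite, so an orbit that comes close to it follows one of its points with a fixed phase.
\<close>

lemma asymptotic_phase:
  assumes "\<delta> > 0"
  obtains N s where "N > 0" "\<And>i. \<bar>y (N + i) - orb (s + i)\<bar> \<le> \<delta>"
proof -
  obtain \<sigma> where \<sigma>: "\<sigma> > 0" "\<And>u v. u \<in> P \<Longrightarrow> v \<in> P \<Longrightarrow> u \<noteq> v \<Longrightarrow> \<sigma> \<le> dist u v"
  proof -
    define D where "D = insert 1 ((\<lambda>(u, v). dist u v) ` Set.filter (\<lambda>(u, v). u \<noteq> v) (P \<times> P))"
    have fin: "finite D" unfolding D_def using finite_P by simp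
    have "0 < Min D" using fin by (subst Min_gr_iff) (auto simp: D_def)
    moreover have "Min D \<le> dist u v" if "u \<in> P" "v \<in> P" "u \<noteq> v" for u v
    proof (rule Min_le[OF fin])
      have "(u, v) \<in> Set.filter (\<lambda>(u, v). u \<noteq> v) (P \<times> P)" using that by simp
      then show "dist u v \<in> D" unfolding D_def by (intro insertI2) force
    qed
    ultimately show ?thesis using that by blast
  qed
  \<comment> \<open>so small that the image of a point near \<open>u\<close> can only be near \<open>g 0 u\<close>\<close>
  define \<delta>' where "\<delta>' = min \<delta> (\<sigma> / (L + 2))"
  have \<delta>': "\<delta>' > 0" "\<delta>' \<le> \<delta>" using assms \<sigma>(1) L by (auto simp: \<delta>'_def)
  have "\<delta>' * (L + 2) \<le> \<sigma>" using L by (simp add: \<delta>'_def pos_le_divide_eq[symmetric])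
  moreover have "L * \<delta>' + \<delta>' < \<delta>' * (L + 2)" using \<delta>'(1) by (simp add: algebra_simps)
  ultimately have small: "L * \<delta>' + \<delta>' < \<sigma>" by simp
  obtain N0 where N0: "\<And>n. n \<ge> N0 \<Longrightarrow> infdist (y n) P < \<delta>'"
    using order_tendstoD(2)[OF attracted \<delta>'(1)] by (auto simp: eventually_sequentially)
  have near: "\<exists>u\<in>P. \<bar>y n - u\<bar> < \<delta>'" if n: "n \<ge> N0" for n
  proof -
    obtain u where "u \<in> P" "infdist (y n) P = dist (y n) u"
      using infdist_attains_inf[OF finite_imp_closed[OF finite_P] P_nonempty] by blast
    then show ?thesis using N0[OF n] by (auto simp: dist_real_def)
  qed
  define N where "N = Suc N0"
  obtain s where s: "\<bar>y N - orb s\<bar> < \<delta>'" using near[of N] by (auto simp: N_def forward_orbit_def)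
  have "\<bar>y (N + i) - orb (s + i)\<bar> < \<delta>'" for i
  proof (induction i)
    case (Suc i)
    obtain u where u: "u \<in> P" "\<bar>y (N + Suc i) - u\<bar> < \<delta>'" using near[of "N + Suc i"] by (auto simp: N_def)
    have oP: "orb j \<in> P" for j by (simp add: forward_orbit_def)
    have "\<bar>g 0 (y (N + i)) - g 0 (orb (s + i))\<bar> \<le> L * \<bar>y (N + i) - orb (s + i)\<bar>"
      using P_in[OF oP] y_in by (intro lip_x) auto
    also have "\<dots> \<le> L * \<delta>'" using Suc L by (intro mult_left_mono) auto
    finally have "\<bar>y (N + Suc i) - orb (s + Suc i)\<bar> \<le> L * \<delta>'" by simp
    then have "dist u (orb (s + Suc i)) < \<sigma>" using u(2) small unfolding dist_real_def by linarith
    then have "u = orb (s + Suc i)" using \<sigma>(2)[OF u(1) oP] by (metis not_less)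
    then show ?case using u by simp
  qed (use s in simp)
  then show ?thesis using that[of N s] \<delta>'(2) by (auto simp: N_def intro: order.trans[OF less_imp_le])
qed

lemma cr_notin_P: "cr 0 \<notin> P"
proof -
  have "cr 0 \<in> forward_orbit (g 0) (cr 0)" unfolding forward_orbit_def by (rule range_eqI[of _ _ 0]) simp
  then show ?thesis using disjoint by blast
qed

lemma infdist_cr: "infdist (cr 0) P > 0"
  using cr_notin_P finite_imp_closed[OF finite_P] P_nonempty
  by (metis in_closed_iff_infdist_zero infdist_nonneg less_eq_real_def)

lemma y_neq_cr: assumes "j > 0" shows "y j \<noteq> cr 0"
proof
  assume e: "y j = cr 0"
  have const: "y (n * j) = cr 0" for n
    by (induction n) (simp_all add: funpow_add e)
  have "filterlim (\<lambda>n. n * j) at_top sequentially" using assms by (intro mult_nat_right_at_top)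
  from filterlim_compose[OF attracted this] have "(\<lambda>n::nat. infdist (cr 0) P) \<longlonglongrightarrow> 0"
    unfolding const .
  then show False using infdist_cr by (simp add: LIMSEQ_const_iff)
qed

text \<open>
  The critical orbit accumulates only on the cycle, which does not contain the critical point.
\<close>

lemma y_away:
  obtains \<Delta> where "\<Delta> > 0" "\<And>j. j > 0 \<Longrightarrow> \<Delta> \<le> \<bar>y j - cr 0\<bar>"
proof -
  define \<delta> where "\<delta> = infdist (cr 0) P / 2"
  have \<delta>: "\<delta> > 0" using infdist_cr by (simp add: \<delta>_def)
  obtain N s where N: "\<And>i. \<bar>y (N + i) - orb (s + i)\<bar> \<le> \<delta>" using asymptotic_phase[OF \<delta>] by blast
  have tail: "\<delta> \<le> \<bar>y j - cr 0\<bar>" if "j \<ge> N" for j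
  proof -
    obtain i where i: "j = N + i" using le_Suc_ex[of N j] \<open>N \<le> j\<close> by blast
    have "2 * \<delta> \<le> \<bar>cr 0 - orb (s + i)\<bar>"
      using infdist_le[of "orb (s + i)" P "cr 0"] by (auto simp: \<delta>_def forward_orbit_def dist_real_def)
    then show ?thesis using N[of i] unfolding i by linarith
  qed
  define D where "D = insert \<delta> ((\<lambda>j. \<bar>y j - cr 0\<bar>) ` {0<..<N})"
  have fin: "finite D" by (simp add: D_def)
  have pos: "Min D > 0" using fin \<delta> y_neq_cr by (subst Min_gr_iff) (auto simp: D_def)
  have "Min D \<le> \<bar>y j - cr 0\<bar>" if "j > 0" for j
  proof (cases "j < N")
    case True
    then show ?thesis using that by (intro Min_le[OF fin]) (auto simp: D_def)
  next
    case False
    moreover have "Min D \<le> \<delta>" by (intro Min_le[OF fin]) (simp add: D_def)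
    ultimately show ?thesis using tail[of j] by simp
  qed
  then show ?thesis using that pos by blast
qed

lemma \<theta>_Suc: "G0.\<theta> (Suc j) = G0.\<theta> j * sgn (cr 0 - y (Suc j))"
  using y_neq_cr[of "Suc j"] by (simp add: G0.\<theta>.simps(2) del: funpow.simps)

text \<open>
  Eventually the critical orbit is on the same side of the critical point as the cycle, so each sign is
  obtained from the previous one by a \<open>k\<close>-periodic factor. The product of the factors over one period can
  be \<open>-1\<close>, so the signs themselves have period \<open>2 * k\<close>.
\<close>

lemma kneading_eventually_periodic: "G0.eventually_periodic"
proof -
  define \<delta> where "\<delta> = infdist (cr 0) P / 2"
  have \<delta>: "\<delta> > 0" using infdist_cr by (simp add: \<delta>_def)
  obtain N s where N: "\<And>i. \<bar>y (N + i) - orb (s + i)\<bar> \<le> \<delta>" using asymptotic_phase[OF \<delta>] by blast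
  have same: "sgn (cr 0 - y (j + k)) = sgn (cr 0 - y j)" if "j \<ge> N" for j
  proof -
    obtain i where i: "j = N + i" using le_Suc_ex[of N j] \<open>N \<le> j\<close> by blast
    have "2 * \<delta> \<le> \<bar>cr 0 - orb (s + i)\<bar>"
      using infdist_le[of "orb (s + i)" P "cr 0"] by (auto simp: \<delta>_def forward_orbit_def dist_real_def)
    moreover have "\<bar>y (j + k) - orb (s + i)\<bar> \<le> \<delta>"
      using N[of "i + k"] orb_periodic[of "s + i"] by (simp add: i add.assoc)
    ultimately show ?thesis using N[of i] \<delta> unfolding i[symmetric] sgn_if by (smt (verit))
  qed
  have ratio: "G0.\<theta> (j + k) * G0.\<theta> j = G0.\<theta> (N + k) * G0.\<theta> N" if "j \<ge> N" for j
    using that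
  proof (induction j rule: dec_induct)
    case (step j)
    have "sgn (cr 0 - y (Suc j)) * sgn (cr 0 - y (Suc j)) = 1"
      using y_neq_cr[of "Suc j"] by (auto simp: sgn_if simp del: funpow.simps)
    moreover have "sgn (cr 0 - y (Suc (j + k))) = sgn (cr 0 - y (Suc j))" using same[of "Suc j"] step.hyps by simp
    moreover have "G0.\<theta> (Suc j + k) * G0.\<theta> (Suc j)
        = (G0.\<theta> (j + k) * G0.\<theta> j) * (sgn (cr 0 - y (Suc (j + k))) * sgn (cr 0 - y (Suc j)))"
      unfolding add_Suc \<theta>_Suc by (simp only: mult_ac)
    ultimately show ?case using step.IH by simp
  qed simp
  have "G0.\<theta> (j + 2 * k) = G0.\<theta> j" if "j \<ge> N" for j
  proof -
    have "G0.\<theta> (j + k + k) * G0.\<theta> (j + k) = G0.\<theta> (j + k) * G0.\<theta> j" using ratio[of j] ratio[of "j + k"] that by simp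
    moreover have "G0.\<theta> (j + k) \<noteq> 0" using G0.\<theta>_cases[of "j + k"] by auto
    ultimately show ?thesis by (simp add: mult_2 add.assoc)
  qed
  then show ?thesis unfolding G0.eventually_periodic_def using k by (intro exI[of _ "2 * k"]) auto
qed

text \<open>
  The maximum of \<open>g 0\<close> is strict, and \<open>g t\<close> is uniformly close to \<open>g 0\<close>.
\<close>

lemma cr_close:
  assumes "\<delta> > 0"
  obtains t0 where "t0 > 0" "\<And>t. t \<in> {0..1} \<Longrightarrow> t < t0 \<Longrightarrow> \<bar>cr t - cr 0\<bar> < \<delta>"
proof -
  define \<epsilon> where "\<epsilon> = min \<delta> (min (1 - cr 0) (cr 0 + 1))"
  have \<epsilon>: "\<epsilon> > 0" "\<epsilon> \<le> \<delta>" "cr 0 - \<epsilon> \<in> {-1..1}" "cr 0 + \<epsilon> \<in> {-1..1}"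
    using assms G0.crit by (auto simp: \<epsilon>_def min_def)
  \<comment> \<open>the largest value of \<open>g 0\<close> outside the \<open>\<epsilon>\<close>-neighbourhood of its critical point\<close>
  define m where "m = max (g 0 (cr 0 - \<epsilon>)) (g 0 (cr 0 + \<epsilon>))"
  have m: "m < g 0 (cr 0)" using G0.f_less_crit[OF \<epsilon>(3)] G0.f_less_crit[OF \<epsilon>(4)] \<epsilon>(1) by (simp add: m_def)
  define t0 where "t0 = (g 0 (cr 0) - m) / (2 * L)"
  have "\<bar>cr t - cr 0\<bar> < \<delta>" if t: "t \<in> {0..1}" "t < t0" for t
  proof (rule ccontr)
    interpret F: unimodal_map "g t" "cr t" by (rule uni[OF t(1)])
    assume "\<not> ?thesis"
    then have far: "cr t \<le> cr 0 - \<epsilon> \<or> cr 0 + \<epsilon> \<le> cr t" using \<epsilon>(2) by linarith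
    have "g 0 (cr t) \<le> m"
      using far G0.incr_le_iff[OF F.c_in \<epsilon>(3)] G0.decr_le_iff[OF F.c_in \<epsilon>(4)] \<epsilon>(1) by (auto simp: m_def le_max_iff_disj)
    moreover have "g t (cr 0) \<le> g t (cr t)" by (rule F.f_le_crit[OF G0.c_in])
    ultimately have "g 0 (cr 0) - m \<le> 2 * (L * t)"
      using lip_t[OF t(1) G0.c_in] lip_t[OF t(1) F.c_in] by linarith
    moreover have "2 * (L * t) < g 0 (cr 0) - m" using t(2) L by (simp add: t0_def pos_less_divide_eq algebra_simps)
    ultimately show False by simp
  qed
  moreover have "t0 > 0" using m L by (simp add: t0_def)
  ultimately show ?thesis using that by blast
qed

text \<open>
  Scaling distances near \<open>orb i\<close> by \<open>weight i\<close> turns \<open>g 0\<close> into an infinitesimal isometry along the cycle.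
  The weights are periodic because the derivatives along the cycle multiply to \<open>1\<close> in absolute value.
\<close>

definition weight :: "nat \<Rightarrow> real" where
  "weight i = (\<Prod>l<i. 1 / \<bar>a 0 (orb l)\<bar>)"

lemma deriv_orb_nonzero: "a 0 (orb l) \<noteq> 0"
proof
  assume "a 0 (orb l) = 0"
  then have "a 0 (orb (l mod k)) = 0" by (simp add: orb_mod)
  then have "(\<Prod>i<k. \<bar>a 0 (orb i)\<bar>) = 0" using k by (intro prod_zero) auto
  then show False using neutral by simp
qed

lemma weight_pos: "weight i > 0"
  unfolding weight_def using deriv_orb_nonzero by (intro prod_pos) auto

lemma weight_Suc: "weight (Suc i) * \<bar>a 0 (orb i)\<bar> = weight i"
  unfolding weight_def using deriv_orb_nonzero[of i] by simp

lemma weight_periodic: "weight (i + k) = weight i"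
proof (induction i)
  case 0
  have "weight k * (\<Prod>i<k. \<bar>a 0 (orb i)\<bar>) = 1"
    unfolding weight_def prod.distrib[symmetric] using deriv_orb_nonzero by (intro prod.neutral) auto
  then show ?case using neutral by (simp add: weight_def)
next
  case (Suc i)
  have "weight (Suc i + k) * \<bar>a 0 (orb i)\<bar> = weight (Suc i) * \<bar>a 0 (orb i)\<bar>"
    using weight_Suc[of "i + k"] weight_Suc[of i] Suc by (simp add: orb_periodic)
  then show ?case using deriv_orb_nonzero[of i] by simp
qed

lemma weight_mod: "weight (i mod k) = weight i"
proof (induction i rule: less_induct)
  case (less i)
  show ?case
  proof (cases "i < k")
    case False
    then have "weight ((i - k) mod k) = weight (i - k)" using less k by simp
    then show ?thesis using weight_periodic[of "i - k"] False by (simp add: le_mod_geq)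
  qed simp
qed

lemma weight_bounds:
  obtains m M where "0 < m" "m \<le> M" "\<And>i. m \<le> weight i" "\<And>i. weight i \<le> M"
proof -
  define W where "W = weight ` {..<k}"
  have W: "finite W" "W \<noteq> {}" using k by (auto simp: W_def)
  have mem: "weight i \<in> W" for i using weight_mod[of i] k by (metis W_def image_eqI lessThan_iff mod_less_divisor)
  have "Min W > 0" using W weight_pos by (subst Min_gr_iff) (auto simp: W_def)
  then show ?thesis using that[of "Min W" "Max W"] W mem by (meson Max_ge Min_le order.trans)
qed

abbreviation z :: "real \<Rightarrow> nat \<Rightarrow> real" where "z t j \<equiv> (g t ^^ j) (cr t)"

text \<open>
  Maximum values depend on the map in a Lipschitz way, so the critical values of \<open>g t\<close> and \<open>g 0\<close> are
  \<open>L * t\<close>-close even where nothing is known about the speed of \<open>cr t\<close>.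
\<close>

lemma initial_drift:
  assumes t: "t \<in> {0..1}" and "j > 0"
  shows "\<bar>z t j - y j\<bar> \<le> real j * L ^ j * t"
  using assms(2)
proof (induction j rule: nat_induct_non_zero)
  case 1
  interpret F: unimodal_map "g t" "cr t" by (rule uni[OF t])
  have "g t (cr 0) \<le> g t (cr t)" "g 0 (cr t) \<le> g 0 (cr 0)"
    using F.f_le_crit[OF G0.c_in] G0.f_le_crit[OF F.c_in] by auto
  then have "\<bar>g t (cr t) - g 0 (cr 0)\<bar> \<le> L * t"
    using lip_t[OF t G0.c_in] lip_t[OF t F.c_in] by linarith
  then show ?case by simp
next
  case (Suc j)
  interpret F: unimodal_map "g t" "cr t" by (rule uni[OF t])
  have "\<bar>z t (Suc j) - y (Suc j)\<bar> \<le> \<bar>g t (z t j) - g t (y j)\<bar> + \<bar>g t (y j) - g 0 (y j)\<bar>" by simp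
  also have "\<dots> \<le> L * \<bar>z t j - y j\<bar> + L * t"
    using lip_x[OF t F.iter_in[OF F.c_in] y_in] lip_t[OF t y_in] by (intro add_mono)
  also have "\<dots> \<le> L * (real j * L ^ j * t) + L ^ Suc j * t"
    using Suc.IH L t power_increasing[of 1 "Suc j" L] by (intro add_mono mult_left_mono mult_right_mono) auto
  also have "\<dots> = real (Suc j) * L ^ Suc j * t" by (simp add: algebra_simps)
  finally show ?case .
qed

lemma local_expansion:
  assumes "e > 0"
  obtains \<delta> where "\<delta> > 0" "\<And>t u v i. t \<in> {0..1} \<Longrightarrow> t < \<delta> \<Longrightarrow> u \<in> {-1..1} \<Longrightarrow> v \<in> {-1..1} \<Longrightarrow>
    \<bar>u - orb i\<bar> < \<delta> \<Longrightarrow> \<bar>v - orb i\<bar> < \<delta> \<Longrightarrow> \<bar>g t u - g t v\<bar> \<le> (\<bar>a 0 (orb i)\<bar> + e) * \<bar>u - v\<bar>"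
proof -
  obtain \<delta> where \<delta>: "\<delta> > 0" "\<And>t x y. t \<in> {0..1} \<Longrightarrow> x \<in> {-1..1} \<Longrightarrow> y \<in> {-1..1} \<Longrightarrow>
      t < \<delta> \<Longrightarrow> \<bar>x - y\<bar> < \<delta> \<Longrightarrow> \<bar>a t x - a 0 y\<bar> < e"
    using deriv_close[OF assms] by blast
  have "\<bar>g t u - g t v\<bar> \<le> (\<bar>a 0 (orb i)\<bar> + e) * \<bar>u - v\<bar>"
    if t: "t \<in> {0..1}" "t < \<delta>" and uv: "u \<in> {-1..1}" "v \<in> {-1..1}" "\<bar>u - orb i\<bar> < \<delta>" "\<bar>v - orb i\<bar> < \<delta>" for t u v i
  proof -
    define S where "S = {-1..1} \<inter> {orb i - \<delta><..<orb i + \<delta>}"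
    have "convex S" unfolding S_def by (intro convex_Int) auto
    moreover have "(g t has_field_derivative a t x) (at x within S)" if "x \<in> S" for x
      by (rule DERIV_subset[OF deriv[OF t(1)]]) (use that in \<open>auto simp: S_def\<close>)
    moreover have "norm (a t x) \<le> \<bar>a 0 (orb i)\<bar> + e" if x: "x \<in> S" for x
    proof -
      have "x \<in> {-1..1}" "\<bar>x - orb i\<bar> < \<delta>" using x unfolding S_def abs_less_iff by auto
      then have "\<bar>a t x - a 0 (orb i)\<bar> < e" using t G0.iter_in[OF p(1)] by (intro \<delta>(2))
      then show ?thesis by simp
    qed
    moreover have "u \<in> S" "v \<in> S" using uv by (auto simp: S_def)
    ultimately have "norm (g t u - g t v) \<le> (\<bar>a 0 (orb i)\<bar> + e) * norm (u - v)"
      by (intro field_differentiable_bound[where S = S and f' = "a t"])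
    then show ?thesis by simp
  qed
  then show ?thesis using that \<delta>(1) by blast
qed

text \<open>
  In the weighted metric the distance of the two orbits satisfies \<open>E (Suc i) \<le> (1 + \<eta>) * E i + M * L * t\<close>
  as long as it is small, hence it grows at most like \<open>(1 + \<eta>) ^ i * t\<close>.
\<close>

lemma shadowing:
  assumes "\<delta> > 0" "\<eta> > 0"
  obtains B t0 where "B > 0" "t0 > 0"
    "\<And>t j. t \<in> {0..1} \<Longrightarrow> t < t0 \<Longrightarrow> j > 0 \<Longrightarrow> B * (1 + \<eta>) ^ j * t \<le> 1 \<Longrightarrow> \<bar>z t j - y j\<bar> \<le> \<delta>"
proof -
  obtain m M where mM: "0 < m" "m \<le> M" "\<And>i. m \<le> weight i" "\<And>i. weight i \<le> M" using weight_bounds by blast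
  \<comment> \<open>the tolerance in the derivative that the weights turn into a relative error \<open>\<eta>\<close>\<close>
  define e where "e = \<eta> * m / M"
  have e: "e > 0" using assms mM by (simp add: e_def)
  obtain \<delta>1 where \<delta>1: "\<delta>1 > 0" and expand: "\<And>t u v i. t \<in> {0..1} \<Longrightarrow> t < \<delta>1 \<Longrightarrow> u \<in> {-1..1} \<Longrightarrow> v \<in> {-1..1} \<Longrightarrow>
    \<bar>u - orb i\<bar> < \<delta>1 \<Longrightarrow> \<bar>v - orb i\<bar> < \<delta>1 \<Longrightarrow> \<bar>g t u - g t v\<bar> \<le> (\<bar>a 0 (orb i)\<bar> + e) * \<bar>u - v\<bar>"
    using local_expansion[OF e] by blast
  \<comment> \<open>both orbits and the segment between them stay \<open>\<delta>1\<close>-close to the cycle\<close>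
  define \<delta>2 where "\<delta>2 = min \<delta> (\<delta>1 / 3)"
  have \<delta>2: "\<delta>2 > 0" "\<delta>2 \<le> \<delta>" "\<delta>2 \<le> \<delta>1 / 3" using assms \<delta>1 by (auto simp: \<delta>2_def)
  obtain N s where N: "N > 0" "\<And>i. \<bar>y (N + i) - orb (s + i)\<bar> \<le> \<delta>2" using asymptotic_phase[OF \<delta>2(1)] by blast
  \<comment> \<open>drift during the first \<open>N\<close> steps, plus the geometric sum of the later perturbations\<close>
  define A where "A = (M * (real N * L ^ N) + M * L / \<eta>) / m"
  have Mpos: "M > 0" using mM by simp
  have NL: "real N * L ^ N \<le> A"
  proof -
    have "m * (real N * L ^ N) \<le> M * (real N * L ^ N) + M * L / \<eta>"
      using mM L assms by (intro add_increasing2 mult_right_mono) auto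
    then show ?thesis using mM(1) by (simp add: A_def pos_le_divide_eq mult.commute)
  qed
  have A: "A > 0" using NL N(1) L by (smt (verit) mult_pos_pos of_nat_0_less_iff zero_less_power)
  define B where "B = A / \<delta>2"
  have B: "B > 0" using A \<delta>2 by (simp add: B_def)
  have main: "\<bar>z t j - y j\<bar> \<le> \<delta>" if t: "t \<in> {0..1}" "t < \<delta>1" and j: "j > 0" and time: "B * (1 + \<eta>) ^ j * t \<le> 1" for t j
  proof -
    interpret F: unimodal_map "g t" "cr t" by (rule uni[OF t(1)])
    have z_in: "z t i \<in> {-1..1}" for i by (rule F.iter_in[OF F.c_in])
    have t0: "t \<ge> 0" using t by simp
    have Atime: "A * (1 + \<eta>) ^ i * t \<le> \<delta>2" if "i \<le> j" for i
    proof -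
      have "B * (1 + \<eta>) ^ i * t \<le> B * (1 + \<eta>) ^ j * t"
        using that B assms t0 by (intro mult_right_mono mult_left_mono power_increasing) auto
      then have "B * (1 + \<eta>) ^ i * t \<le> 1" using time by simp
      then show ?thesis using \<delta>2(1) by (simp add: B_def field_simps)
    qed
    define E where "E i = weight (s + i) * \<bar>z t (N + i) - y (N + i)\<bar>" for i
    \<comment> \<open>adding \<open>c0\<close> makes the affine recursion for \<open>E\<close> linear\<close>
    define c0 where "c0 = M * L * t / \<eta>"
    have E_step: "E (Suc i) \<le> (1 + \<eta>) * E i + M * L * t" if close: "\<bar>z t (N + i) - y (N + i)\<bar> \<le> \<delta>2" for i
    proof -
      let ?z = "z t (N + i)" and ?y = "y (N + i)" and ?w = "weight (s + Suc i)"
      have "\<bar>g t ?z - g t ?y\<bar> \<le> (\<bar>a 0 (orb (s + i))\<bar> + e) * \<bar>?z - ?y\<bar>"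
        using close N(2)[of i] \<delta>2 \<delta>1 by (intro expand t z_in y_in) auto
      then have "\<bar>z t (N + Suc i) - y (N + Suc i)\<bar> \<le> (\<bar>a 0 (orb (s + i))\<bar> + e) * \<bar>?z - ?y\<bar> + L * t"
        using lip_t[OF t(1) y_in, of "N + i"] by simp
      then have "E (Suc i) \<le> ?w * ((\<bar>a 0 (orb (s + i))\<bar> + e) * \<bar>?z - ?y\<bar> + L * t)"
        unfolding E_def using weight_pos[of "s + Suc i"] by (intro mult_left_mono) auto
      also have "\<dots> = (weight (s + i) + ?w * e) * \<bar>?z - ?y\<bar> + ?w * (L * t)"
        using weight_Suc[of "s + i"] by (simp add: algebra_simps)
      also have "\<dots> \<le> (weight (s + i) + \<eta> * weight (s + i)) * \<bar>?z - ?y\<bar> + M * (L * t)"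
      proof -
        have "?w * e \<le> M * e" using mM(4) e by (intro mult_right_mono) auto
        also have "\<dots> = \<eta> * m" using Mpos by (simp add: e_def)
        also have "\<dots> \<le> \<eta> * weight (s + i)" using mM(3) assms by (intro mult_left_mono) auto
        finally show ?thesis using mM(4) L t0 by (intro add_mono mult_right_mono) auto
      qed
      finally show ?thesis by (simp add: E_def algebra_simps)
    qed
    have d_le: "\<bar>z t (N + i) - y (N + i)\<bar> \<le> (1 + \<eta>) ^ i * A * t"
      if "E i + c0 \<le> (1 + \<eta>) ^ i * (E 0 + c0)" for i
    proof -
      have "E 0 \<le> M * (real N * L ^ N * t)"
        unfolding E_def using mM(4)[of s] initial_drift[OF t(1) N(1)] mM by (intro mult_mono) auto
      moreover have "m * A = M * (real N * L ^ N) + M * L / \<eta>" using mM(1) by (simp add: A_def)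
      ultimately have "E 0 + c0 \<le> m * A * t" by (simp add: c0_def algebra_simps)
      then have "(1 + \<eta>) ^ i * (E 0 + c0) \<le> (1 + \<eta>) ^ i * (m * A * t)"
        using assms by (intro mult_left_mono) auto
      moreover have "c0 \<ge> 0" using mM L t0 assms by (simp add: c0_def)
      moreover have "m * \<bar>z t (N + i) - y (N + i)\<bar> \<le> E i" unfolding E_def using mM(3) by (intro mult_right_mono) auto
      ultimately have "m * \<bar>z t (N + i) - y (N + i)\<bar> \<le> m * ((1 + \<eta>) ^ i * A * t)"
        using that by (simp add: mult_ac)
      then show ?thesis using mM(1) by simp
    qed
    have E_bound: "E i + c0 \<le> (1 + \<eta>) ^ i * (E 0 + c0)" if "N + i \<le> j" for i
      using that
    proof (induction i)
      case (Suc i)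
      then have IH: "E i + c0 \<le> (1 + \<eta>) ^ i * (E 0 + c0)" by simp
      have "\<bar>z t (N + i) - y (N + i)\<bar> \<le> A * (1 + \<eta>) ^ i * t" using d_le[OF IH] by (simp add: mult_ac)
      also have "\<dots> \<le> \<delta>2" using Suc.prems by (intro Atime) simp
      finally have "E (Suc i) \<le> (1 + \<eta>) * E i + M * L * t" by (rule E_step)
      moreover have "M * L * t + c0 = (1 + \<eta>) * c0" using assms by (simp add: c0_def field_simps)
      ultimately have "E (Suc i) + c0 \<le> (1 + \<eta>) * (E i + c0)" by (simp add: distrib_left)
      also have "\<dots> \<le> (1 + \<eta>) * ((1 + \<eta>) ^ i * (E 0 + c0))" using IH assms by (intro mult_left_mono) auto
      finally show ?case by simp
    qed simp
    have "\<bar>z t j - y j\<bar> \<le> \<delta>2"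
    proof (cases "j \<le> N")
      case True
      have "\<bar>z t j - y j\<bar> \<le> real j * L ^ j * t" by (rule initial_drift[OF t(1) j])
      also have "\<dots> \<le> real N * L ^ N * t"
        using True L t0 by (intro mult_right_mono mult_mono power_increasing) auto
      also have "\<dots> \<le> A * (1 + \<eta>) ^ 0 * t" using NL t0 by (simp add: mult_right_mono)
      also have "\<dots> \<le> \<delta>2" by (rule Atime) simp
      finally show ?thesis .
    next
      case False
      then obtain i where i: "j = N + i" by (metis le_Suc_ex nat_le_linear)
      have "\<bar>z t j - y j\<bar> \<le> A * (1 + \<eta>) ^ i * t" using d_le[OF E_bound[of i]] by (simp add: i mult_ac)
      also have "\<dots> \<le> \<delta>2" using i by (intro Atime) simp
      finally show ?thesis .
    qed
    then show ?thesis using \<delta>2(2) by simp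
  qed
  show ?thesis by (rule that[OF B \<delta>1 main])
qed

text \<open>
  Two orbits that differ by a third of the distance which the critical orbit keeps from the critical point
  lie on the same side of their critical points.
\<close>

lemma long_agreement:
  assumes "\<eta> > 0"
  obtains B t0 where "B > 0" "t0 > 0"
    "\<And>t n. t \<in> {0..1} \<Longrightarrow> t < t0 \<Longrightarrow> B * (1 + \<eta>) ^ n * t \<le> 1 \<Longrightarrow> G0.agrees n (g t) (cr t)"
proof -
  obtain \<Delta> where \<Delta>: "\<Delta> > 0" "\<And>j. j > 0 \<Longrightarrow> \<Delta> \<le> \<bar>y j - cr 0\<bar>" using y_away by blast
  have D3: "\<Delta> / 3 > 0" using \<Delta>(1) by simp
  obtain B t1 where B: "B > 0" "t1 > 0" and shadow:
    "\<And>t j. t \<in> {0..1} \<Longrightarrow> t < t1 \<Longrightarrow> j > 0 \<Longrightarrow> B * (1 + \<eta>) ^ j * t \<le> 1 \<Longrightarrow> \<bar>z t j - y j\<bar> \<le> \<Delta> / 3"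
    using shadowing[OF D3 assms] by blast
  obtain t2 where t2: "t2 > 0" "\<And>t. t \<in> {0..1} \<Longrightarrow> t < t2 \<Longrightarrow> \<bar>cr t - cr 0\<bar> < \<Delta> / 3"
    using cr_close[OF D3] by blast
  have "G0.agrees n (g t) (cr t)" if t: "t \<in> {0..1}" "t < min t1 t2" and time: "B * (1 + \<eta>) ^ n * t \<le> 1" for t n
  proof -
    interpret F: unimodal_map "g t" "cr t" by (rule uni[OF t(1)])
    have "F.\<theta> i = G0.\<theta> i" if "i < n" for i
      using that
    proof (induction i)
      case (Suc i)
      have "B * (1 + \<eta>) ^ Suc i * t \<le> B * (1 + \<eta>) ^ n * t"
        using Suc.prems B assms t by (intro mult_right_mono mult_left_mono power_increasing) auto
      then have "\<bar>z t (Suc i) - y (Suc i)\<bar> \<le> \<Delta> / 3" using t time by (intro shadow) auto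
      moreover have "\<bar>cr t - cr 0\<bar> < \<Delta> / 3" using t by (intro t2) auto
      moreover have "\<Delta> \<le> \<bar>y (Suc i) - cr 0\<bar>" by (rule \<Delta>(2)) simp
      ultimately have "z t (Suc i) \<noteq> cr t" "sgn (cr t - z t (Suc i)) = sgn (cr 0 - y (Suc i))"
        using sgn_stable[of "z t (Suc i)" "y (Suc i)" \<Delta> "cr t" "cr 0"] \<Delta>(1) by blast+
      then show ?case using Suc by (simp add: F.\<theta>.simps(2) \<theta>_Suc del: funpow.simps)
    qed simp
    then show ?thesis by (simp add: G0.agrees_def F.unimodal_map_axioms)
  qed
  then show ?thesis using that[of B "min t1 t2"] B t2(1) by auto
qed

text \<open>
  The rate \<open>\<eta>\<close> is chosen such that one more step of agreement, which costs a factor \<open>1 + \<eta>\<close> in \<open>t\<close>, gains the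
  factor \<open>\<rho> = (1 + \<eta>) powr (- \<beta>)\<close> in the entropy.
\<close>

theorem entropy_flat:
  assumes "\<beta> > 0"
  obtains C where "C > 0" "\<And>t. t \<in> {0..1} \<Longrightarrow>
    \<bar>real_of_ereal (top_entropy (g t) {-1..1}) - real_of_ereal (top_entropy (g 0) {-1..1})\<bar> \<le> C * t powr \<beta>"
proof -
  define h where "h t = real_of_ereal (top_entropy (g t) {-1..1})" for t
  have h: "h t = ln (unimodal_map.growth (g t))" if "t \<in> {0..1}" for t
    using unimodal_map.entropy_eq[OF uni[OF that]] by (simp add: h_def)
  obtain C \<rho> where C: "0 \<le> C" and \<rho>: "0 < \<rho>" "\<rho> < 1" and close:
    "\<And>n f' c'. G0.agrees n f' c' \<Longrightarrow> \<bar>ln (unimodal_map.growth f') - ln G0.growth\<bar> \<le> C * \<rho> ^ n"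
    using G0.entropy_exponentially_close[OF kneading_eventually_periodic] by blast
  define \<eta> where "\<eta> = \<rho> powr (- 1 / \<beta>) - 1"
  have eta: "\<eta> > 0" using \<rho> assms powr_less_mono2_neg[of "- 1 / \<beta>" \<rho> 1] by (simp add: \<eta>_def)
  have \<rho>\<eta>: "\<rho> = (1 + \<eta>) powr (- \<beta>)" using \<rho> assms by (simp add: \<eta>_def powr_powr)
  obtain B t0 where B: "B > 0" "t0 > 0" and agree:
    "\<And>t n. t \<in> {0..1} \<Longrightarrow> t < t0 \<Longrightarrow> B * (1 + \<eta>) ^ n * t \<le> 1 \<Longrightarrow> G0.agrees n (g t) (cr t)"
    using long_agreement[OF eta] by blast
  define t1 where "t1 = min t0 (1 / B)"
  have t1: "t1 > 0" using B by (simp add: t1_def)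
  \<comment> \<open>the second summand serves the parameters \<open>t \<ge> t1\<close>, where the entropies differ by at most \<open>1\<close>\<close>
  define D where "D = C * (B * (1 + \<eta>)) powr \<beta> + t1 powr (- \<beta>)"
  have D: "D > 0" unfolding D_def using C t1 by (intro add_nonneg_pos) auto
  have "\<bar>h t - h 0\<bar> \<le> D * t powr \<beta>" if t: "t \<in> {0..1}" for t
  proof -
    interpret F: unimodal_map "g t" "cr t" by (rule uni[OF t])
    have ht: "h t = ln F.growth" "h 0 = ln G0.growth" using h t by auto
    consider "t = 0" | "0 < t" "t < t1" | "t \<ge> t1" using t by fastforce
    then show ?thesis
    proof cases
      case 2
      have "1 < 1 / (B * t)" using 2 B by (simp add: t1_def field_simps)
      obtain n0 where "1 / (B * t) < (1 + \<eta>) ^ n0" using real_arch_pow[of "1 + \<eta>" "1 / (B * t)"] eta by auto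
      \<comment> \<open>the longest time \<open>n = q - 1\<close> for which agreement is guaranteed\<close>
      define q where "q = (LEAST n. 1 / (B * t) < (1 + \<eta>) ^ n)"
      have q: "1 / (B * t) < (1 + \<eta>) ^ q" unfolding q_def by (rule LeastI) fact
      with \<open>1 < 1 / (B * t)\<close> have "q \<noteq> 0" by (cases q) auto
      then obtain n where n: "q = Suc n" by (cases q) auto
      have "\<not> 1 / (B * t) < (1 + \<eta>) ^ n" 
        using not_less_Least[of n "\<lambda>n. 1 / (B * t) < (1 + \<eta>) ^ n"] n unfolding q_def by simp
      then have "B * (1 + \<eta>) ^ n * t \<le> 1" using B 2 by (simp add: field_simps)
      then have "G0.agrees n (g t) (cr t)" using 2 t by (intro agree) (auto simp: t1_def)
      then have "\<bar>h t - h 0\<bar> \<le> C * \<rho> ^ n" unfolding ht by (rule close)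
      also have "\<rho> ^ n \<le> (B * (1 + \<eta>) * t) powr \<beta>"
      proof -
        have "1 \<le> B * t * (1 + \<eta>) ^ Suc n" using q B 2 by (simp add: n field_simps)
        then have "inverse ((1 + \<eta>) ^ n) \<le> B * (1 + \<eta>) * t" using eta by (simp add: field_simps)
        then have "inverse ((1 + \<eta>) ^ n) powr \<beta> \<le> (B * (1 + \<eta>) * t) powr \<beta>"
          using eta assms by (intro powr_mono2) auto
        moreover have "\<rho> ^ n = inverse ((1 + \<eta>) ^ n) powr \<beta>"
          using eta unfolding \<rho>\<eta> by (simp add: powr_realpow[symmetric] powr_powr powr_minus[symmetric] mult.commute)
        ultimately show ?thesis by simp
      qed
      also have "C * (B * (1 + \<eta>) * t) powr \<beta> = C * (B * (1 + \<eta>)) powr \<beta> * t powr \<beta>"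
        using B eta 2 by (simp add: powr_mult)
      also have "\<dots> \<le> D * t powr \<beta>" unfolding D_def by (intro mult_right_mono) auto
      finally show ?thesis using C by (simp add: mult_left_mono)
    next
      case 3
      have "\<bar>h t - h 0\<bar> \<le> 1"
        using F.growth_ge1 F.growth_le2 G0.growth_ge1 G0.growth_le2
          ln_le_minus_one[of F.growth] ln_le_minus_one[of G0.growth]
          ln_ge_zero[of F.growth] ln_ge_zero[of G0.growth] unfolding ht by linarith
      also have "1 = t1 powr (- \<beta>) * t1 powr \<beta>" using t1 by (simp add: powr_add[symmetric])
      also have "\<dots> \<le> D * t powr \<beta>"
        unfolding D_def using 3 t1 assms C by (intro mult_mono powr_mono2) auto
      finally show ?thesis .
    qed simp
  qed
  then show ?thesis using that[of D] D by (simp add: h_def)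
qed

end

section \<open>Smooth families\<close>

lemma increasing_if_deriv_pos:
  fixes f b :: "real \<Rightarrow> real"
  assumes "\<And>x. x \<in> {-1..1} \<Longrightarrow> (f has_real_derivative b x) (at x within {-1..1})"
    and "-1 \<le> l" "r \<le> 1" "\<And>x. l < x \<Longrightarrow> x < r \<Longrightarrow> 0 < b x"
    and "l \<le> x" "x < y" "y \<le> r"
  shows "f x < f y"
proof -
  have "\<exists>\<xi>\<in>{x<..<y}. f y - f x = b \<xi> * (y - x)"
  proof (rule mvt_simple[OF assms(6)])
    fix u assume "x \<le> u" "u \<le> y"
    then have "(f has_real_derivative b u) (at u within {x..y})"
      using assms by (intro DERIV_subset[OF assms(1)]) auto
    then show "(f has_derivative (*) (b u)) (at u within {x..y})" by (simp add: has_field_derivative_def)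
  qed
  then obtain \<xi> where "\<xi> \<in> {x<..<y}" "f y - f x = b \<xi> * (y - x)" by blast
  moreover from this have "0 < b \<xi> * (y - x)" using assms(5-7) by (intro mult_pos_pos assms(4)) auto
  ultimately show ?thesis by simp
qed

lemma constant_sign:
  fixes b :: "real \<Rightarrow> real"
  assumes "continuous_on S b" "connected S" "\<And>x. x \<in> S \<Longrightarrow> b x \<noteq> 0"
  shows "(\<forall>x\<in>S. 0 < b x) \<or> (\<forall>x\<in>S. b x < 0)"
proof (rule ccontr)
  assume "\<not> ?thesis"
  then obtain x y where xy: "x \<in> S" "y \<in> S" "b x \<le> 0" "0 \<le> b y" by fastforce
  have "connected (b ` S)" using assms by (intro connected_continuous_image)
  then have "0 \<in> b ` S" using xy connectedD_interval[of "b ` S" "b x" "b y" 0] by auto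
  then show False using assms(3) by auto
qed

lemma turning_point_not_monotone:
  assumes "turning_point f c"
  shows "\<not> (\<forall>x y. -1 \<le> x \<longrightarrow> x < y \<longrightarrow> y \<le> 1 \<longrightarrow> f x < f y)"
    and "\<not> (\<forall>x y. -1 \<le> x \<longrightarrow> x < y \<longrightarrow> y \<le> 1 \<longrightarrow> f y < f x)"
proof -
  have c: "-1 < c" "c < 1" using assms by (auto simp: turning_point_def)
  obtain d where d: "d > 0" "(\<forall>x. x \<noteq> c \<and> dist x c < d \<longrightarrow> f x \<le> f c) \<or> (\<forall>x. x \<noteq> c \<and> dist x c < d \<longrightarrow> f c \<le> f x)"
    using assms unfolding turning_point_def eventually_at by auto
  define h where "h = min (d / 2) (min ((1 - c) / 2) ((c + 1) / 2))"
  have h: "h > 0" "h < d" "c + h \<le> 1" "-1 \<le> c - h" using d c by (auto simp: h_def min_def field_simps)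
  have D: "dist (c + h) c < d" "dist (c - h) c < d" using h by (auto simp: dist_real_def)
  show "\<not> (\<forall>x y. -1 \<le> x \<longrightarrow> x < y \<longrightarrow> y \<le> 1 \<longrightarrow> f x < f y)"
  proof
    assume m: "\<forall>x y. -1 \<le> x \<longrightarrow> x < y \<longrightarrow> y \<le> 1 \<longrightarrow> f x < f y"
    have "f (c - h) < f c" "f c < f (c + h)" using m h c by auto
    then show False using d(2) D h by (smt (verit))
  qed
  show "\<not> (\<forall>x y. -1 \<le> x \<longrightarrow> x < y \<longrightarrow> y \<le> 1 \<longrightarrow> f y < f x)"
  proof
    assume m: "\<forall>x y. -1 \<le> x \<longrightarrow> x < y \<longrightarrow> y \<le> 1 \<longrightarrow> f y < f x"
    have "f c < f (c - h)" "f (c + h) < f c" using m h c by auto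
    then show False using d(2) D h by (smt (verit))
  qed
qed

text \<open>
  Away from \<open>c\<close> the derivative has no zero, so it has a constant sign on either side, and the two signs
  differ because \<open>c\<close> is a local extremum. Monotonicity then forces both end points to go to the same
  end point, \<open>-1\<close> for a maximum and \<open>1\<close> for a minimum.
\<close>

lemma C2_unimodal_normal_form:
  assumes "C2_unimodal f" "turning_point f c" and s: "s = - f (-1)"
  shows "s = 1 \<or> s = -1" and "unimodal_map (\<lambda>x. s * f (s * x)) (s * c)"
proof -
  have uni: "unimodal f" and C2: "C2_on {-1..1} f"
    and crit: "\<And>x. x \<in> {-1..1} \<Longrightarrow> (f has_real_derivative 0) (at x within {-1..1}) \<longleftrightarrow> turning_point f x"
    using assms(1) by (auto simp: C2_unimodal_def)
  have cont: "continuous_on {-1..1} f" and range: "f ` {-1..1} \<subseteq> {-1..1}" and bd: "f ` {-1, 1} \<subseteq> {-1, 1}"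
    and unique: "\<And>x. turning_point f x \<Longrightarrow> x = c"
    using uni assms(2) by (auto simp: unimodal_def)
  have c: "-1 < c" "c < 1" using assms(2) by (auto simp: turning_point_def)
  have "c \<in> {-1..1}" using c by simp
  then have fc: "f c \<in> {-1..1}" using range by blast
  have fe: "f (-1) = -1 \<or> f (-1) = 1" "f 1 = -1 \<or> f 1 = 1" using bd by auto
  show "s = 1 \<or> s = -1" using fe s by auto
  obtain f' where f': "\<And>x. x \<in> {-1..1} \<Longrightarrow> (f has_derivative blinfun_apply (f' x)) (at x within {-1..1})"
    and C1: "C1_on {-1..1} f'" using C2 unfolding C2_on_def by blast
  obtain f'' where f'': "\<And>x. x \<in> {-1..1} \<Longrightarrow> (f' has_derivative blinfun_apply (f'' x)) (at x within {-1..1})"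
    using C1 unfolding C1_on_def by blast
  have "continuous_on {-1..1} f'" using f'' by (rule has_derivative_continuous_on)
  then have bcont: "continuous_on {-1..1} (\<lambda>x. blinfun_apply (f' x) 1)" by (intro continuous_intros)
  define b where "b x = blinfun_apply (f' x) 1" for x
  have b: "(f has_real_derivative b x) (at x within {-1..1})" if "x \<in> {-1..1}" for x
  proof -
    have "blinfun_apply (f' x) = (*) (b x)"
    proof
      fix h show "blinfun_apply (f' x) h = b x * h"
        using blinfun.scaleR_right[of "f' x" h 1] by (simp add: b_def mult.commute)
    qed
    then show ?thesis using f'[OF that] by (simp add: has_field_derivative_def)
  qed
  have nb: "((\<lambda>x. - f x) has_real_derivative - b x) (at x within {-1..1})" if "x \<in> {-1..1}" for x
    using b[OF that] by (rule DERIV_minus)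
  have b_nz: "b x \<noteq> 0" if "x \<in> {-1..1}" "x \<noteq> c" for x
    using crit[OF that(1)] unique[of x] b[OF that(1)] that(2) by auto
  have left: "(\<forall>x\<in>{-1..<c}. 0 < b x) \<or> (\<forall>x\<in>{-1..<c}. b x < 0)"
    using c b_nz by (intro constant_sign continuous_on_subset[OF bcont[folded b_def]]) auto
  have right: "(\<forall>x\<in>{c<..1}. 0 < b x) \<or> (\<forall>x\<in>{c<..1}. b x < 0)"
    using c b_nz by (intro constant_sign continuous_on_subset[OF bcont[folded b_def]]) auto
  have up_left: "f x < f y" if "\<forall>x\<in>{-1..<c}. 0 < b x" "-1 \<le> x" "x < y" "y \<le> c" for x y
    using c that by (intro increasing_if_deriv_pos[OF b, of "-1" c]) auto
  have down_left: "f y < f x" if "\<forall>x\<in>{-1..<c}. b x < 0" "-1 \<le> x" "x < y" "y \<le> c" for x y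
    using increasing_if_deriv_pos[OF nb, of "-1" c x y] c that by auto
  have up_right: "f x < f y" if "\<forall>x\<in>{c<..1}. 0 < b x" "c \<le> x" "x < y" "y \<le> 1" for x y
    using c that by (intro increasing_if_deriv_pos[OF b, of c 1]) auto
  have down_right: "f y < f x" if "\<forall>x\<in>{c<..1}. b x < 0" "c \<le> x" "x < y" "y \<le> 1" for x y
    using increasing_if_deriv_pos[OF nb, of c 1 x y] c that by auto
  have glue_up: "\<not> ((\<forall>x\<in>{-1..<c}. 0 < b x) \<and> (\<forall>x\<in>{c<..1}. 0 < b x))"
  proof
    assume h: "(\<forall>x\<in>{-1..<c}. 0 < b x) \<and> (\<forall>x\<in>{c<..1}. 0 < b x)"
    have "f x < f y" if "-1 \<le> x" "x < y" "y \<le> 1" for x y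
    proof -
      consider "y \<le> c" | "c \<le> x" | "x < c" "c < y" by linarith
      then show ?thesis using up_left[of x y] up_right[of x y] up_left[of x c] up_right[of c y] h that
        by cases auto
    qed
    then show False using turning_point_not_monotone(1)[OF assms(2)] by blast
  qed
  have glue_down: "\<not> ((\<forall>x\<in>{-1..<c}. b x < 0) \<and> (\<forall>x\<in>{c<..1}. b x < 0))"
  proof
    assume h: "(\<forall>x\<in>{-1..<c}. b x < 0) \<and> (\<forall>x\<in>{c<..1}. b x < 0)"
    have "f y < f x" if "-1 \<le> x" "x < y" "y \<le> 1" for x y
    proof -
      consider "y \<le> c" | "c \<le> x" | "x < c" "c < y" by linarith
      then show ?thesis using down_left[of x y] down_right[of x y] down_left[of x c] down_right[of c y] h that
        by cases auto
    qed
    then show False using turning_point_not_monotone(2)[OF assms(2)] by blast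
  qed
  consider (peak) "\<forall>x\<in>{-1..<c}. 0 < b x" "\<forall>x\<in>{c<..1}. b x < 0"
    | (valley) "\<forall>x\<in>{-1..<c}. b x < 0" "\<forall>x\<in>{c<..1}. 0 < b x"
    using left right glue_up glue_down by blast
  then show "unimodal_map (\<lambda>x. s * f (s * x)) (s * c)"
  proof cases
    case peak
    have e: "f (-1) = -1" "f 1 = -1"
      using up_left[OF peak(1), of "-1" c] down_right[OF peak(2), of c 1] c fc fe by auto
    then have "s = 1" by (simp add: s)
    then show ?thesis
      using cont e c fc up_left[OF peak(1)] down_right[OF peak(2)] by unfold_locales auto
  next
    case valley
    have e: "f (-1) = 1" "f 1 = 1"
      using down_left[OF valley(1), of "-1" c] up_right[OF valley(2), of c 1] c fc fe by auto
    then have s1: "s = -1" by (simp add: s)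
    have "continuous_on {-1..1} (\<lambda>x. - f (- x))"
      by (intro continuous_intros continuous_on_compose2[OF cont]) auto
    then show ?thesis unfolding s1
      using e c fc down_left[OF valley(1)] up_right[OF valley(2)] by unfold_locales auto
  qed
qed

lemma funpow_conj:
  fixes s :: real
  assumes "s * s = 1"
  shows "((\<lambda>x. s * f (s * x)) ^^ n) x = s * (f ^^ n) (s * x)"
proof -
  have ss: "s * (s * u) = u" for u using assms by (metis mult.assoc mult_1)
  show ?thesis by (induction n) (simp_all add: ss)
qed

lemma forward_orbit_conj:
  fixes s :: real
  assumes "s * s = 1"
  shows "forward_orbit (\<lambda>x. s * f (s * x)) (s * x) = (*) s ` forward_orbit f x"
proof -
  have ss: "s * (s * u) = u" for u using assms by (metis mult.assoc mult_1)
  show ?thesis unfolding forward_orbit_def by (simp add: funpow_conj[OF assms] image_image ss)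
qed

lemma dist_conj: fixes s :: real assumes "s = 1 \<or> s = -1" shows "dist (s * u) (s * v) = dist u v"
  using assms by (auto simp: dist_real_def abs_minus_commute)

lemma infdist_conj:
  fixes s :: real
  assumes "s = 1 \<or> s = -1"
  shows "infdist (s * x) ((*) s ` A) = infdist x A"
  unfolding infdist_def by (simp add: image_image dist_conj[OF assms])

text \<open>
  The reflection is an isometry, so it carries separated sets to separated sets.
\<close>

lemma top_entropy_conj:
  fixes s :: real
  assumes s: "s = 1 \<or> s = -1"
  shows "top_entropy (\<lambda>x. s * f (s * x)) {-1..1} = top_entropy f {-1..1}"
proof -
  have ss: "s * s = 1" using s by auto
  then have ss': "s * (s * u) = u" for u by (metis mult.assoc mult_1)
  have inj: "inj ((*) s)" using s by (auto intro: injI)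
  let ?F = "\<lambda>x. s * f (s * x)"
  have sep: "(*) s ` E \<in> separated_sets (\<lambda>x. s * g (s * x)) {-1..1} n \<epsilon>" if "E \<in> separated_sets g {-1..1} n \<epsilon>" for E g n \<epsilon>
  proof -
    have "(*) s ` E \<subseteq> {-1..1}" using that s by (auto simp: separated_sets_def)
    then show ?thesis using that unfolding separated_sets_def
      by (auto simp: funpow_conj[OF ss] ss' dist_conj[OF s])
  qed
  have inverse: "(\<lambda>x. s * ?F (s * x)) = f" by (simp add: ss')
  have "separated_sets ?F {-1..1} n \<epsilon> = (`) ((*) s) ` separated_sets f {-1..1} n \<epsilon>" for n \<epsilon>
  proof (intro subset_antisym subsetI)
    fix E assume "E \<in> separated_sets ?F {-1..1} n \<epsilon>"
    from sep[OF this] have "(*) s ` E \<in> separated_sets f {-1..1} n \<epsilon>" unfolding inverse .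
    moreover have "E = (*) s ` ((*) s ` E)" by (simp add: image_image ss')
    ultimately show "E \<in> (`) ((*) s) ` separated_sets f {-1..1} n \<epsilon>" by blast
  qed (use sep in auto)
  moreover have "card ((*) s ` E) = card E" for E using inj by (intro card_image) (auto simp: inj_on_def)
  ultimately show ?thesis unfolding top_entropy_def by (simp add: image_image)
qed

lemma funpow_has_real_derivative:
  fixes f b :: "real \<Rightarrow> real"
  assumes "\<And>x. x \<in> S \<Longrightarrow> (f has_real_derivative b x) (at x within S)" "f ` S \<subseteq> S" "x \<in> S"
  shows "((f ^^ n) has_real_derivative (\<Prod>i<n. b ((f ^^ i) x))) (at x within S)"
proof (induction n)
  case (Suc n)
  have in_S: "(f ^^ n) u \<in> S" if "u \<in> S" for u by (induction n) (use assms(2) that in auto)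
  have "(f has_real_derivative b ((f ^^ n) x)) (at ((f ^^ n) x) within (f ^^ n) ` S)"
    using in_S assms(3) by (intro DERIV_subset[OF assms(1)]) auto
  from DERIV_image_chain[OF this Suc] show ?case by (simp add: mult.commute o_def)
qed (simp add: id_def)

theorem theorem7:
  fixes G :: "real \<times> real \<Rightarrow> real" and c :: real and P :: "real set" and k :: nat
  assumes "C2_on ({-1..1} \<times> {0..1}) G"
    and "\<And>t. t \<in> {0..1} \<Longrightarrow> C2_unimodal (\<lambda>x. G (x, t))"
    and "turning_point (\<lambda>x. G (x, 0)) c"
    and "parabolic_orbit (\<lambda>x. G (x, 0)) k P"
    and "attracts (\<lambda>x. G (x, 0)) P c"
    and "P \<inter> forward_orbit (\<lambda>x. G (x, 0)) c = {}"
  shows "Hoel {0..1} (family_entropy G) 0 = \<infinity>"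
proof -
  let ?R = "{-1..1} \<times> {0..1} :: (real \<times> real) set"
  obtain G' where G': "\<And>z. z \<in> ?R \<Longrightarrow> (G has_derivative blinfun_apply (G' z)) (at z within ?R)"
    and C1: "C1_on ?R G'" using assms(1) unfolding C2_on_def by blast
  obtain G'' where G'': "\<And>z. z \<in> ?R \<Longrightarrow> (G' has_derivative blinfun_apply (G'' z)) (at z within ?R)"
    using C1 unfolding C1_on_def by blast
  have G'cont: "continuous_on ?R G'" using G'' by (rule has_derivative_continuous_on)
  have Gcont: "continuous_on ?R G" using G' by (rule has_derivative_continuous_on)
  have R: "compact ?R" "convex ?R" by (auto intro: compact_Times convex_Times)

  \<comment> \<open>\<open>s = 1\<close> if the maps have a maximum, \<open>s = -1\<close> if they have a minimum; conjugation by \<open>x \<mapsto> s * x\<close> gives the normal form\<close>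
  define s where "s = - G (-1, 0)"
  \<comment> \<open>the turning point, which is unique\<close>
  define tp where "tp t = (THE u. turning_point (\<lambda>x. G (x, t)) u)" for t
  have unique_tp: "\<exists>!u. turning_point (\<lambda>x. G (x, t)) u" and ends: "G (-1, t) \<in> {-1, 1}" if "t \<in> {0..1}" for t
    using assms(2)[OF that] unfolding C2_unimodal_def unimodal_def by blast+
  have tp: "turning_point (\<lambda>x. G (x, t)) (tp t)" if "t \<in> {0..1}" for t
    unfolding tp_def using unique_tp[OF that] by (rule theI')
  have tp0: "tp 0 = c"
    unfolding tp_def using unique_tp[of 0] assms(3) by (intro the1_equality) simp_all
  have s_const: "s = - G (-1, t)" if t: "t \<in> {0..1}" for t
  proof (rule ccontr)
    assume ne: "s \<noteq> - G (-1, t)"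
    have "continuous_on {0..1} (\<lambda>u. G (-1, u))"
      by (intro continuous_on_compose2[OF Gcont] continuous_intros) auto
    then have "(\<forall>u\<in>{0..1}. 0 < G (-1, u)) \<or> (\<forall>u\<in>{0..1}. G (-1, u) < 0)"
    proof (rule constant_sign)
      show "connected {0..1::real}" by simp
      show "G (-1, u) \<noteq> 0" if "u \<in> {0..1}" for u using ends[OF that] by auto
    qed
    then have "(0 < G (-1, 0) \<and> 0 < G (-1, t)) \<or> (G (-1, 0) < 0 \<and> G (-1, t) < 0)" using t by auto
    moreover have "G (-1, 0) \<in> {-1, 1}" "G (-1, t) \<in> {-1, 1}" "G (-1, 0) \<noteq> G (-1, t)"
      using ends[of 0] ends[OF t] ne by (simp_all add: s_def)
    ultimately show False by auto
  qed
  have s: "s = 1 \<or> s = -1" using ends[of 0] by (auto simp: s_def)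
  have ss: "s * s = 1" using s by auto
  have ss': "s * (s * u) = u" for u using ss by (metis mult.assoc mult_1)
  have sI: "s * u \<in> {-1..1} \<longleftrightarrow> u \<in> {-1..1}" for u using s by auto
  define g where "g t x = s * G (s * x, t)" for t x
  define a where "a t x = blinfun_apply (G' (s * x, t)) (1, 0)" for t x
  have g_eq: "g t = (\<lambda>x. s * G (s * x, t))" for t by (simp add: g_def fun_eq_iff)

  have "bounded (G' ` ?R)" using compact_continuous_image[OF G'cont R(1)] by (rule compact_imp_bounded)
  then obtain L0 where L0: "\<And>z. z \<in> ?R \<Longrightarrow> norm (G' z) \<le> L0" unfolding bounded_iff by blast
  define L where "L = max L0 1"
  have lip: "\<bar>G z - G w\<bar> \<le> L * norm (z - w)" if "z \<in> ?R" "w \<in> ?R" for z w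
  proof -
    have "norm (G z - G w) \<le> L * norm (z - w)"
    proof (rule differentiable_bound[OF R(2) G' _ that])
      fix z assume "z \<in> ?R"
      then show "onorm (blinfun_apply (G' z)) \<le> L" using L0[of z] by (simp add: L_def norm_blinfun.rep_eq[symmetric])
    qed
    then show ?thesis by simp
  qed
  obtain p where p: "p \<in> {-1..1}" "((\<lambda>x. G (x, 0)) ^^ k) p = p" "P = forward_orbit (\<lambda>x. G (x, 0)) p" "k > 0"
    and par: "\<And>x. x \<in> P \<Longrightarrow> (((\<lambda>x. G (x, 0)) ^^ k) has_real_derivative 1) (at x within {-1..1}) \<or>
            (((\<lambda>x. G (x, 0)) ^^ k) has_real_derivative -1) (at x within {-1..1})"
    using assms(4) unfolding parabolic_orbit_def periodic_orbit_def by blast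
  have G_deriv: "((\<lambda>x. G (x, t)) has_real_derivative blinfun_apply (G' (x, t)) (1, 0)) (at x within {-1..1})"
    if "t \<in> {0..1}" "x \<in> {-1..1}" for t x
  proof -
    have "((\<lambda>x. G (x, t)) has_derivative (\<lambda>h. blinfun_apply (G' (x, t)) (h, 0))) (at x within {-1..1})"
      by (rule has_derivative_in_compose2[OF G', where f = "\<lambda>x. (x, t)" and f' = "\<lambda>h. (h, 0)"])
        (use that in \<open>auto intro!: derivative_eq_intros\<close>)
    moreover have "(\<lambda>h. blinfun_apply (G' (x, t)) (h, 0)) = (*) (blinfun_apply (G' (x, t)) (1, 0))"
    proof
      fix h :: real
      show "blinfun_apply (G' (x, t)) (h, 0) = blinfun_apply (G' (x, t)) (1, 0) * h"
        using blinfun.scaleR_right[of "G' (x, t)" h "(1, 0)"] by (simp add: mult.commute)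
    qed
    ultimately show ?thesis by (simp add: has_field_derivative_def)
  qed

  interpret parabolic_family g a "\<lambda>t. s * tp t" L "s * p" k
  proof (rule parabolic_family.intro)
    show "unimodal_map (g t) (s * tp t)" if t: "t \<in> {0..1}" for t
      unfolding g_eq by (rule C2_unimodal_normal_form(2)[OF assms(2)[OF t] tp[OF t] s_const[OF t]])
    show "(g t has_real_derivative a t x) (at x within {-1..1})" if t: "t \<in> {0..1}" and x: "x \<in> {-1..1}" for t x
    proof -
      have sx: "s * x \<in> {-1..1}" using x sI by simp
      have img: "(*) s ` {-1..1} \<subseteq> {-1..1}" using s by auto
      have "((\<lambda>x. G (x, t)) \<circ> (*) s has_real_derivative a t x * s) (at x within {-1..1})"
        unfolding a_def
        by (rule DERIV_image_chain[OF DERIV_subset[OF G_deriv[OF t sx] img]])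
          (auto intro!: derivative_eq_intros)
      then have "((\<lambda>x. s * ((\<lambda>x. G (x, t)) \<circ> (*) s) x) has_real_derivative s * (a t x * s)) (at x within {-1..1})"
        by (rule DERIV_cmult)
      moreover have "s * (a t x * s) = a t x" using ss' by (simp add: mult.commute)
      ultimately show ?thesis by (simp add: g_eq o_def)
    qed
    show "\<exists>\<delta>>0. \<forall>t\<in>{0..1}. \<forall>x\<in>{-1..1}. \<forall>y\<in>{-1..1}. t < \<delta> \<longrightarrow> \<bar>x - y\<bar> < \<delta> \<longrightarrow> \<bar>a t x - a 0 y\<bar> < e"
      if e: "e > 0" for e
    proof -
      obtain d where d: "d > 0" "\<And>z w. z \<in> ?R \<Longrightarrow> w \<in> ?R \<Longrightarrow> dist w z < d \<Longrightarrow> dist (G' w) (G' z) < e"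
        using compact_uniformly_continuous[OF G'cont R(1)] e unfolding uniformly_continuous_on_def by blast
      have "\<bar>a t x - a 0 y\<bar> < e" if t: "t \<in> {0..1}" "t < d / 2" and xy: "x \<in> {-1..1}" "y \<in> {-1..1}" "\<bar>x - y\<bar> < d / 2" for t x y
      proof -
        have "dist (s * x, t) (s * y, 0) \<le> dist (s * x) (s * y) + dist t 0"
          unfolding dist_Pair_Pair by (rule sqrt_sum_squares_le_sum) auto
        also have "\<dots> < d" using t xy(3) by (simp add: dist_conj[OF s]) (simp add: dist_real_def)
        finally have "dist (G' (s * x, t)) (G' (s * y, 0)) < e" using t xy sI by (intro d(2)) auto
        moreover have "norm (blinfun_apply (G' (s * x, t) - G' (s * y, 0)) (1, 0)) \<le> norm (G' (s * x, t) - G' (s * y, 0)) * norm (1::real, 0::real)"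
          by (rule norm_blinfun)
        ultimately show ?thesis by (simp add: a_def blinfun.diff_left dist_norm norm_Pair)
      qed
      then show ?thesis using d(1) by (intro exI[of _ "d / 2"]) auto
    qed
    show "L \<ge> 1" by (simp add: L_def)
    show "\<bar>g t x - g 0 x\<bar> \<le> L * t" if "t \<in> {0..1}" "x \<in> {-1..1}" for t x
    proof -
      have "\<bar>G (s * x, t) - G (s * x, 0)\<bar> \<le> L * norm ((s * x, t) - (s * x, 0))"
        using that sI by (intro lip) auto
      moreover have "\<bar>g t x - g 0 x\<bar> = \<bar>G (s * x, t) - G (s * x, 0)\<bar>"
        using dist_conj[OF s, of "G (s * x, t)" "G (s * x, 0)"] by (simp add: g_def dist_real_def)
      ultimately show ?thesis using that by (simp add: norm_Pair)
    qed
    show "\<bar>g t x - g t y\<bar> \<le> L * \<bar>x - y\<bar>" if "t \<in> {0..1}" "x \<in> {-1..1}" "y \<in> {-1..1}" for t x y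
    proof -
      have "\<bar>G (s * x, t) - G (s * y, t)\<bar> \<le> L * norm ((s * x, t) - (s * y, t))"
        using that sI by (intro lip) auto
      moreover have "\<bar>g t x - g t y\<bar> = \<bar>G (s * x, t) - G (s * y, t)\<bar>"
        using dist_conj[OF s, of "G (s * x, t)" "G (s * y, t)"] by (simp add: g_def dist_real_def)
      ultimately show ?thesis using dist_conj[OF s, of x y] by (simp add: norm_Pair dist_real_def)
    qed
    show "k > 0" by fact
    show "s * p \<in> {-1..1}" using p(1) sI by simp
    show "(g 0 ^^ k) (s * p) = s * p" unfolding g_eq by (simp add: funpow_conj[OF ss, where f = "\<lambda>x. G (x, 0)"] ss' p(2))
    have range0: "(\<lambda>x. G (x, 0)) ` {-1..1} \<subseteq> {-1..1}"
      using assms(2)[of 0] unfolding C2_unimodal_def unimodal_def by simp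
    have "p \<in> P" unfolding p(3) forward_orbit_def by (rule range_eqI[of _ _ 0]) simp
    have chain: "(((\<lambda>x. G (x, 0)) ^^ k) has_real_derivative (\<Prod>i<k. blinfun_apply (G' (((\<lambda>x. G (x, 0)) ^^ i) p, 0)) (1, 0))) (at p within {-1..1})"
      using range0 p(1) G_deriv[of 0] by (intro funpow_has_real_derivative) auto
    have nontrivial: "at p within {-1..1} \<noteq> bot" using p(1) by (simp add: trivial_limit_within)
    have "\<bar>\<Prod>i<k. blinfun_apply (G' (((\<lambda>x. G (x, 0)) ^^ i) p, 0)) (1, 0)\<bar> = 1"
      using par[OF \<open>p \<in> P\<close>] has_field_derivative_unique[OF chain _ nontrivial] by fastforce
    then show "(\<Prod>i<k. \<bar>a 0 ((g 0 ^^ i) (s * p))\<bar>) = 1"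
      unfolding a_def g_eq by (simp add: funpow_conj[OF ss, where f = "\<lambda>x. G (x, 0)"] ss' abs_prod)
    show "(\<lambda>n. infdist ((g 0 ^^ n) (s * tp 0)) (forward_orbit (g 0) (s * p))) \<longlonglongrightarrow> 0"
      using assms(5) unfolding attracts_def g_eq tp0 forward_orbit_conj[OF ss, where f = "\<lambda>x. G (x, 0)"] p(3)[symmetric]
      by (simp add: funpow_conj[OF ss, where f = "\<lambda>x. G (x, 0)"] ss' infdist_conj[OF s])
    show "forward_orbit (g 0) (s * p) \<inter> forward_orbit (g 0) (s * tp 0) = {}"
      unfolding g_eq tp0 forward_orbit_conj[OF ss, where f = "\<lambda>x. G (x, 0)"] p(3)[symmetric]
    proof -
      have "inj ((*) s)" using s by (auto intro: injI)
      then show "(*) s ` P \<inter> (*) s ` forward_orbit (\<lambda>x. G (x, 0)) c = {}"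
        by (simp only: image_Int[symmetric] assms(6) image_empty)
    qed
  qed

  have entropy: "family_entropy G t = real_of_ereal (top_entropy (g t) {-1..1})" for t
    unfolding family_entropy_def g_eq top_entropy_conj[OF s, where f = "\<lambda>x. G (x, t)"] ..
  have hoelder: "hoelder_at \<beta> {0..1} (family_entropy G) 0" if "\<beta> > 0" for \<beta>
  proof -
    obtain C where "C > 0" "\<And>t. t \<in> {0..1} \<Longrightarrow>
      \<bar>real_of_ereal (top_entropy (g t) {-1..1}) - real_of_ereal (top_entropy (g 0) {-1..1})\<bar> \<le> C * t powr \<beta>"
      using entropy_flat[OF \<open>\<beta> > 0\<close>] by blast
    then show ?thesis unfolding hoelder_at_def entropy by (intro exI[of _ C]) auto
  qed
  show ?thesis
  proof (rule ereal_top)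
    fix B :: real
    have "ereal B \<le> ereal (max B 1)" by simp
    also have "\<dots> \<le> Hoel {0..1} (family_entropy G) 0"
      unfolding Hoel_def using hoelder[of "max B 1"] by (intro SUP_upper) auto
    finally show "ereal B \<le> Hoel {0..1} (family_entropy G) 0" .
  qed
qed

end
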